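(* Consider the multi-component Curie–Weiss Ising model described in the context, with $\beta<\beta_{cr}$. Then the Glauber dynamics exhibits a cutoff at time $t_n:=\alpha n\log n$ with window of size $n$, i.e. \[ \lim_{\gamma\to\infty}\limsup_{n\to\infty} d_n(t_n+\gamma n)=0 \quad\text{and}\quad \lim_{\gamma\to\infty}\liminf_{n\to\infty} d_n(t_n-\gamma n)=1 , \] where $\alpha=\alpha(\beta,p_i,k_{ij})$ and $\beta_{cr}=\beta_{cr}(p_i,k_{ij})$ are the constants defined in the context (in particular they do not depend on $n$).
   Context: Fix an integer $m\ge 1$, proportions $p_1,\dots,p_m>0$ with $\sum_i p_i=1$, and a symmetric matrix $\mathbf K=(k_{ij})_{1\le i,j\le m}$ with $k_{ij}>0$ for $i\neq j$ and $k_{ii}\ge 0$ (vanishing intra-block interaction $k_{ii}=0$ is allowed). The parameter $n$ ranges over positive integers with $np_i\in\mathbb N$ for all $i$. The vertex set $V=\{1,\dots,n\}$ is partitioned into blocks $G_1,\dots,G_m$ with $|G_i|=np_i$; for $v\in G_i,w\in G_j$ put $K(v,w)=k_{ij}/n$. The state space is $\Omega=\{-1,+1\}^V$ and, for inverse temperature $\beta\ge0$, the Gibbs measure is $\mu_n(\sigma)\propto\exp\big(\beta\sum_{\{v,w\},v\ne w}K(v,w)\sigma(v)\sigma(w)\big)$. The Glauber dynamics $(\sigma_t)_{t\ge0}$ is the discrete-time Markov chain which at each step picks a vertex $v$ uniformly from $V$ and sets the spin at $v$ to $\pm1$ with probability $r_\pm(S^v)=\frac{1\pm\tanh(\beta S^v)}{2}$,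 where $S^v=\sum_{w\ne v}K(v,w)\sigma(w)$, leaving all other spins unchanged; $\mu_n$ is its stationary distribution. Let $d_n(t)=\max_{\sigma\in\Omega}\|\mathbb P_\sigma(\sigma_t\in\cdot)-\mu_n\|_{TV}$ (times are rounded to integers). Let $\mathbf B=(p_ik_{ij})_{i,j}$ and $\mathbf Q_n=(1-\frac1n)\mathbf I_m+\frac{\beta}{n}\mathbf B$ ($\mathbf I_m$ the $m\times m$ identity). Let $\rho_n$ be the largest (Perron) eigenvalue of $\mathbf Q_n$ and $\mathbf a=(a_1,\dots,a_m)^\top>0$ its left Perron eigenvector normalized by $\|\mathbf a\|_1=1$ (it is also the left Perron eigenvector of $\mathbf B$ and does not depend on $n$). Define $\alpha:=\frac{1}{2n(1-\rho_n)}$ and $\beta_{cr}:=\big(\sum_{i,j=1}^m a_ip_ik_{ij}\big)^{-1}$. *)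

theory Defs
  imports "HOL-Analysis.Analysis"
begin

(* Blocks are indexed 0..<m; vertices are 1..n; blk :: nat => nat gives the block of a vertex. *)

definition configs :: "nat \<Rightarrow> (nat \<Rightarrow> real) set" where
  "configs n = PiE {1..n} (\<lambda>_. {-1, 1})"

definition Kint :: "(nat \<Rightarrow> nat \<Rightarrow> real) \<Rightarrow> (nat \<Rightarrow> nat) \<Rightarrow> nat \<Rightarrow> nat \<Rightarrow> nat \<Rightarrow> real" where
  "Kint k blk n v w = k (blk v) (blk w) / real n"

definition local_field :: "(nat \<Rightarrow> nat \<Rightarrow> real) \<Rightarrow> (nat \<Rightarrow> nat) \<Rightarrow> nat \<Rightarrow> (nat \<Rightarrow> real) \<Rightarrow> nat \<Rightarrow> real" where
  "local_field k blk n \<sigma> v = (\<Sum>w\<in>{1..n} - {v}. Kint k blk n v w * \<sigma> w)"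

(* one-step transition probability of the Glauber dynamics:
   pick v uniformly, set spin at v to s = +-1 with prob (1 + s tanh(beta S^v))/2 *)
definition glauber :: "(nat \<Rightarrow> nat \<Rightarrow> real) \<Rightarrow> (nat \<Rightarrow> nat) \<Rightarrow> real \<Rightarrow> nat \<Rightarrow>
    (nat \<Rightarrow> real) \<Rightarrow> (nat \<Rightarrow> real) \<Rightarrow> real" where
  "glauber k blk \<beta> n \<sigma> \<tau> = (1 / real n) *
     (\<Sum>v\<in>{1..n}. (if (\<forall>w\<in>{1..n} - {v}. \<tau> w = \<sigma> w)
                     then (1 + \<tau> v * tanh (\<beta> * local_field k blk n \<sigma> v)) / 2 else 0))"

fun glauber_pow :: "(nat \<Rightarrow> nat \<Rightarrow> real) \<Rightarrow> (nat \<Rightarrow> nat) \<Rightarrow> real \<Rightarrow> nat \<Rightarrow> nat \<Rightarrow>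
    (nat \<Rightarrow> real) \<Rightarrow> (nat \<Rightarrow> real) \<Rightarrow> real" where
  "glauber_pow k blk \<beta> n 0 \<sigma> \<tau> = (if \<sigma> = \<tau> then 1 else 0)"
| "glauber_pow k blk \<beta> n (Suc t) \<sigma> \<tau> =
     (\<Sum>\<rho>\<in>configs n. glauber_pow k blk \<beta> n t \<sigma> \<rho> * glauber k blk \<beta> n \<rho> \<tau>)"

definition hamil :: "(nat \<Rightarrow> nat \<Rightarrow> real) \<Rightarrow> (nat \<Rightarrow> nat) \<Rightarrow> nat \<Rightarrow> (nat \<Rightarrow> real) \<Rightarrow> real" where
  "hamil k blk n \<sigma> = (\<Sum>(v,w)\<in>{(v,w). v \<in> {1..n} \<and> w \<in> {1..n} \<and> v < w}.
                          Kint k blk n v w * \<sigma> v * \<sigma> w)"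

definition gibbs :: "(nat \<Rightarrow> nat \<Rightarrow> real) \<Rightarrow> (nat \<Rightarrow> nat) \<Rightarrow> real \<Rightarrow> nat \<Rightarrow> (nat \<Rightarrow> real) \<Rightarrow> real" where
  "gibbs k blk \<beta> n \<sigma> = exp (\<beta> * hamil k blk n \<sigma>) /
     (\<Sum>\<rho>\<in>configs n. exp (\<beta> * hamil k blk n \<rho>))"

definition tv_dist :: "nat \<Rightarrow> ((nat \<Rightarrow> real) \<Rightarrow> real) \<Rightarrow> ((nat \<Rightarrow> real) \<Rightarrow> real) \<Rightarrow> real" where
  "tv_dist n \<mu> \<nu> = Max ((\<lambda>A. \<bar>(\<Sum>\<sigma>\<in>A. \<mu> \<sigma>) - (\<Sum>\<sigma>\<in>A. \<nu> \<sigma>)\<bar>) ` Pow (configs n))"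

definition mix_dist :: "(nat \<Rightarrow> nat \<Rightarrow> real) \<Rightarrow> (nat \<Rightarrow> nat) \<Rightarrow> real \<Rightarrow> nat \<Rightarrow> nat \<Rightarrow> real" where
  "mix_dist k blk \<beta> n t =
     Max ((\<lambda>\<sigma>0. tv_dist n (glauber_pow k blk \<beta> n t \<sigma>0) (gibbs k blk \<beta> n)) ` configs n)"

definition admissible :: "nat \<Rightarrow> (nat \<Rightarrow> real) \<Rightarrow> nat \<Rightarrow> bool" where
  "admissible m p n \<longleftrightarrow> n > 0 \<and> (\<forall>i<m. real n * p i \<in> \<nat>)"

(* m x m matrices as functions on {0..<m} x {0..<m} *)
definition Bmat :: "(nat \<Rightarrow> real) \<Rightarrow> (nat \<Rightarrow> nat \<Rightarrow> real) \<Rightarrow> nat \<Rightarrow> nat \<Rightarrow> real" where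
  "Bmat p k i j = p i * k i j"

definition Qmat :: "(nat \<Rightarrow> real) \<Rightarrow> (nat \<Rightarrow> nat \<Rightarrow> real) \<Rightarrow> real \<Rightarrow> nat \<Rightarrow> nat \<Rightarrow> nat \<Rightarrow> real" where
  "Qmat p k \<beta> n i j = (if i = j then 1 - 1 / real n else 0) + \<beta> / real n * Bmat p k i j"

definition is_eigenvalue :: "nat \<Rightarrow> (nat \<Rightarrow> nat \<Rightarrow> real) \<Rightarrow> real \<Rightarrow> bool" where
  "is_eigenvalue m M l \<longleftrightarrow> (\<exists>x. (\<exists>i<m. x i \<noteq> 0) \<and> (\<forall>i<m. (\<Sum>j<m. M i j * x j) = l * x i))"

(* largest (real) eigenvalue = Perron root for the matrices considered *)
definition perron_root :: "nat \<Rightarrow> (nat \<Rightarrow> nat \<Rightarrow> real) \<Rightarrow> real" where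
  "perron_root m M = (GREATEST l. is_eigenvalue m M l)"

definition left_perron_vec :: "nat \<Rightarrow> (nat \<Rightarrow> nat \<Rightarrow> real) \<Rightarrow> nat \<Rightarrow> real" where
  "left_perron_vec m M = (THE a. (\<forall>i<m. a i > 0) \<and> (\<Sum>i<m. a i) = 1 \<and>
      (\<forall>j<m. (\<Sum>i<m. a i * M i j) = perron_root m M * a j) \<and> (\<forall>i\<ge>m. a i = 0))"

definition alpha :: "nat \<Rightarrow> (nat \<Rightarrow> real) \<Rightarrow> (nat \<Rightarrow> nat \<Rightarrow> real) \<Rightarrow> real \<Rightarrow> nat \<Rightarrow> real" where
  "alpha m p k \<beta> n = 1 / (2 * real n * (1 - perron_root m (Qmat p k \<beta> n)))"

definition beta_cr :: "nat \<Rightarrow> (nat \<Rightarrow> real) \<Rightarrow> (nat \<Rightarrow> nat \<Rightarrow> real) \<Rightarrow> real" where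
  "beta_cr m p k = 1 / (\<Sum>i<m. \<Sum>j<m. left_perron_vec m (Bmat p k) i * p i * k i j)"

definition cutoff_time :: "nat \<Rightarrow> (nat \<Rightarrow> real) \<Rightarrow> (nat \<Rightarrow> nat \<Rightarrow> real) \<Rightarrow> real \<Rightarrow> nat \<Rightarrow> real" where
  "cutoff_time m p k \<beta> n = alpha m p k \<beta> n * real n * ln (real n)"

end

theory Submission
  imports Defs
begin

text \<open>
  Write $P$ for the one-step transition operator acting on functions and $D_v g$ for the change of $g$
  when the spin at $v$ is flipped. If $|D_v g| \<le> L_v$ everywhere, then $|D_v (P g)|$ is bounded by the
  image of $L$ under a symmetric matrix whose Perron vector is $v \<mapsto> a_{i(v)}$, with eigenvalue
  $\<rho> = 1 - (1 - \<beta>\<lambda>)/n$, where $\<lambda> = 1/\<beta>_{cr}$; so weighted Lipschitz constants contract by exactly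
  the factor that defines the cutoff time.

  Upper bound: the squared gradient $G g = \<Sum>_v (D_v g)^2$ satisfies
  $G (P g) \<le> (1 + O(1/n)) P (G g)$, and the one-step variance of $g$ is at least of order $G g / n$.
  Summing the variances over $n$ steps gives the reverse Poincare inequality $G (P^n f) = O(1)$ for
  $|f| \<le> 1$. For a fixed starting point one may average $f$ over all permutations that preserve blocks
  and initial spins; then the gradient is constant along classes of equal sites, so that
  $|D_v P^n f| = O(N^{-1/2})$ for a class of $N$ sites. Hence $\<Sum>_v a_v |D_v P^n f| = O(n^{1/2})$, and
  $s$ further steps reduce the oscillation to $O(\<rho>^s n^{1/2})$.

  Lower bound: start at magnetisations of small constant size and follow $M = \<Sum>_i a_i m_i$. Since
  $|tanh x - x| \<le> x^2$, the error in the drift of $M$ is controlled by $Q = \<Sum>_i m_i^2 / p_i$, which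
  decays like $\<rho>^{2t}$; therefore $M$ minus a multiple of $Q$ has mean at least
  of order $\<rho>^t - O(1/n)$. The variance of $M$ is $O(1/n)$ by contraction and its stationary second
  moment is $O(1/n)$ by the drift of $Q$, so Chebyshev's inequality applies.
\<close>

text \<open>Plain contraction of Lipschitz constants starts from a weighted sum of order n, so
  \<open>\<rho> ^ s\<close> would have to drop below 1/n, which takes twice the cutoff time.
  Smoothing lowers the start to \<open>sqrt n\<close> and costs n steps, that is, one window. A
  bound on \<open>G\<close> alone is not enough. Contraction acts on vectors that bound
  \<open>D v g\<close> at all configurations at once, and a supremum over configurations of the sum
  of squares does not control the sum over sites of the separate suprema. Symmetrisation turns it
  into a bound for each single site; the price is the number of classes, at most
  \<open>2 * m\<close>, which does not grow with n. For the lower bound, nonlinearity of tanh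
  prevents \<open>M\<close> from being an eigenfunction. The correction by \<open>Q\<close> is
  quadratic while \<open>M\<close> is linear, so at a small constant starting level the corrected
  observable is still positive. At time t_n - \<gamma> n the mean of \<open>M\<close> is at least of
  order \<open>exp (c * \<gamma>)\<close> on the scale 1 / \<open>sqrt n\<close> of its
  fluctuations, whence total variation close to 1.\<close>

section \<open>Estimates for the hyperbolic tangent\<close>

lemma abs_tanh_diff_le: "\<bar>tanh x - tanh y\<bar> \<le> \<bar>x - y\<bar>" for x y :: real
proof -
  have der: "(tanh has_field_derivative (1 - tanh z ^ 2)) (at z within UNIV)" for z :: real
    using cosh_real_pos[of z] by (intro derivative_eq_intros | simp)+
  have "norm (1 - tanh z ^ 2) \<le> 1" for z :: real
  proof -
    have "tanh z ^ 2 \<le> 1"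
      using tanh_real_lt_1[of z] tanh_real_gt_neg1[of z] by (simp add: abs_square_le_1 abs_le_iff)
    then show ?thesis by simp
  qed
  from field_differentiable_bound[of UNIV tanh "\<lambda>z. 1 - tanh z ^ 2" 1 x y, OF _ der this]
  show ?thesis by simp
qed

lemma abs_tanh_le: "\<bar>tanh x\<bar> \<le> \<bar>x\<bar>" for x :: real
  using abs_tanh_diff_le[of x 0] by simp

text \<open>Mean value theorem on the interval from - \<bar>x\<bar> to \<bar>x\<bar>, where the
  derivative \<open>- (tanh z ^ 2)\<close> has modulus at most \<bar>z\<bar>. The true order is
  cubic; a quadratic error suffices because \<open>Q\<close> absorbs it.\<close>

lemma abs_tanh_minus_id_le: "\<bar>tanh x - x\<bar> \<le> x\<^sup>2" for x :: real
proof -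
  let ?S = "{- \<bar>x\<bar>..\<bar>x\<bar>}"
  have der: "((\<lambda>z. tanh z - z) has_field_derivative (- (tanh z ^ 2))) (at z within ?S)" for z :: real
    using cosh_real_pos[of z] by (auto intro!: derivative_eq_intros)
  have "norm (- (tanh z ^ 2)) \<le> \<bar>x\<bar>" if "z \<in> ?S" for z
  proof -
    have "\<bar>tanh z\<bar> \<le> 1"
      using tanh_real_lt_1[of z] tanh_real_gt_neg1[of z] by simp
    then have "\<bar>tanh z\<bar> * \<bar>tanh z\<bar> \<le> 1 * \<bar>tanh z\<bar>"
      by (intro mult_right_mono) auto
    also have "\<dots> \<le> \<bar>x\<bar>" using abs_tanh_le[of z] that by auto
    finally show ?thesis by (simp add: power2_eq_square)
  qed
  from field_differentiable_bound[of ?S "\<lambda>z. tanh z - z" "\<lambda>z. - (tanh z ^ 2)" "\<bar>x\<bar>" x 0, OF _ der this]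
  have "\<bar>tanh x - x\<bar> \<le> \<bar>x\<bar> * \<bar>x\<bar>" by simp linarith
  then show ?thesis by (simp add: power2_eq_square)
qed

text \<open>The Gibbs factor of a spin flip equals the ratio of the two heat-bath probabilities;
  detailed balance reduces to this identity.\<close>

lemma exp_times_one_plus_tanh: "exp (- 2 * y) * (1 + tanh y) = 1 - tanh y" for y :: real
proof -
  have "1 + exp (- 2 * y) > 0" by (intro add_pos_pos) auto
  then have "1 + tanh y = 2 / (1 + exp (- 2 * y))" "1 - tanh y = 2 * exp (- 2 * y) / (1 + exp (- 2 * y))"
    unfolding tanh_real_altdef by (simp_all add: field_simps)
  then show ?thesis by simp
qed

section \<open>The Perron eigenvector\<close>

text \<open>Tychonoff. Vectors of variable length \<open>m\<close> are functions on
  \<open>nat\<close>, and a box of width zero beyond the first \<open>m\<close> coordinates pins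
  them there.\<close>

lemma compact_box_fun:
  fixes l u :: "'i \<Rightarrow> real"
  shows "compact {x. \<forall>i. x i \<in> {l i..u i}}"
proof -
  have "compactin (product_topology (\<lambda>_. euclidean) UNIV) (PiE UNIV (\<lambda>i. {l i..u i}))"
    unfolding compactin_PiE by auto
  moreover have "PiE UNIV (\<lambda>i. {l i..u i}) = {x. \<forall>i. x i \<in> {l i..u i}}"
    by (auto simp: PiE_def)
  ultimately show ?thesis by (simp add: euclidean_product_topology)
qed

text \<open>First-order condition at a maximum. For t = b / (\<bar>c\<bar> + 1) the quadratic term
  cancels at most half of the linear one.\<close>

lemma linear_coeff_zero:
  fixes b c :: real
  assumes "\<And>t. 2 * t * b + t\<^sup>2 * c \<le> 0"
  shows "b = 0"
proof (rule ccontr)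
  assume b: "b \<noteq> 0"
  define t where "t = b / (\<bar>c\<bar> + 1)"
  have "t\<^sup>2 * c \<ge> - (t\<^sup>2 * \<bar>c\<bar>)" using mult_left_mono[of "- \<bar>c\<bar>" c "t\<^sup>2"] by simp
  moreover have "t\<^sup>2 * \<bar>c\<bar> \<le> t\<^sup>2 * (\<bar>c\<bar> + 1)" by (simp add: mult_left_mono)
  moreover have "t\<^sup>2 * (\<bar>c\<bar> + 1) = t * b"
    by (simp add: t_def power2_eq_square add_nonneg_eq_0_iff)
  ultimately have "2 * t * b + t\<^sup>2 * c \<ge> t * b" by linarith
  moreover have "0 < b * b" using b not_real_square_gt_zero by blast
  then have "t * b > 0" by (simp add: t_def zero_less_divide_iff)
  ultimately show False using assms[of t] by linarith
qed

text \<open>Symmetry of \<open>k\<close> permits a variational proof: the Rayleigh quotient of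
  \<open>b\<close> relative to \<open>q\<close> is maximised on a compact set, the maximiser is
  replaced by its absolute value, and the critical-point equation is the left eigenvector
  equation.\<close>

lemma perron_vector_exists:
  fixes p :: "nat \<Rightarrow> real" and k :: "nat \<Rightarrow> nat \<Rightarrow> real"
  assumes m: "m \<ge> 1" and p: "\<forall>i<m. p i > 0"
    and sym: "\<forall>i<m. \<forall>j<m. k i j = k j i"
    and off: "\<forall>i<m. \<forall>j<m. i \<noteq> j \<longrightarrow> k i j > 0" and diag: "\<forall>i<m. k i i \<ge> 0"
  obtains a l where "\<forall>i<m. a i > 0" "(\<Sum>i<m. a i) = 1"
    "\<forall>j<m. (\<Sum>i<m. a i * Bmat p k i j) = l * a j" "\<forall>i\<ge>m. a i = 0"
proof -
  have k0: "k i j \<ge> 0" if "i < m" "j < m" for i j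
    using off diag that by (cases "i = j") (auto simp: less_imp_le)
  define b where "b x y = (\<Sum>i<m. \<Sum>j<m. p i * p j * k i j * x i * y j)" for x y :: "nat \<Rightarrow> real"
  define q where "q x y = (\<Sum>i<m. p i * x i * y i)" for x y :: "nat \<Rightarrow> real"
  \<comment> \<open>The constraint gives \<open>x i * x i \<le> 1 / p i\<close>; the extra 1 comes
    from \<bar>x\<bar> \<le> x^2 + 1, which avoids a square root.\<close>
  define R where "R i = (if i < m then 1 / p i + 1 else 0)" for i
  define X where "X = {x. \<forall>i. x i \<in> {- R i..R i}} \<inter> {x. q x x = 1}"
  have cont_b: "continuous_on UNIV (\<lambda>x. b x x)" and cont_q: "continuous_on UNIV (\<lambda>x. q x x)"
    unfolding b_def q_def by (intro continuous_intros continuous_on_product_coordinates)+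
  have "closed {x. q x x = 1}"
    using cont_q by (intro closed_Collect_eq) auto
  then have "compact X" unfolding X_def by (intro compact_Int_closed compact_box_fun)
  have inX: "x \<in> X" if "q x x = 1" "\<forall>i\<ge>m. x i = 0" for x
  proof -
    have "\<bar>x i\<bar> \<le> R i" for i
    proof (cases "i < m")
      case True
      have "p i * x i * x i \<le> q x x" unfolding q_def
        using p True by (intro member_le_sum) (auto simp: mult.assoc less_imp_le)
      then have "x i * x i \<le> 1 / p i" using p True that by (simp add: field_simps)
      moreover have "\<bar>x i\<bar> \<le> x i * x i + 1"
        using zero_le_power2[of "\<bar>x i\<bar> - 1/2"] by (simp add: power2_eq_square algebra_simps)
      ultimately show ?thesis using True by (simp add: R_def)
    qed (use that in \<open>simp add: R_def\<close>)
    then have "- R i \<le> x i \<and> x i \<le> R i" for i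
      by (simp add: abs_le_iff minus_le_iff)
    then show ?thesis using that by (simp add: X_def)
  qed
  define e where "e i = (if i = 0 then 1 / sqrt (p 0) else 0)" for i :: nat
  have "q e e = (\<Sum>i<m. if i = 0 then p 0 * (1 / sqrt (p 0)) * (1 / sqrt (p 0)) else 0)"
    unfolding q_def e_def by (intro sum.cong) auto
  also have "\<dots> = 1"
  proof -
    have "p 0 > 0" using m p by simp
    then show ?thesis using m by simp
  qed
  finally have "e \<in> X" using m by (intro inX) (auto simp: e_def)
  then have "X \<noteq> {}" by auto
  with \<open>compact X\<close> obtain x0 where x0: "x0 \<in> X" "\<And>y. y \<in> X \<Longrightarrow> b y y \<le> b x0 x0"
    using continuous_attains_sup[of X "\<lambda>x. b x x"] cont_b continuous_on_subset by blast
  define l where "l = b x0 x0"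
  define x where "x i = \<bar>x0 i\<bar>" for i
  have qx: "q x x = 1" using x0 by (simp add: X_def q_def x_def mult.assoc)
  have xout: "\<forall>i\<ge>m. x i = 0"
  proof (intro allI impI)
    fix i assume "i \<ge> m"
    then have "R i = 0" by (simp add: R_def)
    moreover have "x0 i \<in> {- R i..R i}" using x0 unfolding X_def by blast
    ultimately show "x i = 0" by (simp add: x_def)
  qed
  have max: "b y y \<le> l * q y y" if "\<forall>i\<ge>m. y i = 0" for y
  proof (cases "\<exists>i<m. y i \<noteq> 0")
    case False
    then show ?thesis by (simp add: b_def q_def)
  next
    case True
    then obtain i where i: "i < m" "y i \<noteq> 0" by auto
    have "0 < y i * y i" using i(2) not_real_square_gt_zero by blast
    then have "0 < p i * y i * y i" using p i(1) by (simp add: mult.assoc)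
    also have "\<dots> \<le> q y y" unfolding q_def
      using p i by (intro member_le_sum) (auto simp: mult.assoc less_imp_le)
    finally have pos: "q y y > 0" .
    define s where "s = 1 / sqrt (q y y)"
    have s2: "s * s = 1 / q y y" using pos by (simp add: s_def)
    have "q (\<lambda>i. s * y i) (\<lambda>i. s * y i) = s * s * q y y"
      by (simp add: q_def sum_distrib_left algebra_simps)
    then have "b (\<lambda>i. s * y i) (\<lambda>i. s * y i) \<le> l" unfolding l_def
      using that pos s2 by (intro x0 inX) auto
    also have "b (\<lambda>i. s * y i) (\<lambda>i. s * y i) = s * s * b y y"
      by (simp add: b_def sum_distrib_left algebra_simps)
    finally show ?thesis using pos s2 by (simp add: field_simps)
  qed
  have "l \<le> b x x" unfolding l_def b_def
  proof (intro sum_mono)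
    fix i j assume "i \<in> {..<m}" "j \<in> {..<m}"
    then have "p i * p j * k i j * (x0 i * x0 j) \<le> p i * p j * k i j * (\<bar>x0 i\<bar> * \<bar>x0 j\<bar>)"
      using p k0 by (intro mult_left_mono) (auto simp: less_imp_le simp flip: abs_mult)
    then show "p i * p j * k i j * x0 i * x0 j \<le> p i * p j * k i j * x i * x j"
      by (simp add: x_def mult.assoc)
  qed
  with max[OF xout] qx have bx: "b x x = l" by simp
  have bsym: "b u v = b v u" for u v
    unfolding b_def using sym by (subst sum.swap) (intro sum.cong, auto simp: algebra_simps)
  have crit: "b x y = l * q x y" if "\<forall>i\<ge>m. y i = 0" for y
  proof -
    have "2 * t * (b x y - l * q x y) + t\<^sup>2 * (b y y - l * q y y) \<le> 0" for t
    proof -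
      let ?z = "\<lambda>i. x i + t * y i"
      have "b ?z ?z = b x x + t * b x y + t * b y x + t\<^sup>2 * b y y"
        by (simp add: b_def sum_distrib_left sum.distrib[symmetric] algebra_simps power2_eq_square)
      moreover have "q ?z ?z = q x x + 2 * t * q x y + t\<^sup>2 * q y y"
        by (simp add: q_def sum_distrib_left sum.distrib[symmetric] algebra_simps power2_eq_square)
      moreover have "b ?z ?z \<le> l * q ?z ?z" using xout that by (intro max) auto
      ultimately show ?thesis using bsym[of y x] bx qx by (simp add: algebra_simps)
    qed
    from linear_coeff_zero[OF this] show ?thesis by simp
  qed
  have eig: "(\<Sum>i<m. x i * Bmat p k i j) = l * x j" if j: "j < m" for j
  proof -
    \<comment> \<open>Testing with the unit vector at \<open>j\<close>, divided by
      \<open>p j\<close>, isolates one coordinate of the equation.\<close>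
    let ?d = "\<lambda>i. if i = j then 1 / p j else (0::real)"
    have "b x ?d = (\<Sum>i<m. \<Sum>j'<m. if j' = j then p i * k i j * x i else 0)"
      unfolding b_def using p j by (intro sum.cong) auto
    also have "\<dots> = (\<Sum>i<m. x i * Bmat p k i j)"
      using j by (simp add: Bmat_def algebra_simps)
    finally have "b x ?d = (\<Sum>i<m. x i * Bmat p k i j)" .
    moreover have "q x ?d = (\<Sum>i<m. if i = j then x j else 0)"
      unfolding q_def using p j by (intro sum.cong) auto
    then have "q x ?d = x j" using j by simp
    ultimately show ?thesis using crit[of ?d] j by auto
  qed
  obtain i0 where i0: "i0 < m" "x i0 > 0"
  proof -
    have "\<exists>i<m. x i \<noteq> 0"
    proof (rule ccontr)
      assume "\<not> ?thesis"
      then have "q x x = 0" by (simp add: q_def)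
      with qx show False by simp
    qed
    then show ?thesis using that by (force simp: x_def)
  qed
  have xpos: "x j > 0" if j: "j < m" for j
  proof (cases "j = i0")
    case False
    \<comment> \<open>Off-diagonal entries are all positive, so a single positive coordinate forces
      every other one to be nonzero.\<close>
    have "0 < x i0 * Bmat p k i0 j" using i0 j off p False by (simp add: Bmat_def)
    also have "\<dots> \<le> (\<Sum>i<m. x i * Bmat p k i j)"
      using i0 j p k0 by (intro member_le_sum) (auto simp: Bmat_def x_def less_imp_le)
    finally have "l * x j > 0" using eig[OF j] by simp
    then show ?thesis by (auto simp: x_def)
  qed (use i0 in simp)
  define S where "S = (\<Sum>i<m. x i)"
  have S: "S > 0" unfolding S_def using m xpos by (intro sum_pos) (auto simp: lessThan_empty_iff)
  show thesis
  proof
    show "\<forall>i<m. x i / S > 0" using xpos S by simp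
    show "(\<Sum>i<m. x i / S) = 1" using S by (simp add: S_def flip: sum_divide_distrib)
    show "\<forall>j<m. (\<Sum>i<m. x i / S * Bmat p k i j) = l * (x j / S)"
      using eig by (simp flip: sum_divide_distrib)
    show "\<forall>i\<ge>m. x i / S = 0" using xout by simp
  qed
qed

text \<open>Pairing the absolute values of a right eigenvector with a positive left eigenvector bounds
  every eigenvalue of a nonnegative matrix.\<close>

lemma perron_root_eqI:
  assumes a: "\<forall>i<m. a i > 0" and M: "\<forall>i<m. \<forall>j<m. M i j \<ge> 0"
    and left: "\<forall>j<m. (\<Sum>i<m. a i * M i j) = l * a j"
    and ev: "is_eigenvalue m M l"
  shows "perron_root m M = l"
  unfolding perron_root_def
proof (rule Greatest_equality)
  fix r assume "is_eigenvalue m M r"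
  then obtain y i0 where i0: "i0 < m" "y i0 \<noteq> 0" and y: "\<forall>i<m. (\<Sum>j<m. M i j * y j) = r * y i"
    unfolding is_eigenvalue_def by auto
  have pos: "(\<Sum>i<m. a i * \<bar>y i\<bar>) > 0"
    using i0 a by (intro sum_pos2[of _ i0]) (auto simp: less_imp_le)
  have "r * (\<Sum>i<m. a i * \<bar>y i\<bar>) \<le> (\<Sum>i<m. a i * \<bar>r * y i\<bar>)"
    using a unfolding sum_distrib_left
    by (intro sum_mono) (auto simp: abs_mult algebra_simps intro!: mult_right_mono mult_left_mono)
  also have "\<dots> = (\<Sum>i<m. a i * \<bar>\<Sum>j<m. M i j * y j\<bar>)" using y by simp
  also have "\<dots> \<le> (\<Sum>i<m. a i * (\<Sum>j<m. M i j * \<bar>y j\<bar>))"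
    using a M by (intro sum_mono mult_left_mono order_trans[OF sum_abs])
      (auto simp: abs_mult less_imp_le)
  also have "\<dots> = (\<Sum>i<m. \<Sum>j<m. a i * M i j * \<bar>y j\<bar>)"
    by (simp add: sum_distrib_left mult.assoc)
  also have "\<dots> = (\<Sum>j<m. \<Sum>i<m. a i * M i j * \<bar>y j\<bar>)" by (rule sum.swap)
  also have "\<dots> = (\<Sum>j<m. l * a j * \<bar>y j\<bar>)"
    using left by (simp flip: sum_distrib_right)
  also have "\<dots> = l * (\<Sum>i<m. a i * \<bar>y i\<bar>)" by (simp add: sum_distrib_left mult.assoc)
  finally show "r \<le> l" using pos by simp
qed (fact ev)

text \<open>Subtract from a second solution \<open>b\<close> the largest multiple of
  \<open>a\<close> that leaves the difference \<open>c\<close> nonnegative. It vanishes at some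
  \<open>j\<close>, and the equation at \<open>j\<close> is then a vanishing sum of nonnegative
  terms with positive off-diagonal coefficients, so \<open>c\<close> is zero.\<close>

lemma left_perron_vec_eqI:
  assumes m: "m \<ge> 1" and a: "\<forall>i<m. a i > 0" "(\<Sum>i<m. a i) = 1" "\<forall>i\<ge>m. a i = 0"
    and M: "\<forall>i<m. \<forall>j<m. i \<noteq> j \<longrightarrow> M i j > 0" "\<forall>i<m. M i i \<ge> 0"
    and left: "\<forall>j<m. (\<Sum>i<m. a i * M i j) = perron_root m M * a j"
  shows "left_perron_vec m M = a"
  unfolding left_perron_vec_def
proof (rule the_equality)
  fix b assume "(\<forall>i<m. b i > 0) \<and> (\<Sum>i<m. b i) = 1 \<and>
      (\<forall>j<m. (\<Sum>i<m. b i * M i j) = perron_root m M * b j) \<and> (\<forall>i\<ge>m. b i = 0)"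
  then have b: "\<forall>i<m. b i > 0" "(\<Sum>i<m. b i) = 1" "\<forall>i\<ge>m. b i = 0"
    and leftb: "\<forall>j<m. (\<Sum>i<m. b i * M i j) = perron_root m M * b j" by auto
  define s where "s = Min ((\<lambda>i. b i / a i) ` {..<m})"
  have ne: "{..<m} \<noteq> {}" using m by (simp add: lessThan_empty_iff)
  have "s \<in> (\<lambda>i. b i / a i) ` {..<m}" unfolding s_def using ne by (intro Min_in) auto
  then obtain j where j: "j < m" "s = b j / a j" by auto
  define c where "c i = b i - s * a i" for i
  have c0: "c i \<ge> 0" if "i < m" for i
  proof -
    have "s \<le> b i / a i" unfolding s_def using that by (intro Min_le) auto
    then show ?thesis using a that by (simp add: c_def field_simps)
  qed
  have cj: "c j = 0" using j a by (auto simp: c_def)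
  have "(\<Sum>i<m. c i * M i j) = (\<Sum>i<m. b i * M i j) - s * (\<Sum>i<m. a i * M i j)"
    by (simp add: c_def sum_subtractf sum_distrib_left algebra_simps)
  also have "\<dots> = perron_root m M * c j" using left leftb j by (simp add: c_def algebra_simps)
  finally have sum0: "(\<Sum>i<m. c i * M i j) = 0" using cj by simp
  have Mnn: "M i j \<ge> 0" if "i < m" for i
    using M j that by (cases "i = j") (auto simp: less_imp_le)
  have cz: "c i = 0" if i: "i < m" for i
  proof (cases "i = j")
    case False
    have "c i * M i j = 0"
      using sum_nonneg_0[of "{..<m}" "\<lambda>i. c i * M i j", OF _ _ sum0] c0 Mnn i by simp
    then show ?thesis using M j i False by (auto simp: less_le)
  qed (use cj in simp)
  then have ba: "b i = s * a i" if "i < m" for i using that by (simp add: c_def)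
  then have "(\<Sum>i<m. b i) = s * (\<Sum>i<m. a i)" by (simp add: sum_distrib_left)
  then have "s = 1" using a b by simp
  then have "b i = a i" for i using ba[of i] a(3) b(3) by (cases "i < m") auto
  then show "b = a" by (rule ext)
qed (use a left in auto)

text \<open>\<open>Bmat\<close> is a diagonal matrix times the symmetric \<open>k\<close>, so
  scaling by \<open>p\<close> turns left eigenvectors into right ones. The definition of
  \<open>is_eigenvalue\<close> asks for right ones.\<close>

lemma Bmat_right_eigenvector:
  assumes "\<forall>i<m. \<forall>j<m. k i j = k j i" and "\<forall>j<m. (\<Sum>i<m. a i * Bmat p k i j) = l * a j" and "i < m"
  shows "(\<Sum>j<m. Bmat p k i j * (p j * a j)) = l * (p i * a i)"
proof -
  have "(\<Sum>j<m. Bmat p k i j * (p j * a j)) = p i * (\<Sum>j<m. a j * Bmat p k j i)"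
    using assms by (simp add: Bmat_def sum_distrib_left algebra_simps)
  then show ?thesis using assms by simp
qed

lemma perron_facts:
  assumes m: "m \<ge> 1" and p: "\<forall>i<m. p i > 0"
    and sym: "\<forall>i<m. \<forall>j<m. k i j = k j i"
    and off: "\<forall>i<m. \<forall>j<m. i \<noteq> j \<longrightarrow> k i j > 0" and diag: "\<forall>i<m. k i i \<ge> 0"
    and beta: "\<beta> \<ge> 0" "\<beta> < beta_cr m p k"
  obtains a l where "\<forall>i<m. a i > 0" "(\<Sum>i<m. a i) = 1"
    "\<forall>j<m. (\<Sum>i<m. a i * p i * k i j) = l * a j" "l > 0" "\<beta> * l < 1"
    "\<forall>n>0. alpha m p k \<beta> n = 1 / (2 * (1 - \<beta> * l))"
proof -
  obtain a l where
    a: "\<forall>i<m. a i > 0" "(\<Sum>i<m. a i) = 1" "\<forall>i\<ge>m. a i = 0"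
    and left: "\<forall>j<m. (\<Sum>i<m. a i * Bmat p k i j) = l * a j"
    by (rule perron_vector_exists[OF m p sym off diag])
  have B0: "\<forall>i<m. \<forall>j<m. Bmat p k i j \<ge> 0"
  proof (intro allI impI)
    fix i j assume ij: "i < m" "j < m"
    then have "k i j \<ge> 0" using off diag by (cases "i = j") (auto simp: less_imp_le)
    then show "Bmat p k i j \<ge> 0" using p ij by (simp add: Bmat_def less_imp_le)
  qed
  have ex: "\<exists>i<m. p i * a i \<noteq> 0" using m p a by (intro exI[of _ 0]) auto
  note right = Bmat_right_eigenvector[OF sym left]
  have "is_eigenvalue m (Bmat p k) l"
    unfolding is_eigenvalue_def using ex right by (intro exI[of _ "\<lambda>i. p i * a i"]) auto
  then have pB: "perron_root m (Bmat p k) = l"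
    using perron_root_eqI[OF a(1) B0 left] by simp
  have "left_perron_vec m (Bmat p k) = a"
    using left p off diag by (intro left_perron_vec_eqI m a) (auto simp: pB Bmat_def)
  \<comment> \<open>Summing the left eigenvector equation over \<open>j\<close>, with
    \<open>a\<close> summing to 1, shows that the denominator of \<open>beta_cr\<close> is
    \<open>l\<close> itself.\<close>
  then have "beta_cr m p k = 1 / (\<Sum>i<m. \<Sum>j<m. a i * Bmat p k i j)"
    by (simp add: beta_cr_def Bmat_def mult.assoc)
  also have "(\<Sum>i<m. \<Sum>j<m. a i * Bmat p k i j) = (\<Sum>j<m. l * a j)"
    using left by (subst sum.swap) simp
  also have "\<dots> = l" using a by (simp flip: sum_distrib_left)
  finally have bcr: "beta_cr m p k = 1 / l" .
  \<comment> \<open>Positivity of \<open>l\<close> comes from the temperature hypothesis: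
    \<open>l = 0\<close> would give \<open>beta_cr = 0\<close> by the convention on division,
    contradicting 0 \<le> \<beta> < \<open>beta_cr\<close>.\<close>
  have "0 < 1 / l" using beta bcr by linarith
  then have l: "l > 0" by simp
  have bl: "\<beta> * l < 1" using beta bcr l by (simp add: field_simps)
  have al: "alpha m p k \<beta> n = 1 / (2 * (1 - \<beta> * l))" if n: "n > 0" for n
  proof -
    define r where "r = (1 - 1 / real n) + \<beta> / real n * l"
    have Q0: "\<forall>i<m. \<forall>j<m. Qmat p k \<beta> n i j \<ge> 0"
      using B0 beta n by (auto simp: Qmat_def)
    have leftQ: "\<forall>j<m. (\<Sum>i<m. a i * Qmat p k \<beta> n i j) = r * a j"
    proof (intro allI impI)
      fix j assume j: "j < m"
      have "(\<Sum>i<m. a i * Qmat p k \<beta> n i j) =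
        (\<Sum>i<m. (if i = j then a j * (1 - 1 / real n) else 0) + \<beta> / real n * (a i * Bmat p k i j))"
        by (intro sum.cong) (auto simp: Qmat_def algebra_simps)
      also have "\<dots> = a j * (1 - 1 / real n) + \<beta> / real n * (\<Sum>i<m. a i * Bmat p k i j)"
        using j by (simp only: sum.distrib sum_distrib_left) simp
      finally show "(\<Sum>i<m. a i * Qmat p k \<beta> n i j) = r * a j"
        using left j by (simp add: r_def algebra_simps)
    qed
    have "(\<Sum>j<m. Qmat p k \<beta> n i j * (p j * a j)) = r * (p i * a i)" if i: "i < m" for i
    proof -
      have "(\<Sum>j<m. Qmat p k \<beta> n i j * (p j * a j)) =
        (\<Sum>j<m. (if i = j then p i * a i * (1 - 1 / real n) else 0)
           + \<beta> / real n * (Bmat p k i j * (p j * a j)))"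
        by (intro sum.cong) (auto simp: Qmat_def algebra_simps)
      also have "\<dots> = p i * a i * (1 - 1 / real n)
          + \<beta> / real n * (\<Sum>j<m. Bmat p k i j * (p j * a j))"
        using i by (simp only: sum.distrib sum_distrib_left) simp
      finally show ?thesis using right[OF i] by (simp add: r_def algebra_simps)
    qed
    then have "is_eigenvalue m (Qmat p k \<beta> n) r"
      unfolding is_eigenvalue_def using ex by (intro exI[of _ "\<lambda>i. p i * a i"]) auto
    then have "perron_root m (Qmat p k \<beta> n) = r"
      using perron_root_eqI[OF a(1) Q0 leftQ] by simp
    then show ?thesis using n by (simp add: alpha_def r_def field_simps)
  qed
  show thesis
    using that[of a l] a l bl al left by (simp add: Bmat_def mult.assoc)
qed

section \<open>Gradient estimate for heat-bath dynamics\<close>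

lemma nonneg_if_mult_nonneg: "0 \<le> a * b \<Longrightarrow> 0 < a \<Longrightarrow> 0 \<le> b" for a b :: real
  by (simp add: zero_le_mult_iff)

lemma square_le_if_abs_le: "\<bar>x\<bar> \<le> y \<Longrightarrow> x\<^sup>2 \<le> y\<^sup>2" for x y :: real
  using power_mono[of "\<bar>x\<bar>" y 2] by simp

section \<open>The heat-bath operator on observables\<close>

text \<open>The inverse temperature is absorbed into \<open>J\<close>. The constants
  \<open>\<eta>\<close>, \<open>comm_err\<close> and \<open>grad_bound\<close> built here depend on
  \<open>\<kappa>\<close> only and are therefore uniform in the size of the system.\<close>

locale ising =
  fixes n :: nat and J :: "nat \<Rightarrow> nat \<Rightarrow> real" and \<kappa> :: real
  assumes n_pos: "n > 0"
    and J_sym: "\<And>v w. v \<in> {1..n} \<Longrightarrow> w \<in> {1..n} \<Longrightarrow> J v w = J w v"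
    and J_nonneg: "\<And>v w. v \<in> {1..n} \<Longrightarrow> w \<in> {1..n} \<Longrightarrow> J v w \<ge> 0"
    and J_le: "\<And>v w. v \<in> {1..n} \<Longrightarrow> w \<in> {1..n} \<Longrightarrow> J v w \<le> \<kappa> / n"
begin

abbreviation "V \<equiv> {1..n}"
abbreviation "\<Omega> \<equiv> configs n"

definition fld :: "(nat \<Rightarrow> real) \<Rightarrow> nat \<Rightarrow> real" where
  "fld \<sigma> v = (\<Sum>w\<in>V - {v}. J v w * \<sigma> w)"

definition th :: "(nat \<Rightarrow> real) \<Rightarrow> nat \<Rightarrow> real" where
  "th \<sigma> v = tanh (fld \<sigma> v)"

definition resample :: "((nat \<Rightarrow> real) \<Rightarrow> real) \<Rightarrow> nat \<Rightarrow> (nat \<Rightarrow> real) \<Rightarrow> real" where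
  "resample g v \<sigma> = (1 + th \<sigma> v) / 2 * g (\<sigma>(v := 1)) + (1 - th \<sigma> v) / 2 * g (\<sigma>(v := -1))"

definition P :: "((nat \<Rightarrow> real) \<Rightarrow> real) \<Rightarrow> (nat \<Rightarrow> real) \<Rightarrow> real" where
  "P g \<sigma> = (\<Sum>v\<in>V. resample g v \<sigma>) / n"

definition flip :: "nat \<Rightarrow> (nat \<Rightarrow> real) \<Rightarrow> nat \<Rightarrow> real" where
  "flip v \<sigma> = \<sigma>(v := - \<sigma> v)"

definition D :: "nat \<Rightarrow> ((nat \<Rightarrow> real) \<Rightarrow> real) \<Rightarrow> (nat \<Rightarrow> real) \<Rightarrow> real" where
  "D v g \<sigma> = g (flip v \<sigma>) - g \<sigma>"

definition G :: "((nat \<Rightarrow> real) \<Rightarrow> real) \<Rightarrow> (nat \<Rightarrow> real) \<Rightarrow> real" where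
  "G g \<sigma> = (\<Sum>v\<in>V. (D v g \<sigma>)\<^sup>2)"

definition flip_prob :: "nat \<Rightarrow> (nat \<Rightarrow> real) \<Rightarrow> real" where
  "flip_prob v \<sigma> = (1 - \<sigma> v * th \<sigma> v) / (2 * n)"

text \<open>All fields are at most \<open>\<kappa>\<close> in modulus, so each conditional spin
  probability lies between \<open>\<eta>\<close> and 1 - \<open>\<eta>\<close>.\<close>

definition \<eta> :: real where "\<eta> = (1 - tanh \<kappa>) / 2"

lemma finite_configs [simp]: "finite \<Omega>"
  by (simp add: configs_def finite_PiE)

lemma config_cases: "\<sigma> \<in> \<Omega> \<Longrightarrow> v \<in> V \<Longrightarrow> \<sigma> v = 1 \<or> \<sigma> v = -1"
  by (auto simp: configs_def PiE_def Pi_def)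

lemma abs_spin [simp]: "\<sigma> \<in> \<Omega> \<Longrightarrow> v \<in> V \<Longrightarrow> \<bar>\<sigma> v\<bar> = 1"
  using config_cases by fastforce

lemma upd_config [simp]: "\<sigma> \<in> \<Omega> \<Longrightarrow> v \<in> V \<Longrightarrow> s = 1 \<or> s = -1 \<Longrightarrow> \<sigma>(v := s) \<in> \<Omega>"
  by (auto simp: configs_def PiE_def Pi_def extensional_def)

lemma flip_config [simp]: "\<sigma> \<in> \<Omega> \<Longrightarrow> v \<in> V \<Longrightarrow> flip v \<sigma> \<in> \<Omega>"
  using config_cases[of \<sigma> v] by (auto simp: flip_def)

lemma flip_flip [simp]: "flip v (flip v \<sigma>) = \<sigma>"
  by (simp add: flip_def)

lemma flip_same: "flip v \<sigma> v = - \<sigma> v"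
  by (simp add: flip_def)

lemma flip_upd_same [simp]: "(flip v \<sigma>)(v := s) = \<sigma>(v := s)"
  by (simp add: flip_def)

lemma flip_upd_other: "u \<noteq> v \<Longrightarrow> (flip v \<sigma>)(u := s) = flip v (\<sigma>(u := s))"
  by (simp add: flip_def fun_upd_twist)

lemma D_flip: "D v g (flip v \<sigma>) = - D v g \<sigma>"
  by (simp add: D_def)

lemma \<kappa>_nonneg: "\<kappa> \<ge> 0"
proof -
  have "0 \<le> \<kappa> / n" using J_nonneg[of 1 1] J_le[of 1 1] n_pos by simp
  then show ?thesis using n_pos by (simp add: zero_le_divide_iff)
qed

lemma \<eta>_pos: "\<eta> > 0"
  using tanh_real_lt_1[of \<kappa>] by (simp add: \<eta>_def)

lemma fld_le:
  assumes "\<sigma> \<in> \<Omega>" "v \<in> V" shows "\<bar>fld \<sigma> v\<bar> \<le> \<kappa>"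
proof -
  have "\<bar>fld \<sigma> v\<bar> \<le> (\<Sum>w\<in>V - {v}. \<kappa> / n)"
    unfolding fld_def using assms J_nonneg J_le
    by (intro order_trans[OF sum_abs] sum_mono) (auto simp: abs_mult)
  also have "\<dots> \<le> (\<Sum>w\<in>V. \<kappa> / n)"
    using \<kappa>_nonneg by (intro sum_mono2) auto
  finally show ?thesis using n_pos by simp
qed

lemma th_le: "\<sigma> \<in> \<Omega> \<Longrightarrow> v \<in> V \<Longrightarrow> \<bar>th \<sigma> v\<bar> \<le> 1 - 2 * \<eta>"
  using fld_le[of \<sigma> v] tanh_real_le_iff[of "\<bar>fld \<sigma> v\<bar>" \<kappa>] by (simp add: th_def \<eta>_def field_simps)

lemma fld_flip_same [simp]: "fld (flip v \<sigma>) v = fld \<sigma> v"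
  by (simp add: fld_def flip_def)

lemma th_flip_same [simp]: "th (flip v \<sigma>) v = th \<sigma> v"
  by (simp add: th_def)

lemma fld_flip_other:
  assumes "v \<in> V" "u \<noteq> v" shows "fld (flip v \<sigma>) u = fld \<sigma> u - 2 * J u v * \<sigma> v"
proof -
  have "fld (flip v \<sigma>) u = (\<Sum>w\<in>V - {u}. J u w * \<sigma> w - (if w = v then 2 * J u v * \<sigma> v else 0))"
    unfolding fld_def flip_def by (intro sum.cong) auto
  then show ?thesis using assms by (simp add: sum_subtractf fld_def)
qed

lemma th_flip_other:
  assumes "\<sigma> \<in> \<Omega>" "v \<in> V" "u \<in> V" "u \<noteq> v"
  shows "\<bar>th (flip v \<sigma>) u - th \<sigma> u\<bar> \<le> 2 * J u v"
proof -
  have "\<bar>th (flip v \<sigma>) u - th \<sigma> u\<bar> \<le> \<bar>fld (flip v \<sigma>) u - fld \<sigma> u\<bar>"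
    unfolding th_def by (rule abs_tanh_diff_le)
  also have "\<dots> = 2 * J u v"
    using assms J_nonneg[of u v] by (simp add: fld_flip_other abs_mult)
  finally show ?thesis .
qed

lemma resample_flip_same [simp]: "resample g v (flip v \<sigma>) = resample g v \<sigma>"
  by (simp add: resample_def)

lemma resample_eq:
  assumes "\<sigma> \<in> \<Omega>" "v \<in> V"
  shows "resample g v \<sigma> = g \<sigma> + n * flip_prob v \<sigma> * D v g \<sigma>"
  using config_cases[OF assms] n_pos
  by (auto simp: resample_def flip_prob_def D_def flip_def fun_upd_idem field_simps)

lemma P_eq: "\<sigma> \<in> \<Omega> \<Longrightarrow> P g \<sigma> = g \<sigma> + (\<Sum>v\<in>V. flip_prob v \<sigma> * D v g \<sigma>)"
  using n_pos by (simp add: P_def resample_eq sum.distrib add_divide_distrib sum_divide_distrib)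

lemma flip_prob_bounds:
  assumes "\<sigma> \<in> \<Omega>" "v \<in> V"
  shows "flip_prob v \<sigma> \<ge> \<eta> / n" "flip_prob v \<sigma> \<le> (1 - \<eta>) / n"
proof -
  have "\<bar>\<sigma> v * th \<sigma> v\<bar> \<le> 1 - 2 * \<eta>"
    using th_le[OF assms] abs_spin[OF assms] by (simp add: abs_mult)
  then have b: "\<eta> \<le> (1 - \<sigma> v * th \<sigma> v) / 2" "(1 - \<sigma> v * th \<sigma> v) / 2 \<le> 1 - \<eta>"
    by (auto simp: abs_le_iff)
  show "flip_prob v \<sigma> \<ge> \<eta> / n" "flip_prob v \<sigma> \<le> (1 - \<eta>) / n"
    using divide_right_mono[OF b(1), of "real n"] divide_right_mono[OF b(2), of "real n"]
    by (simp_all add: flip_prob_def)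
qed

lemma flip_prob_nonneg: "\<sigma> \<in> \<Omega> \<Longrightarrow> v \<in> V \<Longrightarrow> flip_prob v \<sigma> \<ge> 0"
  using flip_prob_bounds(1)[of \<sigma> v] \<eta>_pos n_pos by (meson divide_pos_pos less_imp_le of_nat_0_less_iff order_less_le_trans)

lemma resample_mono:
  assumes "\<sigma> \<in> \<Omega>" "v \<in> V" "\<And>\<tau>. \<tau> \<in> \<Omega> \<Longrightarrow> f \<tau> \<le> g \<tau>"
  shows "resample f v \<sigma> \<le> resample g v \<sigma>"
  unfolding resample_def using assms th_le[OF assms(1,2)] \<eta>_pos
  by (intro add_mono mult_left_mono) auto

lemma P_mono: "(\<And>\<tau>. \<tau> \<in> \<Omega> \<Longrightarrow> f \<tau> \<le> g \<tau>) \<Longrightarrow> \<sigma> \<in> \<Omega> \<Longrightarrow> P f \<sigma> \<le> P g \<sigma>"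
  unfolding P_def by (intro divide_right_mono sum_mono resample_mono) auto

lemma P_add: "P (\<lambda>\<tau>. f \<tau> + g \<tau>) \<sigma> = P f \<sigma> + P g \<sigma>"
  by (simp add: P_def resample_def sum.distrib[symmetric] add_divide_distrib[symmetric] algebra_simps)

lemma P_cmult: "P (\<lambda>\<tau>. c * f \<tau>) \<sigma> = c * P f \<sigma>"
  by (simp add: P_def resample_def sum_distrib_left algebra_simps)

lemma P_const: "P (\<lambda>_. c) = (\<lambda>_. c)"
  using n_pos by (simp add: P_def resample_def fun_eq_iff flip: add_divide_distrib distrib_right)

lemma P_sum: "P (\<lambda>\<tau>. \<Sum>i\<in>I. f i \<tau>) \<sigma> = (\<Sum>i\<in>I. P (f i) \<sigma>)"
  by (induction I rule: infinite_finite_induct) (simp_all add: P_add P_const)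

lemma Pt_mono:
  "(\<And>\<tau>. \<tau> \<in> \<Omega> \<Longrightarrow> f \<tau> \<le> g \<tau>) \<Longrightarrow> \<sigma> \<in> \<Omega> \<Longrightarrow> (P ^^ t) f \<sigma> \<le> (P ^^ t) g \<sigma>"
  by (induction t arbitrary: \<sigma>) (auto intro: P_mono)

lemma Pt_add: "(P ^^ t) (\<lambda>\<tau>. f \<tau> + g \<tau>) = (\<lambda>\<sigma>. (P ^^ t) f \<sigma> + (P ^^ t) g \<sigma>)"
  by (induction t) (auto intro!: ext simp: P_add)

lemma Pt_cmult: "(P ^^ t) (\<lambda>\<tau>. c * f \<tau>) = (\<lambda>\<sigma>. c * (P ^^ t) f \<sigma>)"
  by (induction t) (auto intro!: ext simp: P_cmult)

lemma Pt_const: "(P ^^ t) (\<lambda>_. c) = (\<lambda>_. c)"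
  by (induction t) (simp_all add: P_const)

lemma Pt_Suc: "(P ^^ Suc t) g = (P ^^ t) (P g)"
  by (simp add: funpow_Suc_right del: funpow.simps)

lemma Pt_sum: "(P ^^ t) (\<lambda>\<tau>. \<Sum>i\<in>I. f i \<tau>) = (\<lambda>\<sigma>. \<Sum>i\<in>I. (P ^^ t) (f i) \<sigma>)"
  by (induction I rule: infinite_finite_induct) (simp_all add: Pt_add Pt_const)

lemma Pt_le_const:
  "(\<And>\<tau>. \<tau> \<in> \<Omega> \<Longrightarrow> f \<tau> \<le> c) \<Longrightarrow> \<sigma> \<in> \<Omega> \<Longrightarrow> (P ^^ t) f \<sigma> \<le> c"
  using Pt_mono[of f "\<lambda>_. c"] by (simp add: Pt_const)

lemma Pt_ge_const:
  "(\<And>\<tau>. \<tau> \<in> \<Omega> \<Longrightarrow> c \<le> f \<tau>) \<Longrightarrow> \<sigma> \<in> \<Omega> \<Longrightarrow> c \<le> (P ^^ t) f \<sigma>"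
  using Pt_mono[of "\<lambda>_. c" f] by (simp add: Pt_const)

section \<open>Commuting the discrete gradient with one step\<close>

lemma abs_D_eq: "\<xi> \<in> \<Omega> \<Longrightarrow> u \<in> V \<Longrightarrow> \<bar>g (\<xi>(u := 1)) - g (\<xi>(u := -1))\<bar> = \<bar>D u g \<xi>\<bar>"
  using config_cases[of \<xi> u] by (auto simp: D_def flip_def fun_upd_idem)

text \<open>Flipping \<open>v\<close> affects the resampling at \<open>u\<close> in two ways: the
  values of \<open>g\<close> change, which is \<open>resample (D v g) u\<close>, and the
  probabilities change by at most \<open>J u v\<close>, which multiplies the gap of \<open>g\<close>
  across \<open>u\<close> in the flipped configuration.\<close>

lemma resample_flip_other:
  assumes "\<sigma> \<in> \<Omega>" "v \<in> V" "u \<in> V" "u \<noteq> v"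
  shows "\<bar>resample g u (flip v \<sigma>) - resample g u \<sigma> - resample (D v g) u \<sigma>\<bar>
         \<le> J u v * \<bar>D u g (flip v \<sigma>)\<bar>"
proof -
  let ?f = "flip v \<sigma>"
  have eq: "resample g u ?f - resample g u \<sigma> - resample (D v g) u \<sigma>
      = (th ?f u - th \<sigma> u) / 2 * (g (?f(u := 1)) - g (?f(u := -1)))"
    using assms(4) by (simp add: resample_def D_def flip_upd_other field_simps)
  have "\<bar>resample g u ?f - resample g u \<sigma> - resample (D v g) u \<sigma>\<bar>
      = \<bar>th ?f u - th \<sigma> u\<bar> / 2 * \<bar>D u g ?f\<bar>"
    unfolding eq by (simp add: abs_mult abs_D_eq[OF flip_config[OF assms(1,2)] assms(3)])
  also have "\<dots> \<le> J u v * \<bar>D u g ?f\<bar>"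
    using th_flip_other[OF assms] by (intro mult_right_mono) auto
  finally show ?thesis .
qed

text \<open>Resampling \<open>v\<close> forgets its spin, so the term at \<open>v\<close>
  disappears; this loss is the only source of contraction.\<close>

lemma D_P:
  assumes "v \<in> V"
  shows "D v (P g) \<sigma> = (\<Sum>u\<in>V - {v}. resample g u (flip v \<sigma>) - resample g u \<sigma>) / n"
  unfolding D_def P_def sum.remove[OF finite_atLeastAtMost assms]
  by (simp add: sum_subtractf diff_divide_distrib add_divide_distrib)

lemma abs_resample_le:
  assumes "\<sigma> \<in> \<Omega>" "u \<in> V" "\<And>\<tau>. \<tau> \<in> \<Omega> \<Longrightarrow> \<bar>g \<tau>\<bar> \<le> c"
  shows "\<bar>resample g u \<sigma>\<bar> \<le> c"
proof -
  have "g \<tau> \<le> c \<and> - c \<le> g \<tau>" if "\<tau> \<in> \<Omega>" for \<tau> using assms(3)[OF that] by auto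
  then have "resample g u \<sigma> \<le> resample (\<lambda>_. c) u \<sigma>" "resample (\<lambda>_. - c) u \<sigma> \<le> resample g u \<sigma>"
    using assms by (auto intro!: resample_mono)
  then show ?thesis by (simp add: resample_def field_simps abs_le_iff)
qed

lemma lipschitz_P:
  assumes L: "\<And>\<tau> u. \<tau> \<in> \<Omega> \<Longrightarrow> u \<in> V \<Longrightarrow> \<bar>D u g \<tau>\<bar> \<le> L u"
    and \<sigma>: "\<sigma> \<in> \<Omega>" and v: "v \<in> V"
  shows "\<bar>D v (P g) \<sigma>\<bar> \<le> (1 - 1 / n) * L v + (\<Sum>u\<in>V. J u v * L u) / n"
proof -
  have L0: "L u \<ge> 0" if "u \<in> V" for u using L[OF \<sigma> that] by linarith
  have "\<bar>\<Sum>u\<in>V - {v}. resample g u (flip v \<sigma>) - resample g u \<sigma>\<bar> \<le> (\<Sum>u\<in>V - {v}. L v + J u v * L u)"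
  proof (intro order_trans[OF sum_abs] sum_mono)
    fix u assume u: "u \<in> V - {v}"
    have "\<bar>resample (D v g) u \<sigma>\<bar> \<le> L v"
      using u v \<sigma> L by (intro abs_resample_le) auto
    moreover have "J u v * \<bar>D u g (flip v \<sigma>)\<bar> \<le> J u v * L u"
      using u v \<sigma> L J_nonneg by (intro mult_left_mono) auto
    ultimately show "\<bar>resample g u (flip v \<sigma>) - resample g u \<sigma>\<bar> \<le> L v + J u v * L u"
      using resample_flip_other[of \<sigma> v u g] u v \<sigma> by auto
  qed
  also have "\<dots> = (n - 1) * L v + (\<Sum>u\<in>V - {v}. J u v * L u)"
    using v n_pos by (simp add: sum.distrib of_nat_diff)
  \<comment> \<open>The nonnegative diagonal term is added to obtain the full matrix
    \<open>J\<close>, whose Perron vector is known.\<close>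
  also have "\<dots> \<le> (n - 1) * L v + (\<Sum>u\<in>V. J u v * L u)"
    using L0 v J_nonneg by (intro add_left_mono sum_mono2) auto
  finally have "\<bar>D v (P g) \<sigma>\<bar> \<le> ((n - 1) * L v + (\<Sum>u\<in>V. J u v * L u)) / n"
    using n_pos by (simp add: D_P[OF v] divide_right_mono)
  also have "real (n - 1) = real n - 1" using n_pos by simp
  finally show ?thesis using n_pos
    by (simp add: add_divide_distrib diff_divide_distrib left_diff_distrib)
qed

text \<open>Jensen for a two-point law; the gap is the product of the two probabilities times the
  squared difference of the values.\<close>

lemma resample_square_le:
  assumes "\<sigma> \<in> \<Omega>" "u \<in> V"
  shows "(resample g u \<sigma>)\<^sup>2 \<le> resample (\<lambda>\<tau>. (g \<tau>)\<^sup>2) u \<sigma>"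
proof -
  let ?x = "g (\<sigma>(u := 1))" and ?y = "g (\<sigma>(u := -1))"
  have "\<bar>th \<sigma> u\<bar> \<le> 1" using th_le[OF assms] \<eta>_pos by simp
  then have "0 \<le> (1 + th \<sigma> u) / 2 * ((1 - th \<sigma> u) / 2) * (?x - ?y)\<^sup>2" by auto
  then show ?thesis by (simp add: resample_def power2_eq_square field_simps)
qed

lemma square_add_le:
  fixes x y \<theta> :: real
  assumes "\<theta> > 0" shows "(x + y)\<^sup>2 \<le> (1 + \<theta>) * x\<^sup>2 + (1 + 1 / \<theta>) * y\<^sup>2"
proof -
  have "0 \<le> (\<theta> * x - y)\<^sup>2 / \<theta>" using assms by simp
  also have "\<dots> = (1 + \<theta>) * x\<^sup>2 + (1 + 1 / \<theta>) * y\<^sup>2 - (x + y)\<^sup>2"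
    using assms by (simp add: power2_eq_square field_simps)
  finally show ?thesis by simp
qed

text \<open>The 1 is the loss in Young's inequality with parameter 1/n. The other summand bounds (1
  + n) \<le> 2 n times the squared commutation error, which has relative size
  \<open>\<kappa>\<^sup>2 / (\<eta> * n\<^sup>2)\<close>.\<close>

definition comm_err :: real where "comm_err = 1 + 2 * \<kappa>\<^sup>2 / \<eta>"

lemma comm_err_pos: "comm_err > 0"
  using \<eta>_pos by (simp add: comm_err_def add_pos_nonneg)

text \<open>The commutation error involves the gradient at the neighbours of \<^term>\<open>\<sigma>\<close>; these are
  charged with probability at least \<^term>\<open>\<eta> / n\<close> by one step, which absorbs it into \<^term>\<open>P (G g)\<close>.\<close>

lemma G_P_le:
  assumes \<sigma>: "\<sigma> \<in> \<Omega>"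
  shows "G (P g) \<sigma> \<le> (1 + comm_err / n) * P (G g) \<sigma>"
proof -
  \<comment> \<open>\<open>A\<close> is the gradient resampled with the old probabilities, bounded
    through Cauchy-Schwarz and Jensen; \<open>e\<close> is what remains from the change of the
    probabilities.\<close>
  define A where "A v = (\<Sum>u\<in>V - {v}. resample (D v g) u \<sigma>) / n" for v
  define e where "e v = D v (P g) \<sigma> - A v" for v
  have n: "real n > 0" using n_pos by simp
  have A2: "(A v)\<^sup>2 \<le> P (\<lambda>\<tau>. (D v g \<tau>)\<^sup>2) \<sigma>" if v: "v \<in> V" for v
  proof -
    have "(\<Sum>u\<in>V - {v}. resample (D v g) u \<sigma>)\<^sup>2 \<le>
        (\<Sum>u\<in>V - {v}. (resample (D v g) u \<sigma>)\<^sup>2) * card (V - {v})"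
      by (rule sum_squared_le_sum_of_squares)
    also have "\<dots> \<le> (\<Sum>u\<in>V. (resample (D v g) u \<sigma>)\<^sup>2) * n"
      using card_mono[of V "V - {v}"] by (intro mult_mono sum_mono2) (auto simp: sum_nonneg v)
    also have "\<dots> \<le> (\<Sum>u\<in>V. resample (\<lambda>\<tau>. (D v g \<tau>)\<^sup>2) u \<sigma>) * n"
      using \<sigma> by (intro mult_right_mono sum_mono resample_square_le) auto
    finally show ?thesis using n by (simp add: A_def P_def power_divide power2_eq_square field_simps)
  qed
  have e2: "(e v)\<^sup>2 \<le> \<kappa>\<^sup>2 / n ^ 3 * G g (flip v \<sigma>)" if v: "v \<in> V" for v
  proof -
    have "\<bar>e v\<bar> = \<bar>\<Sum>u\<in>V - {v}. resample g u (flip v \<sigma>) - resample g u \<sigma> - resample (D v g) u \<sigma>\<bar> / n"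
      using n by (simp add: e_def A_def D_P[OF v] sum_subtractf flip: diff_divide_distrib)
    also have "\<dots> \<le> (\<Sum>u\<in>V - {v}. \<kappa> / n * \<bar>D u g (flip v \<sigma>)\<bar>) / n"
    proof (intro divide_right_mono order_trans[OF sum_abs] sum_mono)
      fix u assume u: "u \<in> V - {v}"
      have "J u v * \<bar>D u g (flip v \<sigma>)\<bar> \<le> \<kappa> / n * \<bar>D u g (flip v \<sigma>)\<bar>"
        using u v by (intro mult_right_mono J_le) auto
      then show "\<bar>resample g u (flip v \<sigma>) - resample g u \<sigma> - resample (D v g) u \<sigma>\<bar>
          \<le> \<kappa> / n * \<bar>D u g (flip v \<sigma>)\<bar>"
        using resample_flip_other[of \<sigma> v u g] u v \<sigma> by auto
    qed simp
    also have "\<dots> \<le> (\<Sum>u\<in>V. \<kappa> / n * \<bar>D u g (flip v \<sigma>)\<bar>) / n"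
      using \<kappa>_nonneg n by (intro divide_right_mono sum_mono2) auto
    also have "\<dots> = \<kappa> / n\<^sup>2 * (\<Sum>u\<in>V. \<bar>D u g (flip v \<sigma>)\<bar>)"
      by (simp add: sum_distrib_left power2_eq_square flip: sum_divide_distrib)
    finally have "(e v)\<^sup>2 \<le> (\<kappa> / n\<^sup>2 * (\<Sum>u\<in>V. \<bar>D u g (flip v \<sigma>)\<bar>))\<^sup>2"
      by (rule square_le_if_abs_le)
    also have "\<dots> = \<kappa>\<^sup>2 / n ^ 4 * (\<Sum>u\<in>V. \<bar>D u g (flip v \<sigma>)\<bar>)\<^sup>2"
      by (simp add: power_mult_distrib power_divide flip: power_mult)
    also have "\<dots> \<le> \<kappa>\<^sup>2 / n ^ 4 * (G g (flip v \<sigma>) * n)"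
      using sum_squared_le_sum_of_squares[of "\<lambda>u. \<bar>D u g (flip v \<sigma>)\<bar>" V]
      by (intro mult_left_mono) (auto simp: G_def)
    also have "\<dots> = \<kappa>\<^sup>2 / n ^ 3 * G g (flip v \<sigma>)"
      using n by (simp add: eval_nat_numeral)
    finally show ?thesis .
  qed
  have G0: "G g \<tau> \<ge> 0" for \<tau> by (simp add: G_def sum_nonneg)
  have sumA: "(\<Sum>v\<in>V. (A v)\<^sup>2) \<le> P (G g) \<sigma>"
    unfolding G_def[abs_def] P_sum by (intro sum_mono A2)
  have "\<eta> / n * (\<Sum>v\<in>V. G g (flip v \<sigma>)) \<le> (\<Sum>v\<in>V. flip_prob v \<sigma> * G g (flip v \<sigma>))"
    unfolding sum_distrib_left using flip_prob_bounds(1)[OF \<sigma>] G0 by (intro sum_mono mult_right_mono) auto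
  also have "\<dots> \<le> P (G g) \<sigma>"
  proof -
    have "(\<Sum>v\<in>V. flip_prob v \<sigma>) \<le> (\<Sum>v\<in>V. (1 - \<eta>) / n)"
      using flip_prob_bounds(2)[OF \<sigma>] by (intro sum_mono) auto
    then have "(\<Sum>v\<in>V. flip_prob v \<sigma>) \<le> 1" using n \<eta>_pos by simp
    then have "0 \<le> (1 - (\<Sum>v\<in>V. flip_prob v \<sigma>)) * G g \<sigma>" using G0 by simp
    then show ?thesis using P_eq[OF \<sigma>, of "G g"]
      by (simp add: D_def algebra_simps sum_subtractf sum_distrib_left)
  qed
  finally have nb: "\<eta> / n * (\<Sum>v\<in>V. G g (flip v \<sigma>)) \<le> P (G g) \<sigma>" .
  have "(\<Sum>v\<in>V. (e v)\<^sup>2) \<le> \<kappa>\<^sup>2 / n ^ 3 * (\<Sum>v\<in>V. G g (flip v \<sigma>))"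
    unfolding sum_distrib_left by (intro sum_mono e2)
  also have "\<dots> = \<kappa>\<^sup>2 / (\<eta> * n\<^sup>2) * (\<eta> / n * (\<Sum>v\<in>V. G g (flip v \<sigma>)))"
    using n \<eta>_pos by (simp add: eval_nat_numeral)
  also have "\<dots> \<le> \<kappa>\<^sup>2 / (\<eta> * n\<^sup>2) * P (G g) \<sigma>"
    using nb \<eta>_pos by (intro mult_left_mono) auto
  finally have sume: "(\<Sum>v\<in>V. (e v)\<^sup>2) \<le> \<kappa>\<^sup>2 / (\<eta> * n\<^sup>2) * P (G g) \<sigma>" .
  have PG0: "P (G g) \<sigma> \<ge> 0" using sumA by (meson order_trans sum_nonneg zero_le_power2)
  have "G (P g) \<sigma> = (\<Sum>v\<in>V. (A v + e v)\<^sup>2)" by (simp add: G_def e_def)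
  \<comment> \<open>The estimate will be iterated n times, so the main term may only grow by 1 +
    O(1/n). The error is small enough to bear the resulting factor 1 + n.\<close>
  also have "\<dots> \<le> (\<Sum>v\<in>V. (1 + 1 / n) * (A v)\<^sup>2 + (1 + n) * (e v)\<^sup>2)"
    using square_add_le[of "1 / real n"] n by (intro sum_mono) auto
  also have "\<dots> = (1 + 1 / n) * (\<Sum>v\<in>V. (A v)\<^sup>2) + (1 + n) * (\<Sum>v\<in>V. (e v)\<^sup>2)"
    by (simp add: sum.distrib sum_distrib_left)
  also have "\<dots> \<le> (1 + 1 / n) * P (G g) \<sigma> + (1 + n) * (\<kappa>\<^sup>2 / (\<eta> * n\<^sup>2) * P (G g) \<sigma>)"
    using sumA sume by (intro add_mono mult_left_mono) auto
  also have "\<dots> = (1 + 1 / n + (1 + n) * (\<kappa>\<^sup>2 / (\<eta> * n\<^sup>2))) * P (G g) \<sigma>"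
    by (simp add: algebra_simps)
  also have "\<dots> \<le> (1 + 1 / n + (2 * n) * (\<kappa>\<^sup>2 / (\<eta> * n\<^sup>2))) * P (G g) \<sigma>"
    using PG0 n_pos \<eta>_pos by (intro mult_right_mono add_left_mono) auto
  also have "1 + 1 / n + (2 * n) * (\<kappa>\<^sup>2 / (\<eta> * n\<^sup>2)) = 1 + comm_err / n"
    using n \<eta>_pos by (simp add: comm_err_def power2_eq_square field_simps)
  finally show ?thesis .
qed

section \<open>One-step variance and the reverse Poincare inequality\<close>

lemma variance_eq:
  assumes "\<sigma> \<in> \<Omega>"
  shows "P (\<lambda>\<tau>. (g \<tau>)\<^sup>2) \<sigma> - (P g \<sigma>)\<^sup>2 =
    (\<Sum>v\<in>V. flip_prob v \<sigma> * (D v g \<sigma>)\<^sup>2) - (\<Sum>v\<in>V. flip_prob v \<sigma> * D v g \<sigma>)\<^sup>2"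
proof -
  have "D v (\<lambda>\<tau>. (g \<tau>)\<^sup>2) \<sigma> = (D v g \<sigma>)\<^sup>2 + 2 * g \<sigma> * D v g \<sigma>" for v
    by (simp add: D_def power2_eq_square algebra_simps)
  then show ?thesis
    by (simp add: P_eq[OF assms] distrib_left sum.distrib sum_distrib_left power2_eq_square algebra_simps)
qed

text \<open>A step really flips a spin with probability at most 1 - \<open>\<eta>\<close>, so by
  Cauchy-Schwarz the squared mean of the increment leaves a fraction \<open>\<eta>\<close> of its
  second moment. The second factor \<open>\<eta>\<close> bounds each flip probability from
  below.\<close>

lemma variance_ge:
  assumes \<sigma>: "\<sigma> \<in> \<Omega>"
  shows "P (\<lambda>\<tau>. (g \<tau>)\<^sup>2) \<sigma> - (P g \<sigma>)\<^sup>2 \<ge> \<eta>\<^sup>2 / n * G g \<sigma>"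
proof -
  let ?q = "\<lambda>v. flip_prob v \<sigma>" and ?x = "\<lambda>v. D v g \<sigma>"
  have n: "real n > 0" using n_pos by simp
  have "(\<Sum>v\<in>V. ?q v * ?x v)\<^sup>2 = (\<Sum>v\<in>V. sqrt (?q v) * (sqrt (?q v) * ?x v))\<^sup>2"
    using flip_prob_nonneg[OF \<sigma>]
    by (intro arg_cong[of _ _ "\<lambda>x. x\<^sup>2"] sum.cong) (auto simp: mult.assoc[symmetric])
  also have "\<dots> \<le> (\<Sum>v\<in>V. (sqrt (?q v))\<^sup>2) * (\<Sum>v\<in>V. (sqrt (?q v) * ?x v)\<^sup>2)"
    by (rule Cauchy_Schwarz_ineq_sum)
  also have "\<dots> = (\<Sum>v\<in>V. ?q v) * (\<Sum>v\<in>V. ?q v * (?x v)\<^sup>2)"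
    using flip_prob_nonneg[OF \<sigma>] by (intro arg_cong2[of _ _ _ _ "(*)"] sum.cong) (auto simp: power_mult_distrib)
  also have "\<dots> \<le> (1 - \<eta>) * (\<Sum>v\<in>V. ?q v * (?x v)\<^sup>2)"
  proof (intro mult_right_mono)
    have "(\<Sum>v\<in>V. ?q v) \<le> (\<Sum>v\<in>V. (1 - \<eta>) / n)"
      using flip_prob_bounds(2)[OF \<sigma>] by (intro sum_mono) auto
    then show "(\<Sum>v\<in>V. ?q v) \<le> 1 - \<eta>" using n by simp
  qed (use flip_prob_nonneg[OF \<sigma>] in \<open>auto intro!: sum_nonneg\<close>)
  finally have "P (\<lambda>\<tau>. (g \<tau>)\<^sup>2) \<sigma> - (P g \<sigma>)\<^sup>2 \<ge> \<eta> * (\<Sum>v\<in>V. ?q v * (?x v)\<^sup>2)"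
    by (simp add: variance_eq[OF \<sigma>] algebra_simps)
  moreover have "\<eta> / n * G g \<sigma> \<le> (\<Sum>v\<in>V. ?q v * (?x v)\<^sup>2)"
    unfolding G_def sum_distrib_left using flip_prob_bounds(1)[OF \<sigma>]
    by (intro sum_mono mult_right_mono) auto
  then have "\<eta> * (\<eta> / n * G g \<sigma>) \<le> \<eta> * (\<Sum>v\<in>V. ?q v * (?x v)\<^sup>2)"
    using \<eta>_pos by (intro mult_left_mono) auto
  ultimately show ?thesis by (simp add: power2_eq_square)
qed

lemma variance_le:
  assumes "\<sigma> \<in> \<Omega>"
  shows "P (\<lambda>\<tau>. (g \<tau>)\<^sup>2) \<sigma> - (P g \<sigma>)\<^sup>2 \<le> G g \<sigma> / n"
proof -
  have "flip_prob v \<sigma> \<le> 1 / n" if "v \<in> V" for v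
    using flip_prob_bounds(2)[OF assms that] \<eta>_pos n_pos
    by (meson diff_le_eq divide_right_mono le_add_same_cancel1 less_imp_le of_nat_0_le_iff order_trans)
  then have "(\<Sum>v\<in>V. flip_prob v \<sigma> * (D v g \<sigma>)\<^sup>2) \<le> (\<Sum>v\<in>V. 1 / n * (D v g \<sigma>)\<^sup>2)"
    by (intro sum_mono mult_right_mono) auto
  then show ?thesis using zero_le_power2[of "\<Sum>v\<in>V. flip_prob v \<sigma> * D v g \<sigma>"]
    unfolding variance_eq[OF assms] G_def sum_divide_distrib times_divide_eq_left mult_1_left
    by linarith
qed

lemma G_Pt_le: "\<sigma> \<in> \<Omega> \<Longrightarrow> G ((P ^^ t) g) \<sigma> \<le> (1 + comm_err / n) ^ t * (P ^^ t) (G g) \<sigma>"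
proof (induction t arbitrary: \<sigma>)
  case (Suc t)
  have "G ((P ^^ Suc t) g) \<sigma> \<le> (1 + comm_err / n) * P (G ((P ^^ t) g)) \<sigma>"
    using G_P_le[OF Suc.prems] by simp
  also have "\<dots> \<le> (1 + comm_err / n) * P (\<lambda>\<tau>. (1 + comm_err / n) ^ t * (P ^^ t) (G g) \<tau>) \<sigma>"
    using comm_err_pos Suc by (intro mult_left_mono P_mono) auto
  finally show ?case by (simp add: P_cmult)
qed simp

text \<open>Reverse Poincare inequality: by the commutation estimate the variance added by each of the
  \<^term>\<open>Suc t\<close> steps dominates the gradient after \<^term>\<open>t\<close> steps.\<close>

lemma Pt_variance_ge:
  assumes "\<sigma> \<in> \<Omega>"
  shows "Suc t * (\<eta>\<^sup>2 / n) * G ((P ^^ t) f) \<sigma>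
     \<le> (1 + comm_err / n) ^ t * ((P ^^ Suc t) (\<lambda>\<tau>. (f \<tau>)\<^sup>2) \<sigma> - ((P ^^ Suc t) f \<sigma>)\<^sup>2)"
  using assms
proof (induction t arbitrary: f \<sigma>)
  case 0
  then show ?case using variance_ge by simp
next
  case (Suc t)
  let ?r = "1 + comm_err / n" and ?e = "\<eta>\<^sup>2 / n"
  have r1: "?r \<ge> 1" using comm_err_pos n_pos by simp
  \<comment> \<open>Law of total variance over t + 2 steps: \<open>?var1\<close> is the variance of
    \<open>P f\<close> over the first t + 1 of them, handled by the induction hypothesis for
    \<open>P f\<close>; the remainder is the averaged variance of the last step, handled by
    \<open>variance_ge\<close> and \<open>G_Pt_le\<close>.\<close>
  let ?var1 = "(P ^^ Suc t) (\<lambda>\<tau>. (P f \<tau>)\<^sup>2) \<sigma> - ((P ^^ Suc t) (P f) \<sigma>)\<^sup>2"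
  have IH: "Suc t * ?e * G ((P ^^ t) (P f)) \<sigma> \<le> ?r ^ t * ?var1"
    by (rule Suc.IH) fact
  \<comment> \<open>The induction hypothesis itself gives the sign, its left side being nonnegative;
    this allows the power of \<open>?r\<close> to be raised by one.\<close>
  have var1: "?var1 \<ge> 0"
  proof -
    have "0 \<le> Suc t * ?e * G ((P ^^ t) (P f)) \<sigma>" by (simp add: G_def sum_nonneg)
    with IH have "0 \<le> ?r ^ t * ?var1" by linarith
    moreover have "?r ^ t > 0" using r1 by simp
    ultimately show ?thesis by (rule nonneg_if_mult_nonneg)
  qed
  have "?e * G ((P ^^ Suc t) f) \<sigma> \<le> ?e * (?r ^ Suc t * (P ^^ Suc t) (G f) \<sigma>)"
    using n_pos by (intro mult_left_mono G_Pt_le Suc.prems) auto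
  also have "\<dots> = ?r ^ Suc t * (P ^^ Suc t) (\<lambda>\<tau>. ?e * G f \<tau>) \<sigma>"
    by (subst Pt_cmult) (simp add: ac_simps del: funpow.simps power_Suc)
  also have "\<dots> \<le> ?r ^ Suc t * (P ^^ Suc t) (\<lambda>\<tau>. P (\<lambda>\<tau>. (f \<tau>)\<^sup>2) \<tau> + (-1) * (P f \<tau>)\<^sup>2) \<sigma>"
    using variance_ge Suc.prems r1 by (intro mult_left_mono Pt_mono) (auto simp del: funpow.simps)
  also have "\<dots> = ?r ^ Suc t * ((P ^^ Suc (Suc t)) (\<lambda>\<tau>. (f \<tau>)\<^sup>2) \<sigma> - (P ^^ Suc t) (\<lambda>\<tau>. (P f \<tau>)\<^sup>2) \<sigma>)"
    by (subst Pt_add, subst Pt_cmult, subst (2) Pt_Suc) simp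
  finally have 1: "?e * G ((P ^^ Suc t) f) \<sigma> \<le>
    ?r ^ Suc t * ((P ^^ Suc (Suc t)) (\<lambda>\<tau>. (f \<tau>)\<^sup>2) \<sigma> - (P ^^ Suc t) (\<lambda>\<tau>. (P f \<tau>)\<^sup>2) \<sigma>)" .
  have "?r ^ t * ?var1 \<le> ?r ^ Suc t * ?var1"
    using r1 var1 by (intro mult_right_mono power_increasing) auto
  with IH have 2: "Suc t * ?e * G ((P ^^ Suc t) f) \<sigma> \<le> ?r ^ Suc t * ?var1"
    by (simp add: Pt_Suc del: funpow.simps)
  have "Suc (Suc t) * ?e * G ((P ^^ Suc t) f) \<sigma>
      = ?e * G ((P ^^ Suc t) f) \<sigma> + Suc t * ?e * G ((P ^^ Suc t) f) \<sigma>"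
    unfolding of_nat_Suc[of "Suc t"] by (simp only: distrib_right mult_1_left)
  also have "\<dots> \<le> ?r ^ Suc t * ((P ^^ Suc (Suc t)) (\<lambda>\<tau>. (f \<tau>)\<^sup>2) \<sigma> - ((P ^^ Suc t) (P f) \<sigma>)\<^sup>2)"
    using 1 2 by (simp add: algebra_simps del: funpow.simps power_Suc)
  finally show ?case by (simp add: Pt_Suc del: funpow.simps)
qed

definition grad_bound :: real where "grad_bound = exp comm_err / \<eta>\<^sup>2"

lemma grad_bound_pos: "grad_bound > 0" using \<eta>_pos by (simp add: grad_bound_def)

text \<open>With n steps the prefactor \<open>Suc n * (\<eta>\<^sup>2 / n)\<close> is already at
  least \<open>\<eta>\<^sup>2\<close>, while the accumulated commutation factor is still at most
  \<open>exp comm_err\<close>. The variance of \<open>f\<close> is at most 1.\<close>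

lemma G_Pn_le:
  assumes \<sigma>: "\<sigma> \<in> \<Omega>" and f: "\<And>\<tau>. \<tau> \<in> \<Omega> \<Longrightarrow> \<bar>f \<tau>\<bar> \<le> 1"
  shows "G ((P ^^ n) f) \<sigma> \<le> grad_bound"
proof -
  have n: "real n > 0" using n_pos by simp
  have "(P ^^ Suc n) (\<lambda>\<tau>. (f \<tau>)\<^sup>2) \<sigma> \<le> 1"
    using f \<sigma> by (intro Pt_le_const) (auto simp: abs_square_le_1)
  then have v: "(P ^^ Suc n) (\<lambda>\<tau>. (f \<tau>)\<^sup>2) \<sigma> - ((P ^^ Suc n) f \<sigma>)\<^sup>2 \<le> 1"
    using zero_le_power2[of "(P ^^ Suc n) f \<sigma>"] by linarith
  have "(1 + comm_err / n) ^ n \<le> exp (comm_err / n) ^ n" using comm_err_pos n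
    by (intro power_mono exp_ge_add_one_self) auto
  also have "\<dots> = exp comm_err" using n by (simp flip: exp_of_nat_mult)
  finally have e: "(1 + comm_err / n) ^ n \<le> exp comm_err" .
  have "\<eta>\<^sup>2 * G ((P ^^ n) f) \<sigma> \<le> Suc n * (\<eta>\<^sup>2 / n) * G ((P ^^ n) f) \<sigma>"
    using n by (intro mult_right_mono) (auto simp: G_def sum_nonneg field_simps)
  also have "\<dots> \<le> (1 + comm_err / n) ^ n * ((P ^^ Suc n) (\<lambda>\<tau>. (f \<tau>)\<^sup>2) \<sigma> - ((P ^^ Suc n) f \<sigma>)\<^sup>2)"
    by (rule Pt_variance_ge) fact
  also have "\<dots> \<le> exp comm_err * 1"
  proof (rule mult_mono')
    show "0 \<le> (P ^^ Suc n) (\<lambda>\<tau>. (f \<tau>)\<^sup>2) \<sigma> - ((P ^^ Suc n) f \<sigma>)\<^sup>2"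
    proof -
      have "0 \<le> Suc n * (\<eta>\<^sup>2 / n) * G ((P ^^ n) f) \<sigma>" by (simp add: G_def sum_nonneg)
      also note Pt_variance_ge[OF \<sigma>]
      finally show ?thesis
        by (rule nonneg_if_mult_nonneg) (use comm_err_pos n in \<open>auto intro!: zero_less_power add_pos_pos\<close>)
    qed
  qed (use e v comm_err_pos in auto)
  finally show ?thesis using \<eta>_pos by (simp add: grad_bound_def field_simps)
qed

text \<open>One configuration is turned into the other site by site, each change being either
  nothing or a flip. Configurations share the value \<open>undefined\<close> off \<open>V\<close>,
  so the path ends exactly at the target.\<close>

lemma abs_diff_le_sum_lipschitz:
  assumes L: "\<And>\<tau> u. \<tau> \<in> \<Omega> \<Longrightarrow> u \<in> V \<Longrightarrow> \<bar>D u g \<tau>\<bar> \<le> L u"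
    and \<sigma>: "\<sigma> \<in> \<Omega>" and \<tau>: "\<tau> \<in> \<Omega>"
  shows "\<bar>g \<sigma> - g \<tau>\<bar> \<le> (\<Sum>v\<in>V. L v)"
proof -
  have "override_on \<sigma> \<tau> A \<in> \<Omega> \<and> \<bar>g \<sigma> - g (override_on \<sigma> \<tau> A)\<bar> \<le> (\<Sum>v\<in>A. L v)"
    if "finite A" "A \<subseteq> V" for A
    using that
  proof (induction A rule: finite_induct)
    case empty
    then show ?case using \<sigma> by simp
  next
    case (insert x A)
    let ?\<xi> = "override_on \<sigma> \<tau> A"
    have x: "x \<in> V" and \<xi>: "?\<xi> \<in> \<Omega>" and IH: "\<bar>g \<sigma> - g ?\<xi>\<bar> \<le> (\<Sum>v\<in>A. L v)"
      using insert by auto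
    have "override_on \<sigma> \<tau> (insert x A) = ?\<xi> \<or> override_on \<sigma> \<tau> (insert x A) = flip x ?\<xi>"
      using config_cases[OF \<xi> x] config_cases[OF \<tau> x]
      by (auto simp: override_on_insert flip_def fun_upd_idem)
    then show ?case
    proof
      assume "override_on \<sigma> \<tau> (insert x A) = ?\<xi>"
      then show ?thesis using \<xi> IH insert.hyps L[OF \<xi> x] by simp
    next
      assume *: "override_on \<sigma> \<tau> (insert x A) = flip x ?\<xi>"
      then have "\<bar>g ?\<xi> - g (flip x ?\<xi>)\<bar> \<le> L x" using L[OF \<xi> x] by (simp add: D_def abs_minus_commute)
      then show ?thesis using * \<xi> IH insert.hyps x by simp
    qed
  qed
  from this[of V] have "\<bar>g \<sigma> - g (override_on \<sigma> \<tau> V)\<bar> \<le> (\<Sum>v\<in>V. L v)" by simp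
  moreover have "override_on \<sigma> \<tau> V = \<tau>"
    using \<sigma> \<tau> by (auto simp: override_on_def configs_def PiE_def extensional_def fun_eq_iff)
  ultimately show ?thesis by simp
qed

section \<open>Symmetrisation and contraction\<close>

lemma perm_config:
  assumes \<pi>: "\<pi> permutes V" and \<sigma>: "\<sigma> \<in> \<Omega>"
  shows "\<sigma> \<circ> \<pi> \<in> \<Omega>"
  unfolding configs_def
proof (rule PiE_I)
  fix x assume "x \<in> V"
  then show "(\<sigma> \<circ> \<pi>) x \<in> {-1, 1}"
    using config_cases[OF \<sigma>, of "\<pi> x"] permutes_in_image[OF \<pi>, of x] by auto
next
  fix x assume "x \<notin> V"
  then show "(\<sigma> \<circ> \<pi>) x = undefined"
    using \<sigma> permutes_not_in[OF \<pi>, of x] by (auto simp: configs_def PiE_def extensional_def)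
qed

lemma sum_configs_perm:
  assumes \<pi>: "\<pi> permutes V"
  shows "(\<Sum>\<sigma>\<in>\<Omega>. h (\<sigma> \<circ> \<pi>)) = (\<Sum>\<sigma>\<in>\<Omega>. h \<sigma>)"
  by (rule sum.reindex_bij_witness[of _ "\<lambda>\<sigma>. \<sigma> \<circ> inv \<pi>" "\<lambda>\<sigma>. \<sigma> \<circ> \<pi>"])
    (simp_all add: perm_config[OF \<pi>] perm_config[OF permutes_inv[OF \<pi>]] comp_assoc
      permutes_inv_o[OF \<pi>])

definition aut :: "(nat \<Rightarrow> nat) \<Rightarrow> bool" where
  "aut \<pi> \<longleftrightarrow> \<pi> permutes V \<and> (\<forall>v\<in>V. \<forall>w\<in>V. J (\<pi> v) (\<pi> w) = J v w)"

lemma fld_aut: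
  assumes \<pi>: "aut \<pi>" and v: "v \<in> V"
  shows "fld (\<sigma> \<circ> \<pi>) v = fld \<sigma> (\<pi> v)"
proof -
  have p: "\<pi> permutes V" using \<pi> by (simp add: aut_def)
  have "bij_betw \<pi> (V - {v}) (V - {\<pi> v})"
    unfolding bij_betw_def image_set_diff[OF permutes_inj[OF p]] permutes_image[OF p]
    using inj_on_subset[OF permutes_inj[OF p]] by simp
  then have "(\<Sum>w\<in>V - {v}. J (\<pi> v) (\<pi> w) * \<sigma> (\<pi> w)) = (\<Sum>u\<in>V - {\<pi> v}. J (\<pi> v) u * \<sigma> u)"
    by (rule sum.reindex_bij_betw)
  then show ?thesis using \<pi> v by (simp add: fld_def aut_def)
qed

lemma comp_perm_upd:
  assumes "\<pi> permutes V" shows "\<sigma>(\<pi> v := s) \<circ> \<pi> = (\<sigma> \<circ> \<pi>)(v := s)"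
  using permutes_inj[OF assms] by (auto simp: fun_eq_iff inj_eq)

lemma P_aut:
  assumes \<pi>: "aut \<pi>"
  shows "P (\<lambda>\<tau>. g (\<tau> \<circ> \<pi>)) \<sigma> = P g (\<sigma> \<circ> \<pi>)"
proof -
  have p: "\<pi> permutes V" using \<pi> by (simp add: aut_def)
  have "(\<Sum>v\<in>V. resample (\<lambda>\<tau>. g (\<tau> \<circ> \<pi>)) v \<sigma>) = (\<Sum>v\<in>V. resample (\<lambda>\<tau>. g (\<tau> \<circ> \<pi>)) (\<pi> v) \<sigma>)"
    by (rule sum.permute[OF p, unfolded o_def])
  also have "\<dots> = (\<Sum>v\<in>V. resample g v (\<sigma> \<circ> \<pi>))"
    by (intro sum.cong refl) (simp add: resample_def th_def fld_aut[OF \<pi>] comp_perm_upd[OF p])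
  finally show ?thesis by (simp add: P_def)
qed

lemma Pt_aut: "aut \<pi> \<Longrightarrow> (P ^^ t) (\<lambda>\<tau>. g (\<tau> \<circ> \<pi>)) = (\<lambda>\<sigma>. (P ^^ t) g (\<sigma> \<circ> \<pi>))"
  by (induction t) (auto intro!: ext simp: P_aut)

text \<open>If \<open>w\<close> and \<open>v\<close> carry the same spin, flipping \<open>w\<close>
  is flipping \<open>v\<close> followed by exchanging the two sites, which \<open>g\<close> does not
  see. Thus the same square occurs in \<open>G\<close> once for every such site.\<close>

lemma symmetric_gradient_half:
  assumes GC: "G g \<sigma> \<le> C" and W: "W \<subseteq> V" and v: "v \<in> W" and \<sigma>: "\<sigma> \<in> \<Omega>"
    and sym: "\<And>\<tau> w. \<tau> \<in> \<Omega> \<Longrightarrow> w \<in> W \<Longrightarrow> g (\<tau> \<circ> Transposition.transpose v w) = g \<tau>"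
  shows "card {w \<in> W. \<sigma> w = \<sigma> v} * (D v g \<sigma>)\<^sup>2 \<le> C"
proof -
  have "D w g \<sigma> = D v g \<sigma>" if "w \<in> W" "\<sigma> w = \<sigma> v" for w
  proof -
    have "flip w \<sigma> = flip v \<sigma> \<circ> Transposition.transpose v w"
    proof (rule ext)
      fix x
      show "flip w \<sigma> x = (flip v \<sigma> \<circ> Transposition.transpose v w) x"
        using that(2)
        by (simp only: flip_def o_apply Transposition.transpose_def fun_upd_apply split: if_split) metis
    qed
    moreover have "flip v \<sigma> \<in> \<Omega>" using W v \<sigma> by auto
    ultimately show ?thesis using sym[of "flip v \<sigma>" w] that by (simp add: D_def)
  qed
  then have "card {w \<in> W. \<sigma> w = \<sigma> v} * (D v g \<sigma>)\<^sup>2 = (\<Sum>w\<in>{w \<in> W. \<sigma> w = \<sigma> v}. (D w g \<sigma>)\<^sup>2)"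
    by simp
  also have "\<dots> \<le> G g \<sigma>" unfolding G_def using W by (intro sum_mono2) auto
  finally show ?thesis using GC by simp
qed

text \<open>At one of the two ends of an edge, at least half of the class carries the spin that the edge
  flips, and the edges flipping these spins all have the same gradient.\<close>

lemma symmetric_gradient:
  assumes GC: "\<And>\<tau>. \<tau> \<in> \<Omega> \<Longrightarrow> G g \<tau> \<le> C" and W: "W \<subseteq> V" and v: "v \<in> W" and \<sigma>: "\<sigma> \<in> \<Omega>"
    and sym: "\<And>\<tau> w. \<tau> \<in> \<Omega> \<Longrightarrow> w \<in> W \<Longrightarrow> g (\<tau> \<circ> Transposition.transpose v w) = g \<tau>"
  shows "card W * (D v g \<sigma>)\<^sup>2 \<le> 2 * C"
proof -
  let ?f = "flip v \<sigma>"
  let ?A = "{w \<in> W. \<sigma> w = \<sigma> v}" and ?B = "{w \<in> W. ?f w = ?f v}"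
  have f: "?f \<in> \<Omega>" using W v \<sigma> by auto
  have fin: "finite W" using W by (rule finite_subset) simp
  have "W \<subseteq> ?A \<union> ?B"
  proof
    fix w assume w: "w \<in> W"
    then have "w \<in> V" "v \<in> V" using W v by auto
    then show "w \<in> ?A \<union> ?B" using w config_cases[OF \<sigma>, of w] config_cases[OF \<sigma>, of v]
      by (auto simp: flip_def)
  qed
  then have "card W \<le> card (?A \<union> ?B)" using fin by (intro card_mono) auto
  also have "\<dots> \<le> card ?A + card ?B" by (rule card_Un_le)
  finally have "real (card W) * (D v g \<sigma>)\<^sup>2 \<le> real (card ?A + card ?B) * (D v g \<sigma>)\<^sup>2"
    by (intro mult_right_mono) auto
  also have "\<dots> = card ?A * (D v g \<sigma>)\<^sup>2 + card ?B * (D v g ?f)\<^sup>2"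
    by (simp add: D_flip distrib_right)
  also have "\<dots> \<le> C + C"
    using symmetric_gradient_half[OF GC W v _ sym] \<sigma> f by (intro add_mono) blast+
  finally show ?thesis by simp
qed

section \<open>Stationarity from detailed balance\<close>

text \<open>For each \<open>v\<close> the change of variables by \<open>flip v\<close> preserves the
  weight times the flip probability and reverses the sign of \<open>D v g\<close>, so the generator
  term equals its own negative.\<close>

lemma stationary_P:
  assumes db: "\<And>\<sigma> v. \<sigma> \<in> \<Omega> \<Longrightarrow> v \<in> V \<Longrightarrow> w (flip v \<sigma>) * flip_prob v (flip v \<sigma>) = w \<sigma> * flip_prob v \<sigma>"
  shows "(\<Sum>\<sigma>\<in>\<Omega>. w \<sigma> * P g \<sigma>) = (\<Sum>\<sigma>\<in>\<Omega>. w \<sigma> * g \<sigma>)"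
proof -
  have zero: "(\<Sum>\<sigma>\<in>\<Omega>. w \<sigma> * (flip_prob v \<sigma> * D v g \<sigma>)) = 0" if v: "v \<in> V" for v
  proof -
    let ?h = "\<lambda>\<sigma>. w \<sigma> * (flip_prob v \<sigma> * D v g \<sigma>)"
    have "(\<Sum>\<sigma>\<in>\<Omega>. ?h \<sigma>) = (\<Sum>\<sigma>\<in>\<Omega>. ?h (flip v \<sigma>))"
      by (rule sum.reindex_bij_witness[of _ "flip v" "flip v"]) (use v in auto)
    also have "\<dots> = (\<Sum>\<sigma>\<in>\<Omega>. - ?h \<sigma>)"
      using db[OF _ v] by (intro sum.cong) (auto simp: D_flip mult.assoc[symmetric])
    finally show ?thesis by (simp add: sum_negf)
  qed
  have "(\<Sum>\<sigma>\<in>\<Omega>. w \<sigma> * P g \<sigma>) =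
      (\<Sum>\<sigma>\<in>\<Omega>. w \<sigma> * g \<sigma>) + (\<Sum>\<sigma>\<in>\<Omega>. \<Sum>v\<in>V. w \<sigma> * (flip_prob v \<sigma> * D v g \<sigma>))"
    by (simp add: P_eq distrib_left sum.distrib sum_distrib_left)
  also have "(\<Sum>\<sigma>\<in>\<Omega>. \<Sum>v\<in>V. w \<sigma> * (flip_prob v \<sigma> * D v g \<sigma>)) = 0"
    using zero by (subst sum.swap) simp
  finally show ?thesis by simp
qed

lemma stationary_Pt:
  assumes "\<And>\<sigma> v. \<sigma> \<in> \<Omega> \<Longrightarrow> v \<in> V \<Longrightarrow> w (flip v \<sigma>) * flip_prob v (flip v \<sigma>) = w \<sigma> * flip_prob v \<sigma>"
  shows "(\<Sum>\<sigma>\<in>\<Omega>. w \<sigma> * (P ^^ t) g \<sigma>) = (\<Sum>\<sigma>\<in>\<Omega>. w \<sigma> * g \<sigma>)"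
proof (induction t)
  case (Suc t)
  then show ?case using stationary_P[of w "(P ^^ t) g", OF assms] by simp
qed simp

end

section \<open>Contraction with Perron weights\<close>

text \<open>In the application \<open>a\<close> is the block Perron vector read off at each site and
  \<open>\<theta>\<close> is \<beta> times the Perron root of \<open>Bmat\<close>;
  \<open>\<rho>\<close> is then the Perron root of \<open>Qmat\<close>.\<close>

locale ising_contraction = ising +
  fixes a :: "nat \<Rightarrow> real" and \<theta> :: real
  assumes a_pos: "\<And>v. v \<in> {1..n} \<Longrightarrow> a v > 0"
    and a_le_1: "\<And>v. v \<in> {1..n} \<Longrightarrow> a v \<le> 1"
    and a_eig: "\<And>v. v \<in> {1..n} \<Longrightarrow> (\<Sum>u\<in>{1..n}. J u v * a u) = \<theta> * a v"
    and \<theta>: "\<theta> \<ge> 0" "\<theta> < 1"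
begin

definition \<rho> :: real where "\<rho> = 1 - (1 - \<theta>) / n"

lemma \<rho>_nonneg: "\<rho> \<ge> 0" and \<rho>_less_1: "\<rho> < 1"
proof -
  have "(1 - \<theta>) / n \<le> 1 / 1" using n_pos \<theta> by (intro frac_le) auto
  then show "\<rho> \<ge> 0" by (simp add: \<rho>_def)
  show "\<rho> < 1" using n_pos \<theta> by (simp add: \<rho>_def)
qed

text \<open>\<open>J\<close> is symmetric, so \<open>a\<close> is also a left eigenvector, and
  pairing the transformed bounds with \<open>a\<close> multiplies the sum by exactly
  \<open>\<rho>\<close>.\<close>

lemma lipschitz_sum_P:
  assumes L: "\<And>\<tau> u. \<tau> \<in> \<Omega> \<Longrightarrow> u \<in> V \<Longrightarrow> \<bar>D u g \<tau>\<bar> \<le> L u"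
  obtains L' where "\<And>\<tau> u. \<tau> \<in> \<Omega> \<Longrightarrow> u \<in> V \<Longrightarrow> \<bar>D u (P g) \<tau>\<bar> \<le> L' u"
    "(\<Sum>v\<in>V. a v * L' v) = \<rho> * (\<Sum>v\<in>V. a v * L v)"
proof
  define L' where "L' v = (1 - 1 / n) * L v + (\<Sum>u\<in>V. J u v * L u) / n" for v
  show "\<bar>D u (P g) \<tau>\<bar> \<le> L' u" if "\<tau> \<in> \<Omega>" "u \<in> V" for \<tau> u
    unfolding L'_def using L that by (intro lipschitz_P) auto
  have "(\<Sum>v\<in>V. \<Sum>u\<in>V. a v * (J u v * L u)) = (\<Sum>u\<in>V. \<Sum>v\<in>V. a v * (J u v * L u))"
    by (rule sum.swap)
  also have "\<dots> = (\<Sum>u\<in>V. (\<Sum>v\<in>V. J v u * a v) * L u)"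
    unfolding sum_distrib_right using J_sym by (intro sum.cong refl) (simp add: ac_simps)
  also have "\<dots> = \<theta> * (\<Sum>u\<in>V. a u * L u)"
    unfolding sum_distrib_left by (intro sum.cong refl) (simp only: a_eig mult.assoc)
  finally have *: "(\<Sum>v\<in>V. a v * (\<Sum>u\<in>V. J u v * L u)) = \<theta> * (\<Sum>u\<in>V. a u * L u)"
    by (simp add: sum_distrib_left)
  have "(\<Sum>v\<in>V. a v * L' v) = (1 - 1 / n) * (\<Sum>v\<in>V. a v * L v) + (\<Sum>v\<in>V. a v * (\<Sum>u\<in>V. J u v * L u)) / n"
    by (simp add: L'_def distrib_left sum.distrib sum_distrib_left sum_divide_distrib ac_simps)
  then show "(\<Sum>v\<in>V. a v * L' v) = \<rho> * (\<Sum>v\<in>V. a v * L v)"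
    unfolding * by (simp add: \<rho>_def algebra_simps diff_divide_distrib)
qed

lemma lipschitz_sum_Pt:
  assumes L: "\<And>\<tau> u. \<tau> \<in> \<Omega> \<Longrightarrow> u \<in> V \<Longrightarrow> \<bar>D u g \<tau>\<bar> \<le> L u"
  shows "\<exists>L'. (\<forall>\<tau>\<in>\<Omega>. \<forall>u\<in>V. \<bar>D u ((P ^^ t) g) \<tau>\<bar> \<le> L' u) \<and>
    (\<Sum>v\<in>V. a v * L' v) = \<rho> ^ t * (\<Sum>v\<in>V. a v * L v)"
proof (induction t)
  case 0
  then show ?case using L by (intro exI[of _ L]) simp
next
  case (Suc t)
  then obtain L' where L': "\<And>\<tau> u. \<tau> \<in> \<Omega> \<Longrightarrow> u \<in> V \<Longrightarrow> \<bar>D u ((P ^^ t) g) \<tau>\<bar> \<le> L' u"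
    "(\<Sum>v\<in>V. a v * L' v) = \<rho> ^ t * (\<Sum>v\<in>V. a v * L v)" by blast
  obtain L'' where "\<And>\<tau> u. \<tau> \<in> \<Omega> \<Longrightarrow> u \<in> V \<Longrightarrow> \<bar>D u (P ((P ^^ t) g)) \<tau>\<bar> \<le> L'' u"
    "(\<Sum>v\<in>V. a v * L'' v) = \<rho> * (\<Sum>v\<in>V. a v * L' v)"
    using lipschitz_sum_P[of "(P ^^ t) g" L', OF L'(1)] by blast
  then show ?case using L'(2) by (intro exI[of _ L'']) simp
qed

text \<open>Dual form of the contraction: bounds proportional to \<open>a\<close> stay so. It serves
  the variance of \<open>M\<close>, whose gradient has this shape.\<close>

lemma lipschitz_pointwise_P:
  assumes L: "\<And>\<tau> u. \<tau> \<in> \<Omega> \<Longrightarrow> u \<in> V \<Longrightarrow> \<bar>D u g \<tau>\<bar> \<le> L * a u"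
    and "\<sigma> \<in> \<Omega>" "v \<in> V"
  shows "\<bar>D v (P g) \<sigma>\<bar> \<le> \<rho> * L * a v"
proof -
  have "(\<Sum>u\<in>V. J u v * (L * a u)) = L * (\<Sum>u\<in>V. J u v * a u)"
    by (simp add: sum_distrib_left ac_simps)
  then show ?thesis using lipschitz_P[of g "\<lambda>u. L * a u" \<sigma> v, OF L] assms(2,3) a_eig[of v]
    by (simp add: \<rho>_def algebra_simps diff_divide_distrib)
qed

text \<open>Each step contributes a variance of at most the squared current Lipschitz constant, and
  these constants shrink by \<open>\<rho>\<close>. The geometric series is at most
  \<open>L\<^sup>2 / (1 - \<rho>)\<close>, because
  \<open>\<rho>\<^sup>2 \<le> \<rho>\<close>.\<close>

lemma Pt_variance_le:
  assumes "\<And>\<tau> u. \<tau> \<in> \<Omega> \<Longrightarrow> u \<in> V \<Longrightarrow> \<bar>D u g \<tau>\<bar> \<le> L * a u" and "\<sigma> \<in> \<Omega>"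
  shows "(P ^^ t) (\<lambda>\<tau>. (g \<tau>)\<^sup>2) \<sigma> - ((P ^^ t) g \<sigma>)\<^sup>2 \<le> L\<^sup>2 * n / (1 - \<theta>)"
  using assms(1)
proof (induction t arbitrary: g L)
  case 0
  then show ?case using \<theta> by simp
next
  case (Suc t)
  have "P (\<lambda>\<tau>. (g \<tau>)\<^sup>2) \<tau> \<le> (P g \<tau>)\<^sup>2 + L\<^sup>2" if \<tau>: "\<tau> \<in> \<Omega>" for \<tau>
  proof -
    have "G g \<tau> \<le> (\<Sum>v\<in>V. L\<^sup>2)" unfolding G_def
    proof (intro sum_mono)
      fix v assume v: "v \<in> V"
      have "\<bar>D v g \<tau>\<bar> \<le> \<bar>L\<bar> * a v"
        using Suc.prems[OF \<tau> v] a_pos[OF v] by (meson abs_ge_self less_imp_le mult_right_mono order_trans)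
      also have "\<dots> \<le> \<bar>L\<bar> * 1" using a_le_1[OF v] by (intro mult_left_mono) auto
      finally show "(D v g \<tau>)\<^sup>2 \<le> L\<^sup>2" by (simp add: abs_le_square_iff)
    qed
    then have "G g \<tau> / n \<le> L\<^sup>2" using n_pos by (simp add: field_simps)
    then show ?thesis using variance_le[OF \<tau>, of g] by linarith
  qed
  then have "(P ^^ t) (P (\<lambda>\<tau>. (g \<tau>)\<^sup>2)) \<sigma> \<le> (P ^^ t) (\<lambda>\<tau>. (P g \<tau>)\<^sup>2 + L\<^sup>2) \<sigma>"
    using assms(2) by (intro Pt_mono) auto
  also have "\<dots> = (P ^^ t) (\<lambda>\<tau>. (P g \<tau>)\<^sup>2) \<sigma> + L\<^sup>2" by (simp add: Pt_add Pt_const)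
  also have "(P ^^ t) (\<lambda>\<tau>. (P g \<tau>)\<^sup>2) \<sigma> \<le> ((P ^^ t) (P g) \<sigma>)\<^sup>2 + (\<rho> * L)\<^sup>2 * n / (1 - \<theta>)"
    using Suc.IH[of "P g" "\<rho> * L"] lipschitz_pointwise_P[OF Suc.prems] by simp
  finally have "(P ^^ t) (P (\<lambda>\<tau>. (g \<tau>)\<^sup>2)) \<sigma> - ((P ^^ t) (P g) \<sigma>)\<^sup>2
     \<le> (\<rho> * L)\<^sup>2 * n / (1 - \<theta>) + L\<^sup>2" by simp
  also have "\<dots> \<le> L\<^sup>2 * n / (1 - \<theta>)"
  proof -
    have "\<rho>\<^sup>2 \<le> \<rho>" using \<rho>_nonneg \<rho>_less_1 by (simp add: power2_eq_square mult_left_le)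
    then have "\<rho>\<^sup>2 * (L\<^sup>2 * n / (1 - \<theta>)) \<le> \<rho> * (L\<^sup>2 * n / (1 - \<theta>))"
      using \<theta> by (intro mult_right_mono) auto
    also have "\<dots> = L\<^sup>2 * n / (1 - \<theta>) - L\<^sup>2" using n_pos \<theta> by (simp add: \<rho>_def field_simps)
    finally show ?thesis by (simp add: power_mult_distrib)
  qed
  finally show ?case by (simp add: Pt_Suc del: funpow.simps)
qed

text \<open>Time is split: n steps of smoothing produce the bound of order \<open>sqrt n\<close>,
  the other \<open>s\<close> steps contract it. The map \<open>cls\<close> will send a site to its
  block and its initial spin.\<close>

lemma upper_bound:
  fixes cls :: "nat \<Rightarrow> 'c"
  assumes \<sigma>0: "\<sigma>0 \<in> \<Omega>" and f: "\<And>\<tau>. \<tau> \<in> \<Omega> \<Longrightarrow> \<bar>f \<tau>\<bar> \<le> 1"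
    and J_cls: "\<And>v w v' w'. v \<in> V \<Longrightarrow> w \<in> V \<Longrightarrow> v' \<in> V \<Longrightarrow> w' \<in> V \<Longrightarrow>
      cls v = cls v' \<Longrightarrow> cls w = cls w' \<Longrightarrow> J v w = J v' w'"
    and \<sigma>0_cls: "\<And>v v'. v \<in> V \<Longrightarrow> v' \<in> V \<Longrightarrow> cls v = cls v' \<Longrightarrow> \<sigma>0 v = \<sigma>0 v'"
    and w_aut: "\<And>\<pi> \<tau>. aut \<pi> \<Longrightarrow> \<tau> \<in> \<Omega> \<Longrightarrow> w (\<tau> \<circ> \<pi>) = w \<tau>"
    and w0: "\<And>\<tau>. \<tau> \<in> \<Omega> \<Longrightarrow> w \<tau> \<ge> 0" and w1: "(\<Sum>\<tau>\<in>\<Omega>. w \<tau>) = 1"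
    and db: "\<And>\<sigma> v. \<sigma> \<in> \<Omega> \<Longrightarrow> v \<in> V \<Longrightarrow>
      w (flip v \<sigma>) * flip_prob v (flip v \<sigma>) = w \<sigma> * flip_prob v \<sigma>"
    and amin: "amin > 0" "\<And>v. v \<in> V \<Longrightarrow> a v \<ge> amin"
  shows "\<bar>(P ^^ (s + n)) f \<sigma>0 - (\<Sum>\<tau>\<in>\<Omega>. w \<tau> * f \<tau>)\<bar>
    \<le> \<rho> ^ s * (card (cls ` V) * sqrt (2 * grad_bound * n)) / amin"
proof -
  define \<Gamma> where "\<Gamma> = {\<pi>. \<pi> permutes V \<and> (\<forall>v\<in>V. cls (\<pi> v) = cls v)}"
  have fin: "finite \<Gamma>" unfolding \<Gamma>_def
    by (rule finite_subset[OF _ finite_permutations[of V]]) auto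
  have id: "id \<in> \<Gamma>" by (simp add: \<Gamma>_def permutes_id)
  have N: "real (card \<Gamma>) > 0" using fin id by (auto simp: card_gt_0_iff)
  have aut: "aut \<pi>" if "\<pi> \<in> \<Gamma>" for \<pi>
  proof -
    have p: "\<pi> permutes V" and c: "\<And>v. v \<in> V \<Longrightarrow> cls (\<pi> v) = cls v"
      using that by (auto simp: \<Gamma>_def)
    have "J (\<pi> v) (\<pi> w) = J v w" if "v \<in> V" "w \<in> V" for v w
      using that c permutes_in_image[OF p] by (intro J_cls) auto
    then show ?thesis using p by (simp add: aut_def)
  qed
  have fix0: "\<sigma>0 \<circ> \<pi> = \<sigma>0" if "\<pi> \<in> \<Gamma>" for \<pi>
  proof
    fix v
    have p: "\<pi> permutes V" and c: "\<And>v. v \<in> V \<Longrightarrow> cls (\<pi> v) = cls v"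
      using that by (auto simp: \<Gamma>_def)
    show "(\<sigma>0 \<circ> \<pi>) v = \<sigma>0 v"
    proof (cases "v \<in> V")
      case True
      then show ?thesis using \<sigma>0_cls[of "\<pi> v" v] c permutes_in_image[OF p, of v] by simp
    next
      case False
      then show ?thesis using permutes_not_in[OF p False] by simp
    qed
  qed
  define h where "h \<tau> = (\<Sum>\<pi>\<in>\<Gamma>. (1 / card \<Gamma>) * f (\<tau> \<circ> \<pi>))" for \<tau>
  have h1: "\<bar>h \<tau>\<bar> \<le> 1" if "\<tau> \<in> \<Omega>" for \<tau>
  proof -
    have "\<bar>h \<tau>\<bar> \<le> (\<Sum>\<pi>\<in>\<Gamma>. (1 / card \<Gamma>) * 1)" unfolding h_def
    proof (intro order_trans[OF sum_abs] sum_mono)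
      fix \<pi> assume "\<pi> \<in> \<Gamma>"
      then have "\<tau> \<circ> \<pi> \<in> \<Omega>" using that by (auto simp: \<Gamma>_def intro: perm_config)
      then show "\<bar>(1 / card \<Gamma>) * f (\<tau> \<circ> \<pi>)\<bar> \<le> (1 / card \<Gamma>) * 1"
        unfolding abs_mult using f[of "\<tau> \<circ> \<pi>"] by (intro mult_mono) auto
    qed
    then show ?thesis using N by simp
  qed
  have h_sym: "h (\<tau> \<circ> \<pi>) = h \<tau>" if \<pi>: "\<pi> \<in> \<Gamma>" for \<tau> \<pi>
  proof -
    have p: "\<pi> permutes V" and c: "\<And>v. v \<in> V \<Longrightarrow> cls (\<pi> v) = cls v"
      using that by (auto simp: \<Gamma>_def)
    have p': "inv \<pi> permutes V" by (rule permutes_inv[OF p])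
    have c': "cls (inv \<pi> v) = cls v" if "v \<in> V" for v
      using c[of "inv \<pi> v"] permutes_in_image[OF p', of v] permutes_inverses[OF p] that by simp
    show ?thesis unfolding h_def
    \<comment> \<open>Left translation by \<open>\<pi>\<close> is a bijection of the group
      \<open>\<Gamma>\<close>.\<close>
    proof (rule sum.reindex_bij_witness[of _ "\<lambda>\<kappa>. inv \<pi> \<circ> \<kappa>" "\<lambda>\<kappa>. \<pi> \<circ> \<kappa>"])
      fix \<kappa> assume k: "\<kappa> \<in> \<Gamma>"
      then have kp: "\<kappa> permutes V" and kc: "\<And>v. v \<in> V \<Longrightarrow> cls (\<kappa> v) = cls v" by (auto simp: \<Gamma>_def)
      show "\<pi> \<circ> \<kappa> \<in> \<Gamma>" "inv \<pi> \<circ> \<kappa> \<in> \<Gamma>"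
        using kp kc p p' c c' permutes_in_image[OF kp] by (auto simp: \<Gamma>_def permutes_compose)
      show "inv \<pi> \<circ> (\<pi> \<circ> \<kappa>) = \<kappa>" "\<pi> \<circ> (inv \<pi> \<circ> \<kappa>) = \<kappa>"
        by (simp_all add: comp_assoc[symmetric] permutes_inv_o[OF p])
      show "1 / card \<Gamma> * f (\<tau> \<circ> (\<pi> \<circ> \<kappa>)) = 1 / card \<Gamma> * f (\<tau> \<circ> \<pi> \<circ> \<kappa>)"
        by (simp add: comp_assoc)
    qed
  qed
  define g where "g = (P ^^ n) h"
  have g_sym: "g (\<tau> \<circ> \<pi>) = g \<tau>" if "\<pi> \<in> \<Gamma>" for \<tau> \<pi>
    using Pt_aut[OF aut[OF that], of n h] h_sym[OF that] by (simp add: g_def fun_eq_iff)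
  have g_G: "G g \<tau> \<le> grad_bound" if "\<tau> \<in> \<Omega>" for \<tau>
    unfolding g_def using that h1 by (intro G_Pn_le) auto
  define W where "W v = {u \<in> V. cls u = cls v}" for v
  have Wpos: "card (W v) > 0" if "v \<in> V" for v
    using that by (auto simp: W_def card_gt_0_iff)
  \<comment> \<open>One bound per site, valid at every configuration, as
    \<open>lipschitz_sum_Pt\<close> requires.\<close>
  define L where "L v = sqrt (2 * grad_bound / card (W v))" for v
  have L: "\<bar>D v g \<tau>\<bar> \<le> L v" if \<tau>: "\<tau> \<in> \<Omega>" and v: "v \<in> V" for \<tau> v
  proof -
    have tr: "g (\<tau>' \<circ> Transposition.transpose v u) = g \<tau>'" if "u \<in> W v" for u \<tau>'
    proof (rule g_sym)
      show "Transposition.transpose v u \<in> \<Gamma>"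
        using that v by (auto simp: \<Gamma>_def W_def permutes_swap_id Transposition.transpose_def)
    qed
    have "card (W v) * (D v g \<tau>)\<^sup>2 \<le> 2 * grad_bound"
      using g_G \<tau> v tr by (intro symmetric_gradient) (auto simp: W_def)
    then have "(D v g \<tau>)\<^sup>2 \<le> 2 * grad_bound / card (W v)"
      using Wpos[OF v] by (simp add: field_simps)
    then show ?thesis unfolding L_def by (metis real_sqrt_abs real_sqrt_le_iff)
  qed
  have L0: "L v \<ge> 0" for v using grad_bound_pos by (simp add: L_def)
  have "(\<Sum>v\<in>V. a v * L v) \<le> (\<Sum>v\<in>V. 1 * L v)"
    using a_le_1 L0 by (intro sum_mono mult_right_mono) auto
  also have "\<dots> = (\<Sum>c\<in>cls ` V. \<Sum>v\<in>{v \<in> V. cls v = c}. L v)"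
    by (simp only: mult_1_left) (rule sum.image_gen, simp)
  also have "\<dots> \<le> (\<Sum>c\<in>cls ` V. sqrt (2 * grad_bound * n))"
  proof (intro sum_mono)
    fix c assume "c \<in> cls ` V"
    then obtain v0 where v0: "v0 \<in> V" "c = cls v0" by auto
    let ?N = "card (W v0)"
    have "(\<Sum>v\<in>{v \<in> V. cls v = c}. L v) = (\<Sum>v\<in>W v0. sqrt (2 * grad_bound / ?N))"
      using v0 by (intro sum.cong) (auto simp: W_def L_def)
    also have "\<dots> = ?N * sqrt (2 * grad_bound / ?N)" by simp
    also have "\<dots> = sqrt (2 * grad_bound * ?N)"
    proof -
      have "?N * sqrt (2 * grad_bound / ?N) = sqrt ((real ?N)\<^sup>2 * (2 * grad_bound / ?N))"
        by (simp only: real_sqrt_mult real_sqrt_abs abs_of_nat)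
      then show ?thesis using Wpos[OF v0(1)] by (simp add: power2_eq_square)
    qed
    also have "\<dots> \<le> sqrt (2 * grad_bound * n)"
    proof -
      have "?N \<le> card V" unfolding W_def by (intro card_mono) auto
      then show ?thesis using grad_bound_pos by (simp add: mult_left_mono)
    qed
    finally show "(\<Sum>v\<in>{v \<in> V. cls v = c}. L v) \<le> sqrt (2 * grad_bound * n)" .
  qed
  finally have Lsum: "(\<Sum>v\<in>V. a v * L v) \<le> card (cls ` V) * sqrt (2 * grad_bound * n)" by simp
  obtain L' where L': "\<And>\<tau> u. \<tau> \<in> \<Omega> \<Longrightarrow> u \<in> V \<Longrightarrow> \<bar>D u ((P ^^ s) g) \<tau>\<bar> \<le> L' u"
    "(\<Sum>v\<in>V. a v * L' v) = \<rho> ^ s * (\<Sum>v\<in>V. a v * L v)"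
    using lipschitz_sum_Pt[of g L s, OF L] by blast
  have L'0: "L' v \<ge> 0" if "v \<in> V" for v using L'(1)[OF \<sigma>0 that] by linarith
  have "amin * (\<Sum>v\<in>V. L' v) \<le> (\<Sum>v\<in>V. a v * L' v)"
    unfolding sum_distrib_left using amin(2) L'0 by (intro sum_mono mult_right_mono) auto
  also have "\<dots> \<le> \<rho> ^ s * (card (cls ` V) * sqrt (2 * grad_bound * n))"
    unfolding L'(2) using Lsum \<rho>_nonneg by (intro mult_left_mono) auto
  finally have B: "(\<Sum>v\<in>V. L' v) \<le> \<rho> ^ s * (card (cls ` V) * sqrt (2 * grad_bound * n)) / amin"
    using amin(1) by (simp add: field_simps)
  define F where "F = (P ^^ (s + n)) h"
  have F: "F = (P ^^ s) g" by (simp add: F_def g_def funpow_add)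
  \<comment> \<open>Averaging changes nothing at the starting point: each \<open>\<pi>\<close>
    commutes with \<open>P\<close> and fixes \<open>\<sigma>0\<close>.\<close>
  have F0: "F \<sigma>0 = (P ^^ (s + n)) f \<sigma>0"
  proof -
    have "F \<sigma>0 = (\<Sum>\<pi>\<in>\<Gamma>. (1 / card \<Gamma>) * (P ^^ (s + n)) (\<lambda>\<tau>. f (\<tau> \<circ> \<pi>)) \<sigma>0)"
      unfolding F_def h_def[abs_def] Pt_sum Pt_cmult ..
    also have "\<dots> = (\<Sum>\<pi>\<in>\<Gamma>. (1 / card \<Gamma>) * (P ^^ (s + n)) f \<sigma>0)"
      using Pt_aut[OF aut] fix0 by (intro sum.cong refl) simp
    finally show ?thesis using N by simp
  qed
  have Fw: "(\<Sum>\<tau>\<in>\<Omega>. w \<tau> * F \<tau>) = (\<Sum>\<tau>\<in>\<Omega>. w \<tau> * f \<tau>)"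
  proof -
    have "(\<Sum>\<tau>\<in>\<Omega>. w \<tau> * F \<tau>) = (\<Sum>\<tau>\<in>\<Omega>. w \<tau> * h \<tau>)"
      unfolding F_def using db by (intro stationary_Pt) auto
    also have "\<dots> = (\<Sum>\<tau>\<in>\<Omega>. \<Sum>\<pi>\<in>\<Gamma>. (1 / card \<Gamma>) * (w \<tau> * f (\<tau> \<circ> \<pi>)))"
      by (simp add: h_def sum_distrib_left ac_simps)
    also have "\<dots> = (\<Sum>\<pi>\<in>\<Gamma>. \<Sum>\<tau>\<in>\<Omega>. (1 / card \<Gamma>) * (w \<tau> * f (\<tau> \<circ> \<pi>)))" by (rule sum.swap)
    also have "\<dots> = (\<Sum>\<pi>\<in>\<Gamma>. (1 / card \<Gamma>) * (\<Sum>\<tau>\<in>\<Omega>. w \<tau> * f \<tau>))"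
    proof (intro sum.cong refl)
      fix \<pi> assume \<pi>: "\<pi> \<in> \<Gamma>"
      have "(\<Sum>\<tau>\<in>\<Omega>. w \<tau> * f (\<tau> \<circ> \<pi>)) = (\<Sum>\<tau>\<in>\<Omega>. w (\<tau> \<circ> \<pi>) * f (\<tau> \<circ> \<pi>))"
        using w_aut[OF aut[OF \<pi>]] by (intro sum.cong) auto
      also have "\<dots> = (\<Sum>\<tau>\<in>\<Omega>. w \<tau> * f \<tau>)"
        using \<pi> by (intro sum_configs_perm[of \<pi> "\<lambda>\<tau>. w \<tau> * f \<tau>"]) (auto simp: \<Gamma>_def)
      finally show "(\<Sum>\<tau>\<in>\<Omega>. (1 / card \<Gamma>) * (w \<tau> * f (\<tau> \<circ> \<pi>))) = (1 / card \<Gamma>) * (\<Sum>\<tau>\<in>\<Omega>. w \<tau> * f \<tau>)"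
        by (simp only: sum_distrib_left[symmetric])
    qed
    finally show ?thesis using N by simp
  qed
  have "\<bar>F \<sigma>0 - (\<Sum>\<tau>\<in>\<Omega>. w \<tau> * F \<tau>)\<bar> = \<bar>\<Sum>\<tau>\<in>\<Omega>. w \<tau> * (F \<sigma>0 - F \<tau>)\<bar>"
    using w1 by (simp add: right_diff_distrib sum_subtractf flip: sum_distrib_right)
  also have "\<dots> \<le> (\<Sum>\<tau>\<in>\<Omega>. w \<tau> * (\<Sum>v\<in>V. L' v))"
  proof (intro order_trans[OF sum_abs] sum_mono)
    fix \<tau> assume \<tau>: "\<tau> \<in> \<Omega>"
    have "\<bar>F \<sigma>0 - F \<tau>\<bar> \<le> (\<Sum>v\<in>V. L' v)"
      unfolding F using L'(1) \<sigma>0 \<tau> by (intro abs_diff_le_sum_lipschitz) auto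
    then show "\<bar>w \<tau> * (F \<sigma>0 - F \<tau>)\<bar> \<le> w \<tau> * (\<Sum>v\<in>V. L' v)"
      using w0[OF \<tau>] by (simp add: abs_mult mult_left_mono)
  qed
  also have "\<dots> = (\<Sum>v\<in>V. L' v)" using w1 by (simp flip: sum_distrib_right)
  finally show ?thesis using B F0 Fw by simp
qed

end

section \<open>Drift and fluctuation of the magnetisations\<close>

text \<open>The Perron pair enters through its defining equations, so the choice operators in
  \<open>perron_root\<close> and \<open>left_perron_vec\<close> are confined to
  \<open>perron_facts\<close>. The error constants defined below are free of \<open>n\<close>, which
  makes the final bounds uniform.\<close>

locale block_ising =
  fixes m :: nat and p :: "nat \<Rightarrow> real" and k :: "nat \<Rightarrow> nat \<Rightarrow> real" and \<beta> :: real
    and n :: nat and b :: "nat \<Rightarrow> nat" and a :: "nat \<Rightarrow> real" and l \<kappa> :: real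
  assumes n_pos: "n > 0"
    and p_pos: "\<And>i. i < m \<Longrightarrow> p i > 0" and p_sum: "(\<Sum>i<m. p i) = 1"
    and k_sym: "\<And>i j. i < m \<Longrightarrow> j < m \<Longrightarrow> k i j = k j i"
    and k_nonneg: "\<And>i j. i < m \<Longrightarrow> j < m \<Longrightarrow> k i j \<ge> 0"
    and \<beta>_nonneg: "\<beta> \<ge> 0"
    and k_le: "\<And>i j. i < m \<Longrightarrow> j < m \<Longrightarrow> \<beta> * k i j \<le> \<kappa>"
    and b_less: "\<And>v. v \<in> {1..n} \<Longrightarrow> b v < m"
    and b_card: "\<And>i. i < m \<Longrightarrow> real (card {v \<in> {1..n}. b v = i}) = real n * p i"
    and ba_pos: "\<And>i. i < m \<Longrightarrow> a i > 0" and a_sum: "(\<Sum>i<m. a i) = 1"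
    and ba_eig: "\<And>j. j < m \<Longrightarrow> (\<Sum>i<m. a i * p i * k i j) = l * a j"
    and l_pos: "l > 0" and \<beta>l: "\<beta> * l < 1"
begin

definition J :: "nat \<Rightarrow> nat \<Rightarrow> real" where
  "J v w = \<beta> * Kint k b n v w"

lemma sum_blocks: "(\<Sum>v\<in>{1..n}. f v) = (\<Sum>i<m. \<Sum>v\<in>{v \<in> {1..n}. b v = i}. f v)"
  by (rule sum.group[symmetric]) (use b_less in auto)

lemma sum_blocks_const: "(\<Sum>v\<in>{1..n}. f (b v)) = n * (\<Sum>i<m. p i * f i)"
proof -
  have "(\<Sum>v\<in>{1..n}. f (b v)) = (\<Sum>i<m. \<Sum>v\<in>{v \<in> {1..n}. b v = i}. f i)"
    unfolding sum_blocks by (intro sum.cong) auto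
  also have "\<dots> = (\<Sum>i<m. n * p i * f i)"
    by (intro sum.cong refl) (simp only: sum_constant b_card lessThan_iff)
  finally show ?thesis by (simp add: sum_distrib_left mult.assoc)
qed

lemma ba_le_1: "i < m \<Longrightarrow> a i \<le> 1"
  using member_le_sum[of i "{..<m}" a] ba_pos a_sum by (auto simp: less_imp_le)

sublocale ising_contraction n J \<kappa> "\<lambda>v. a (b v)" "\<beta> * l"
proof unfold_locales
  show "n > 0" by (rule n_pos)
  show "a (b v) > 0" "a (b v) \<le> 1" if "v \<in> {1..n}" for v
    using b_less[OF that] ba_pos ba_le_1 by auto
  show "J v w = J w v" "J v w \<ge> 0" "J v w \<le> \<kappa> / n" if "v \<in> {1..n}" "w \<in> {1..n}" for v w
    using b_less[OF that(1)] b_less[OF that(2)] k_sym k_nonneg \<beta>_nonneg k_le n_pos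
    by (auto simp: J_def Kint_def divide_right_mono)
  show "(\<Sum>u\<in>{1..n}. J u v * a (b u)) = \<beta> * l * a (b v)" if "v \<in> {1..n}" for v
  proof -
    have "(\<Sum>u\<in>{1..n}. J u v * a (b u)) = n * (\<Sum>i<m. p i * (\<beta> * (k i (b v) / n) * a i))"
      by (simp only: sum_blocks_const[symmetric] J_def Kint_def)
    also have "\<dots> = \<beta> * (\<Sum>i<m. a i * p i * k i (b v))"
      using n_pos by (simp add: sum_distrib_left field_simps)
    finally show ?thesis using ba_eig b_less[OF that] by simp
  qed
  show "\<beta> * l \<ge> 0" "\<beta> * l < 1" using \<beta>_nonneg l_pos \<beta>l by auto
qed

abbreviation "B i \<equiv> {v \<in> V. b v = i}"

definition c :: real where "c = 1 - \<beta> * l"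

lemma c_pos: "c > 0"
  using \<beta>l by (simp add: c_def)

lemma \<rho>_eq: "\<rho> = 1 - c / n" by (simp add: \<rho>_def c_def)

text \<open>Dividing by \<open>n\<close> instead of the block size makes \<open>Qmat\<close> the
  linearised one-step map of the vector of all \<open>mag i\<close>; \<open>M\<close> pairs this
  vector with the left Perron vector.\<close>

definition mag :: "nat \<Rightarrow> (nat \<Rightarrow> real) \<Rightarrow> real" where
  "mag i \<sigma> = (\<Sum>v\<in>B i. \<sigma> v) / n"

text \<open>The weights 1 / \<open>p i\<close> cancel the factor \<open>p i\<close> in the drift, so
  the interaction enters through the symmetric form of \<open>k\<close> and \<open>Q\<close> decays
  at the full Perron rate.\<close>

definition Q :: "(nat \<Rightarrow> real) \<Rightarrow> real" where
  "Q \<sigma> = (\<Sum>i<m. (mag i \<sigma>)\<^sup>2 / p i)"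

definition M :: "(nat \<Rightarrow> real) \<Rightarrow> real" where
  "M \<sigma> = (\<Sum>i<m. a i * mag i \<sigma>)"

lemma Q_nonneg: "Q \<sigma> \<ge> 0"
  unfolding Q_def using p_pos by (intro sum_nonneg) (auto simp: less_imp_le)

lemma mag_le:
  assumes "\<sigma> \<in> \<Omega>" "i < m" shows "\<bar>mag i \<sigma>\<bar> \<le> p i"
proof -
  have "\<bar>\<Sum>v\<in>B i. \<sigma> v\<bar> \<le> (\<Sum>v\<in>B i. 1)"
    using assms by (intro order_trans[OF sum_abs] sum_mono) auto
  also have "\<dots> = n * p i" using b_card[OF assms(2)] by simp
  finally show ?thesis using n_pos by (simp add: mag_def field_simps)
qed

lemma sum_abs_mag_le: "\<sigma> \<in> \<Omega> \<Longrightarrow> (\<Sum>i<m. \<bar>mag i \<sigma>\<bar>) \<le> 1"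
  using sum_mono[of "{..<m}" "\<lambda>i. \<bar>mag i \<sigma>\<bar>" p] mag_le p_sum by simp

lemma sum_abs_mag_square_le: "(\<Sum>i<m. \<bar>mag i \<sigma>\<bar>)\<^sup>2 \<le> Q \<sigma>"
proof -
  have "(\<Sum>i<m. \<bar>mag i \<sigma>\<bar>) = (\<Sum>i<m. (\<bar>mag i \<sigma>\<bar> / sqrt (p i)) * sqrt (p i))"
    using p_pos by (intro sum.cong) (auto simp: less_imp_neq[symmetric])
  also have "\<dots>\<^sup>2 \<le> (\<Sum>i<m. (\<bar>mag i \<sigma>\<bar> / sqrt (p i))\<^sup>2) * (\<Sum>i<m. (sqrt (p i))\<^sup>2)"
    by (rule Cauchy_Schwarz_ineq_sum)
  also have "\<dots> = Q \<sigma> * (\<Sum>i<m. p i)" unfolding Q_def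
    using p_pos by (intro arg_cong2[of _ _ _ _ "(*)"] sum.cong) (auto simp: power_divide less_imp_le)
  finally show ?thesis using p_sum by simp
qed

lemma M_square_le: "(M \<sigma>)\<^sup>2 \<le> Q \<sigma>"
proof -
  have "\<bar>M \<sigma>\<bar> \<le> (\<Sum>i<m. 1 * \<bar>mag i \<sigma>\<bar>)"
    unfolding M_def using ba_pos ba_le_1
    by (intro order_trans[OF sum_abs] sum_mono)
      (auto simp: abs_mult less_imp_le intro!: mult_left_le_one_le)
  then have "(M \<sigma>)\<^sup>2 \<le> (\<Sum>i<m. \<bar>mag i \<sigma>\<bar>)\<^sup>2"
    by (intro square_le_if_abs_le) simp
  then show ?thesis using sum_abs_mag_square_le[of \<sigma>] by linarith
qed

text \<open>Block sums include the site itself. Removing it costs at most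
  \<open>\<kappa> / n\<close>, a source of the n^(-2) errors in the drift estimates.\<close>

lemma fld_eq:
  assumes v: "v \<in> V"
  shows "fld \<sigma> v = \<beta> * (\<Sum>j<m. k (b v) j * mag j \<sigma>) - J v v * \<sigma> v"
proof -
  have "(\<Sum>w\<in>V. J v w * \<sigma> w) = (\<Sum>j<m. \<Sum>w\<in>B j. \<beta> * k (b v) j * \<sigma> w / n)"
    unfolding sum_blocks by (intro sum.cong) (auto simp: J_def Kint_def)
  also have "\<dots> = \<beta> * (\<Sum>j<m. k (b v) j * mag j \<sigma>)"
    by (simp add: mag_def sum_distrib_left sum_divide_distrib mult.assoc)
  finally show ?thesis unfolding fld_def using v by (simp add: sum_diff1)
qed

lemma abs_fld_le:
  assumes \<sigma>: "\<sigma> \<in> \<Omega>" and v: "v \<in> V"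
  shows "\<bar>fld \<sigma> v\<bar> \<le> \<beta> * (\<Sum>j<m. k (b v) j * \<bar>mag j \<sigma>\<bar>) + \<kappa> / n"
proof -
  have "\<bar>\<beta> * (\<Sum>j<m. k (b v) j * mag j \<sigma>)\<bar> = \<beta> * \<bar>\<Sum>j<m. k (b v) j * mag j \<sigma>\<bar>"
    using \<beta>_nonneg by (simp add: abs_mult)
  also have "\<dots> \<le> \<beta> * (\<Sum>j<m. \<bar>k (b v) j * mag j \<sigma>\<bar>)"
    using \<beta>_nonneg by (intro mult_left_mono sum_abs)
  also have "(\<Sum>j<m. \<bar>k (b v) j * mag j \<sigma>\<bar>) = (\<Sum>j<m. k (b v) j * \<bar>mag j \<sigma>\<bar>)"
    using k_nonneg b_less[OF v] by (intro sum.cong) (auto simp: abs_mult)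
  finally have "\<bar>\<beta> * (\<Sum>j<m. k (b v) j * mag j \<sigma>)\<bar> \<le> \<beta> * (\<Sum>j<m. k (b v) j * \<bar>mag j \<sigma>\<bar>)" .
  moreover have "\<bar>J v v * \<sigma> v\<bar> \<le> \<kappa> / n"
    using J_le[OF v v] J_nonneg[OF v v] \<sigma> v by (simp add: abs_mult)
  ultimately show ?thesis unfolding fld_eq[OF v] by linarith
qed

lemma fld_square_le:
  assumes \<sigma>: "\<sigma> \<in> \<Omega>" and v: "v \<in> V"
  shows "(fld \<sigma> v)\<^sup>2 \<le> 2 * \<kappa>\<^sup>2 * Q \<sigma> + 2 * \<kappa>\<^sup>2 / n"
proof -
  let ?s = "\<Sum>j<m. \<bar>mag j \<sigma>\<bar>"
  have "\<beta> * (\<Sum>j<m. k (b v) j * \<bar>mag j \<sigma>\<bar>) \<le> (\<Sum>j<m. \<kappa> * \<bar>mag j \<sigma>\<bar>)"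
    unfolding sum_distrib_left mult.assoc[symmetric] using k_le b_less[OF v]
    by (intro sum_mono mult_right_mono) auto
  then have "\<bar>fld \<sigma> v\<bar> \<le> \<kappa> * ?s + \<kappa> / n"
    using abs_fld_le[OF assms] by (simp add: sum_distrib_left)
  then have "(fld \<sigma> v)\<^sup>2 \<le> (\<kappa> * ?s + \<kappa> / n)\<^sup>2"
    by (rule square_le_if_abs_le)
  also have "\<dots> \<le> 2 * (\<kappa> * ?s)\<^sup>2 + 2 * (\<kappa> / n)\<^sup>2"
    using square_add_le[of 1] by simp
  also have "\<dots> = 2 * \<kappa>\<^sup>2 * ?s\<^sup>2 + 2 * \<kappa>\<^sup>2 * (1 / n)\<^sup>2"
    by (simp add: power_mult_distrib power_divide)
  also have "\<dots> \<le> 2 * \<kappa>\<^sup>2 * Q \<sigma> + 2 * \<kappa>\<^sup>2 * (1 / n)"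
  proof (intro add_mono mult_left_mono sum_abs_mag_square_le)
    show "(1 / real n)\<^sup>2 \<le> 1 / n" using n_pos by (simp add: power2_eq_square field_simps)
  qed auto
  finally show ?thesis by simp
qed

section \<open>One-step drift of the magnetisations\<close>

lemma D_mag:
  assumes "v \<in> V" shows "D v (mag i) \<sigma> = (if b v = i then - 2 * \<sigma> v / n else 0)"
proof -
  have "(\<Sum>u\<in>B i. flip v \<sigma> u) = (\<Sum>u\<in>B i. \<sigma> u - (if u = v then 2 * \<sigma> v else 0))"
    by (intro sum.cong) (auto simp: flip_def)
  also have "\<dots> = (\<Sum>u\<in>B i. \<sigma> u) - (if b v = i then 2 * \<sigma> v else 0)"
    using assms by (simp add: sum_subtractf)
  finally show ?thesis by (simp add: D_def mag_def flip: diff_divide_distrib)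
qed

lemma drift_mag:
  assumes \<sigma>: "\<sigma> \<in> \<Omega>"
  shows "(\<Sum>v\<in>V. flip_prob v \<sigma> * D v (mag i) \<sigma>) = ((\<Sum>v\<in>B i. th \<sigma> v) / n - mag i \<sigma>) / n"
proof -
  have *: "flip_prob v \<sigma> * (- 2 * \<sigma> v / n) = (th \<sigma> v - \<sigma> v) / (n * n)" if "v \<in> V" for v
    using config_cases[OF \<sigma> that] n_pos by (auto simp: flip_prob_def field_simps)
  have "(\<Sum>v\<in>V. flip_prob v \<sigma> * D v (mag i) \<sigma>) = (\<Sum>v\<in>V. if b v = i then (th \<sigma> v - \<sigma> v) / (n * n) else 0)"
  proof (intro sum.cong refl)
    fix v assume v: "v \<in> V"
    show "flip_prob v \<sigma> * D v (mag i) \<sigma> = (if b v = i then (th \<sigma> v - \<sigma> v) / (n * n) else 0)"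
      unfolding D_mag[OF v] using *[OF v] by simp
  qed
  also have "\<dots> = (\<Sum>v\<in>B i. (th \<sigma> v - \<sigma> v) / (n * n))"
    by (rule sum.inter_filter[symmetric]) simp
  also have "\<dots> = ((\<Sum>v\<in>B i. th \<sigma> v) / n - mag i \<sigma>) / n"
    unfolding sum_divide_distrib[symmetric] sum_subtractf mag_def by (simp add: diff_divide_distrib)
  finally show ?thesis .
qed

lemma P_mag:
  "\<sigma> \<in> \<Omega> \<Longrightarrow> P (mag i) \<sigma> = mag i \<sigma> + ((\<Sum>v\<in>B i. th \<sigma> v) / n - mag i \<sigma>) / n"
  unfolding P_eq drift_mag ..

text \<open>The last term is the second moment of the increment: \<open>n * p i\<close> sites, each
  flipped with probability at most 1/n, each moving \<open>mag i\<close> by 2/n.\<close>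

lemma P_mag_square:
  assumes \<sigma>: "\<sigma> \<in> \<Omega>" and i: "i < m"
  shows "P (\<lambda>\<tau>. (mag i \<tau>)\<^sup>2) \<sigma> \<le>
    (mag i \<sigma>)\<^sup>2 + 2 * mag i \<sigma> * (((\<Sum>v\<in>B i. th \<sigma> v) / n - mag i \<sigma>) / n) + 4 * p i / n\<^sup>2"
proof -
  have D2: "D v (\<lambda>\<tau>. (mag i \<tau>)\<^sup>2) \<sigma> = 2 * mag i \<sigma> * D v (mag i) \<sigma> + (D v (mag i) \<sigma>)\<^sup>2" for v
    by (simp add: D_def power2_eq_square algebra_simps)
  have "(\<Sum>v\<in>V. flip_prob v \<sigma> * (D v (mag i) \<sigma>)\<^sup>2) \<le> (\<Sum>v\<in>V. if b v = i then 4 / n ^ 3 else 0)"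
  proof (intro sum_mono)
    fix v assume v: "v \<in> V"
    have "\<sigma> v * \<sigma> v = 1" using config_cases[OF \<sigma> v] by auto
    then have "(D v (mag i) \<sigma>)\<^sup>2 = (if b v = i then 4 / n\<^sup>2 else 0)"
      unfolding D_mag[OF v] by (simp add: power_divide power_mult_distrib power2_eq_square)
    moreover have "flip_prob v \<sigma> \<le> 1 / n"
      using flip_prob_bounds(2)[OF \<sigma> v] \<eta>_pos n_pos
      by (meson diff_le_eq divide_right_mono le_add_same_cancel1 less_imp_le of_nat_0_le_iff order_trans)
    then have "flip_prob v \<sigma> * (4 / n\<^sup>2) \<le> 1 / n * (4 / n\<^sup>2)" by (intro mult_right_mono) auto
    ultimately show "flip_prob v \<sigma> * (D v (mag i) \<sigma>)\<^sup>2 \<le> (if b v = i then 4 / n ^ 3 else 0)"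
      by (simp add: eval_nat_numeral)
  qed
  also have "\<dots> = (\<Sum>v\<in>B i. 4 / n ^ 3)" by (rule sum.inter_filter[symmetric]) simp
  also have "\<dots> = 4 * p i / n\<^sup>2" using b_card[OF i] n_pos by (simp add: eval_nat_numeral)
  finally have "(\<Sum>v\<in>V. flip_prob v \<sigma> * (D v (mag i) \<sigma>)\<^sup>2) \<le> 4 * p i / n\<^sup>2" .
  moreover have "P (\<lambda>\<tau>. (mag i \<tau>)\<^sup>2) \<sigma> = (mag i \<sigma>)\<^sup>2
      + 2 * mag i \<sigma> * (\<Sum>v\<in>V. flip_prob v \<sigma> * D v (mag i) \<sigma>)
      + (\<Sum>v\<in>V. flip_prob v \<sigma> * (D v (mag i) \<sigma>)\<^sup>2)"
    unfolding P_eq[OF \<sigma>] D2 by (simp add: distrib_left sum.distrib sum_distrib_left ac_simps)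
  ultimately show ?thesis unfolding drift_mag[OF \<sigma>] by linarith
qed

text \<open>Schur's test with the weights \<^term>\<open>p i * a i\<close>.\<close>

lemma quadratic_form_le:
  fixes x :: "nat \<Rightarrow> real"
  shows "(\<Sum>i<m. \<Sum>j<m. k i j * (x i * x j)) \<le> l * (\<Sum>i<m. (x i)\<^sup>2 / p i)"
proof -
  define y where "y i = p i * a i" for i
  have y: "y i > 0" if "i < m" for i using p_pos[OF that] ba_pos[OF that] by (simp add: y_def)
  define f where "f i j = k i j * ((x i)\<^sup>2 * y j / y i)" for i j
  have row: "(\<Sum>i<m. \<Sum>j<m. f i j) = l * (\<Sum>i<m. (x i)\<^sup>2 / p i)"
    unfolding sum_distrib_left
  proof (intro sum.cong refl)
    fix i assume "i \<in> {..<m}"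
    then have i: "i < m" by simp
    have "(\<Sum>j<m. f i j) = (x i)\<^sup>2 / y i * (\<Sum>j<m. a j * p j * k j i)"
      unfolding sum_distrib_left f_def using k_sym[OF i] by (intro sum.cong) (auto simp: y_def)
    also have "\<dots> = l * ((x i)\<^sup>2 / p i)"
      unfolding ba_eig[OF i] using ba_pos[OF i] by (simp add: y_def)
    finally show "(\<Sum>j<m. f i j) = l * ((x i)\<^sup>2 / p i)" .
  qed
  have "(\<Sum>i<m. \<Sum>j<m. k i j * (x i * x j)) \<le> (\<Sum>i<m. \<Sum>j<m. (f i j + f j i) / 2)"
  proof (intro sum_mono)
    fix i j assume "i \<in> {..<m}" "j \<in> {..<m}"
    then have ij: "i < m" "j < m" by auto
    have "0 \<le> (x i * y j - x j * y i)\<^sup>2 / (2 * y i * y j)"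
      using y[OF ij(1)] y[OF ij(2)] by simp
    also have "\<dots> = ((x i)\<^sup>2 * y j / y i + (x j)\<^sup>2 * y i / y j) / 2 - x i * x j"
      using y[OF ij(1)] y[OF ij(2)] by (simp add: power2_eq_square field_simps)
    finally have "x i * x j \<le> ((x i)\<^sup>2 * y j / y i + (x j)\<^sup>2 * y i / y j) / 2" by simp
    then have "k i j * (x i * x j) \<le> k i j * (((x i)\<^sup>2 * y j / y i + (x j)\<^sup>2 * y i / y j) / 2)"
      using k_nonneg[OF ij] by (rule mult_left_mono)
    then show "k i j * (x i * x j) \<le> (f i j + f j i) / 2"
      using k_sym[OF ij] by (simp add: f_def algebra_simps)
  qed
  also have "\<dots> = ((\<Sum>i<m. \<Sum>j<m. f i j) + (\<Sum>i<m. \<Sum>j<m. f j i)) / 2"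
    by (simp add: sum.distrib sum_divide_distrib[symmetric])
  also have "(\<Sum>i<m. \<Sum>j<m. f j i) = (\<Sum>i<m. \<Sum>j<m. f i j)" by (rule sum.swap)
  finally show ?thesis using row by simp
qed

text \<open>\<open>4 * m\<close> collects the increment variances of the blocks after division by
  \<open>p i\<close>; \<open>2 * \<kappa>\<close> comes from the self-interaction in the
  field.\<close>

definition Q_err :: real where "Q_err = 4 * m + 2 * \<kappa>"

lemma Q_err_nonneg: "Q_err \<ge> 0" using \<kappa>_nonneg by (simp add: Q_err_def)

text \<open>Here the nonlinearity needs no expansion: \<bar>tanh x\<bar> \<le> \<bar>x\<bar> bounds
  the drift by the quadratic form of \<open>k\<close> in the absolute magnetisations, and
  \<open>quadratic_form_le\<close> turns that into \<open>l * Q\<close>.\<close>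

lemma P_Q_le:
  assumes \<sigma>: "\<sigma> \<in> \<Omega>"
  shows "P Q \<sigma> \<le> (1 - 2 * c / n) * Q \<sigma> + Q_err / n\<^sup>2"
proof -
  let ?x = "\<lambda>i. \<bar>mag i \<sigma>\<bar>"
  have summand: "P (\<lambda>\<tau>. 1 / p i * (mag i \<tau>)\<^sup>2) \<sigma> \<le> (1 - 2 / n) * ((mag i \<sigma>)\<^sup>2 / p i)
      + 2 / n * (\<beta> * (\<Sum>j<m. k i j * (?x i * ?x j))) + 2 * \<kappa> / n\<^sup>2 * ?x i + 4 / n\<^sup>2"
    if i: "i < m" for i
  proof -
    let ?T = "\<Sum>v\<in>B i. th \<sigma> v" and ?F = "\<beta> * (\<Sum>j<m. k i j * ?x j) + \<kappa> / n"
    have "\<bar>?T\<bar> \<le> (\<Sum>v\<in>B i. ?F)"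
    proof (intro order_trans[OF sum_abs] sum_mono)
      fix v assume v: "v \<in> B i"
      have "\<bar>th \<sigma> v\<bar> \<le> \<bar>fld \<sigma> v\<bar>" unfolding th_def by (rule abs_tanh_le)
      also have "\<dots> \<le> ?F" using abs_fld_le[OF \<sigma>, of v] v by simp
      finally show "\<bar>th \<sigma> v\<bar> \<le> ?F" .
    qed
    also have "\<dots> = n * p i * ?F" using b_card[OF i] by simp
    finally have T: "\<bar>?T\<bar> \<le> n * p i * ?F" .
    have "mag i \<sigma> * ?T \<le> ?x i * \<bar>?T\<bar>" by (simp flip: abs_mult)
    also have "\<dots> \<le> ?x i * (n * p i * ?F)" using T by (intro mult_left_mono) auto
    finally have "2 * mag i \<sigma> * ?T / n\<^sup>2 \<le> 2 * (?x i * (n * p i * ?F)) / n\<^sup>2"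
      by (intro divide_right_mono) auto
    also have "\<dots> = p i * (2 / n * ?F * ?x i)" using n_pos by (simp add: power2_eq_square)
    finally have m1: "2 * mag i \<sigma> * ?T / n\<^sup>2 \<le> p i * (2 / n * ?F * ?x i)" .
    have "P (\<lambda>\<tau>. (mag i \<tau>)\<^sup>2) \<sigma> \<le>
      (mag i \<sigma>)\<^sup>2 + 2 * mag i \<sigma> * ((?T / n - mag i \<sigma>) / n) + 4 * p i / n\<^sup>2"
      by (rule P_mag_square[OF \<sigma> i])
    also have "\<dots> = (1 - 2 / n) * (mag i \<sigma>)\<^sup>2 + 2 * mag i \<sigma> * ?T / n\<^sup>2 + 4 * p i / n\<^sup>2"
      by (simp add: power2_eq_square algebra_simps diff_divide_distrib)
    finally have "P (\<lambda>\<tau>. (mag i \<tau>)\<^sup>2) \<sigma>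
        \<le> (1 - 2 / n) * (mag i \<sigma>)\<^sup>2 + p i * (2 / n * ?F * ?x i) + 4 * p i / n\<^sup>2"
      using m1 by linarith
    then have "1 / p i * P (\<lambda>\<tau>. (mag i \<tau>)\<^sup>2) \<sigma>
        \<le> 1 / p i * ((1 - 2 / n) * (mag i \<sigma>)\<^sup>2 + p i * (2 / n * ?F * ?x i) + 4 * p i / n\<^sup>2)"
      using p_pos[OF i] by (intro mult_left_mono) auto
    also have "\<dots> = (1 - 2 / n) * ((mag i \<sigma>)\<^sup>2 / p i) + 2 / n * ?F * ?x i + 4 / n\<^sup>2"
      using p_pos[OF i] by (simp add: distrib_left)
    also have "2 / n * ?F * ?x i
        = 2 / n * (\<beta> * (\<Sum>j<m. k i j * (?x i * ?x j))) + 2 * \<kappa> / n\<^sup>2 * ?x i"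
      by (simp add: distrib_left distrib_right sum_distrib_left sum_distrib_right power2_eq_square ac_simps)
    finally show ?thesis unfolding P_cmult by simp
  qed
  have "P Q \<sigma> = (\<Sum>i<m. P (\<lambda>\<tau>. 1 / p i * (mag i \<tau>)\<^sup>2) \<sigma>)"
    unfolding P_sum[symmetric] Q_def[abs_def] by simp
  also have "\<dots> \<le> (\<Sum>i<m. (1 - 2 / n) * ((mag i \<sigma>)\<^sup>2 / p i)
      + 2 / n * (\<beta> * (\<Sum>j<m. k i j * (?x i * ?x j))) + 2 * \<kappa> / n\<^sup>2 * ?x i + 4 / n\<^sup>2)"
    using summand by (intro sum_mono) auto
  also have "\<dots> = (1 - 2 / n) * Q \<sigma> + 2 / n * (\<beta> * (\<Sum>i<m. \<Sum>j<m. k i j * (?x i * ?x j)))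
      + 2 * \<kappa> / n\<^sup>2 * (\<Sum>i<m. ?x i) + 4 * m / n\<^sup>2"
    unfolding Q_def by (simp only: sum.distrib sum_distrib_left[symmetric]) simp
  also have "\<dots> \<le> (1 - 2 / n) * Q \<sigma> + 2 / n * (\<beta> * (l * Q \<sigma>)) + 2 * \<kappa> / n\<^sup>2 * 1 + 4 * m / n\<^sup>2"
    using quadratic_form_le[of ?x] \<beta>_nonneg sum_abs_mag_le[OF \<sigma>] \<kappa>_nonneg
    by (intro add_mono mult_left_mono order_refl) (auto simp: Q_def)
  also have "\<dots> = (1 - 2 * c / n) * Q \<sigma> + Q_err / n\<^sup>2"
    by (simp add: c_def Q_err_def algebra_simps diff_divide_distrib add_divide_distrib)
  finally show ?thesis .
qed

text \<open>The tanh is linearised at each site. The eigenvector equation evaluates the linear part,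
  and the error, at most the squared field, is bounded by \<open>fld_square_le\<close>. A one-sided
  bound suffices because the chain is started with positive \<open>M\<close>.\<close>

lemma P_M_ge:
  assumes \<sigma>: "\<sigma> \<in> \<Omega>"
  shows "P M \<sigma> \<ge> \<rho> * M \<sigma> - 2 * \<kappa>\<^sup>2 / n * Q \<sigma> - (\<kappa> + 2 * \<kappa>\<^sup>2) / n\<^sup>2"
proof -
  let ?E = "2 * \<kappa>\<^sup>2 * Q \<sigma> + 2 * \<kappa>\<^sup>2 / n"
  have a01: "0 \<le> a (b v)" "a (b v) \<le> 1" if "v \<in> V" for v
    using b_less[OF that] ba_pos ba_le_1 by (auto simp: less_imp_le)
  have aux: "(\<Sum>v\<in>V. a (b v) * (\<beta> * (\<Sum>j<m. k (b v) j * mag j \<sigma>))) = n * (\<beta> * l * M \<sigma>)"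
  proof -
    have "(\<Sum>v\<in>V. a (b v) * (\<beta> * (\<Sum>j<m. k (b v) j * mag j \<sigma>)))
        = n * (\<Sum>i<m. p i * (a i * (\<beta> * (\<Sum>j<m. k i j * mag j \<sigma>))))"
      by (rule sum_blocks_const)
    also have "(\<Sum>i<m. p i * (a i * (\<beta> * (\<Sum>j<m. k i j * mag j \<sigma>))))
        = \<beta> * (\<Sum>i<m. \<Sum>j<m. a i * p i * k i j * mag j \<sigma>)"
      by (simp add: sum_distrib_left ac_simps)
    also have "(\<Sum>i<m. \<Sum>j<m. a i * p i * k i j * mag j \<sigma>) = (\<Sum>j<m. \<Sum>i<m. a i * p i * k i j * mag j \<sigma>)"
      by (rule sum.swap)
    also have "\<dots> = (\<Sum>j<m. l * a j * mag j \<sigma>)"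
      unfolding sum_distrib_right[symmetric] by (intro sum.cong) (auto simp: ba_eig)
    also have "\<dots> = l * M \<sigma>" by (simp add: M_def sum_distrib_left mult.assoc)
    finally show ?thesis by simp
  qed
  have "n * (\<beta> * l * M \<sigma>) - \<kappa> - n * ?E
      = (\<Sum>v\<in>V. a (b v) * (\<beta> * (\<Sum>j<m. k (b v) j * mag j \<sigma>)) - \<kappa> / n - ?E)"
    unfolding sum_subtractf aux using n_pos by simp
  also have "\<dots> \<le> (\<Sum>v\<in>V. a (b v) * th \<sigma> v)"
  proof (intro sum_mono)
    fix v assume v: "v \<in> V"
    have "\<bar>J v v * \<sigma> v\<bar> \<le> \<kappa> / n" "\<kappa> / n \<ge> 0"
      using J_le[OF v v] J_nonneg[OF v v] \<sigma> v \<kappa>_nonneg by (simp_all add: abs_mult)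
    then have "a (b v) * \<bar>J v v * \<sigma> v\<bar> \<le> 1 * (\<kappa> / n)"
      using a01[OF v] by (intro mult_mono) auto
    moreover have "a (b v) * (J v v * \<sigma> v) \<le> a (b v) * \<bar>J v v * \<sigma> v\<bar>"
      using a01[OF v] by (intro mult_left_mono) auto
    ultimately have 1: "a (b v) * (J v v * \<sigma> v) \<le> 1 * (\<kappa> / n)" by (rule order_trans[rotated])
    have 2: "a (b v) * (fld \<sigma> v)\<^sup>2 \<le> 1 * ?E"
      using a01[OF v] fld_square_le[OF \<sigma> v] by (intro mult_mono) auto
    let ?X = "a (b v) * (\<beta> * (\<Sum>j<m. k (b v) j * mag j \<sigma>))"
    have "?X - \<kappa> / n - ?E \<le> ?X - a (b v) * (J v v * \<sigma> v) - a (b v) * (fld \<sigma> v)\<^sup>2"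
      using 1 2 unfolding mult_1_left by (intro diff_mono order_refl)
    also have "\<dots> = a (b v) * (fld \<sigma> v - (fld \<sigma> v)\<^sup>2)"
      by (simp add: fld_eq[OF v] right_diff_distrib)
    also have "\<dots> \<le> a (b v) * th \<sigma> v"
      using a01[OF v] abs_tanh_minus_id_le[of "fld \<sigma> v"]
      by (intro mult_left_mono) (auto simp: th_def)
    finally show "?X - \<kappa> / n - ?E \<le> a (b v) * th \<sigma> v" .
  qed
  also have "\<dots> = (\<Sum>i<m. a i * (\<Sum>v\<in>B i. th \<sigma> v))"
    unfolding sum_blocks sum_distrib_left by (intro sum.cong) auto
  finally have "(n * (\<beta> * l * M \<sigma>) - \<kappa> - n * ?E) / n\<^sup>2 \<le> (\<Sum>i<m. a i * (\<Sum>v\<in>B i. th \<sigma> v)) / n\<^sup>2"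
    by (rule divide_right_mono) simp
  moreover have "P M \<sigma> = M \<sigma> - M \<sigma> / n + (\<Sum>i<m. a i * (\<Sum>v\<in>B i. th \<sigma> v)) / n\<^sup>2"
  proof -
    have "P M \<sigma> = (\<Sum>i<m. a i * P (mag i) \<sigma>)"
      unfolding M_def[abs_def] P_sum P_cmult ..
    also have "\<dots> = (\<Sum>i<m. a i * mag i \<sigma> - a i * mag i \<sigma> / n + a i * (\<Sum>v\<in>B i. th \<sigma> v) / n\<^sup>2)"
      unfolding P_mag[OF \<sigma>]
      by (intro sum.cong refl) (simp add: distrib_left right_diff_distrib diff_divide_distrib power2_eq_square)
    finally show ?thesis by (simp add: sum.distrib sum_subtractf M_def sum_divide_distrib)
  qed
  moreover have "(n * (\<beta> * l * M \<sigma>) - \<kappa> - n * ?E) / n\<^sup>2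
      = \<beta> * l * M \<sigma> / n - 2 * \<kappa>\<^sup>2 / n * Q \<sigma> - (\<kappa> + 2 * \<kappa>\<^sup>2) / n\<^sup>2"
    using n_pos by (simp add: power2_eq_square field_simps)
  moreover have "\<rho> * M \<sigma> = M \<sigma> - M \<sigma> / n + \<beta> * l * M \<sigma> / n"
    by (simp add: \<rho>_def algebra_simps diff_divide_distrib)
  ultimately show ?thesis by linarith
qed

section \<open>The corrected observable and its mean\<close>

text \<open>In one step \<open>Q\<close> loses \<open>c / n\<close> more than the factor
  \<open>\<rho>\<close>; this weight makes that surplus equal to the error
  \<open>2 * \<kappa>\<^sup>2 / n * Q\<close> in the drift of \<open>M\<close>.\<close>

definition Q_weight :: real where "Q_weight = 2 * \<kappa>\<^sup>2 / c"
definition U_err :: real where "U_err = \<kappa> + 2 * \<kappa>\<^sup>2 + Q_weight * Q_err"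

lemma Q_weight_nonneg: "Q_weight \<ge> 0" using c_pos by (simp add: Q_weight_def)
lemma U_err_nonneg: "U_err \<ge> 0" using Q_weight_nonneg Q_err_nonneg \<kappa>_nonneg by (simp add: U_err_def)

text \<open>The quadratic correction absorbs the nonlinearity of the hyperbolic tangent: \<^term>\<open>Q\<close> decays
  twice as fast as \<^term>\<open>M\<close>.\<close>

definition U :: "(nat \<Rightarrow> real) \<Rightarrow> real" where "U \<sigma> = M \<sigma> + (- Q_weight) * Q \<sigma>"

lemma P_U_ge:
  assumes \<sigma>: "\<sigma> \<in> \<Omega>" shows "P U \<sigma> \<ge> \<rho> * U \<sigma> + (- (U_err / n\<^sup>2))"
proof -
  have "Q_weight * P Q \<sigma> \<le> Q_weight * ((1 - 2 * c / n) * Q \<sigma> + Q_err / n\<^sup>2)"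
    using P_Q_le[OF \<sigma>] Q_weight_nonneg by (intro mult_left_mono)
  moreover have "P U \<sigma> = P M \<sigma> - Q_weight * P Q \<sigma>"
    unfolding U_def[abs_def] P_add P_cmult by simp
  moreover have "\<rho> * M \<sigma> - 2 * \<kappa>\<^sup>2 / n * Q \<sigma> - (\<kappa> + 2 * \<kappa>\<^sup>2) / n\<^sup>2
      - Q_weight * ((1 - 2 * c / n) * Q \<sigma> + Q_err / n\<^sup>2) = \<rho> * U \<sigma> + (- (U_err / n\<^sup>2))"
  proof -
    have "2 * \<kappa>\<^sup>2 = Q_weight * c" using c_pos by (simp add: Q_weight_def)
    then show ?thesis
      by (simp add: U_def U_err_def \<rho>_eq algebra_simps add_divide_distrib diff_divide_distrib)
  qed
  ultimately show ?thesis using P_M_ge[OF \<sigma>] by linarith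
qed

text \<open>\<open>U_err / (c * n)\<close> is the fixed point of the error recursion x =
  \<open>\<rho>\<close> x + \<open>U_err / n\<^sup>2\<close>.\<close>

lemma Pt_U_ge:
  assumes \<sigma>: "\<sigma> \<in> \<Omega>" shows "(P ^^ t) U \<sigma> \<ge> \<rho> ^ t * U \<sigma> - U_err / (c * n)"
proof (induction t)
  case 0
  then show ?case using U_err_nonneg c_pos by simp
next
  case (Suc t)
  have "\<rho> * (\<rho> ^ t * U \<sigma> - U_err / (c * n)) \<le> \<rho> * (P ^^ t) U \<sigma>"
    using Suc \<rho>_nonneg by (intro mult_left_mono)
  moreover have "(P ^^ t) (\<lambda>\<tau>. \<rho> * U \<tau> + (- (U_err / n\<^sup>2))) \<sigma> \<le> (P ^^ t) (P U) \<sigma>"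
    using P_U_ge \<sigma> by (intro Pt_mono) auto
  moreover have "\<rho> * (U_err / (c * n)) + U_err / n\<^sup>2 = U_err / (c * n)"
    using c_pos n_pos by (simp add: \<rho>_eq power2_eq_square field_simps)
  ultimately show ?case
    unfolding Pt_Suc Pt_add Pt_cmult Pt_const power_Suc by (simp add: algebra_simps)
qed

lemma Pt_M_ge:
  assumes \<sigma>: "\<sigma> \<in> \<Omega>" shows "(P ^^ t) M \<sigma> \<ge> \<rho> ^ t * U \<sigma> - U_err / (c * n)"
proof -
  have "(P ^^ t) U \<sigma> \<le> (P ^^ t) M \<sigma>"
    using \<sigma> Q_nonneg Q_weight_nonneg by (intro Pt_mono) (auto simp: U_def)
  then show ?thesis using Pt_U_ge[OF \<sigma>, of t] by linarith
qed

lemma Pt_M_variance_le: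
  assumes \<sigma>: "\<sigma> \<in> \<Omega>"
  shows "(P ^^ t) (\<lambda>\<tau>. (M \<tau>)\<^sup>2) \<sigma> - ((P ^^ t) M \<sigma>)\<^sup>2 \<le> 4 / (c * n)"
proof -
  have "\<bar>D v M \<tau>\<bar> \<le> 2 / n * a (b v)" if "\<tau> \<in> \<Omega>" "v \<in> V" for \<tau> v
  proof -
    have bv: "b v < m" using b_less that by simp
    have "D v M \<tau> = (\<Sum>i<m. a i * D v (mag i) \<tau>)"
      by (simp add: D_def M_def right_diff_distrib sum_subtractf)
    also have "\<dots> = (\<Sum>i<m. if i = b v then a i * (- 2 * \<tau> v / n) else 0)"
      unfolding D_mag[OF that(2)] by (intro sum.cong) auto
    also have "\<dots> = a (b v) * (- 2 * \<tau> v / n)" using bv by simp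
    finally show ?thesis using that ba_pos[OF bv] by (simp add: abs_mult mult.commute)
  qed
  from Pt_variance_le[OF this \<sigma>, of t] show ?thesis
    using n_pos by (simp add: c_def power2_eq_square ac_simps)
qed

section \<open>The starting configuration\<close>

lemma starting_config:
  assumes \<delta>: "0 \<le> \<delta>" "\<delta> \<le> 1"
  obtains \<sigma> where "\<sigma> \<in> \<Omega>" "\<And>i. i < m \<Longrightarrow> \<bar>mag i \<sigma> - \<delta> * p i\<bar> \<le> 2 / n"
proof -
  \<comment> \<open>The number of plus spins in block \<open>i\<close>; rounding it down moves
    \<open>mag i\<close> by at most 2/n.\<close>
  define N where "N i = nat \<lfloor>(1 + \<delta>) / 2 * (n * p i)\<rfloor>" for i
  have N: "real (N i) \<le> (1 + \<delta>) / 2 * (n * p i)" "(1 + \<delta>) / 2 * (n * p i) - 1 \<le> real (N i)"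
    if "i < m" for i
  proof -
    have "0 \<le> (1 + \<delta>) / 2 * (n * p i)" using \<delta> p_pos[OF that] by simp
    then show "real (N i) \<le> (1 + \<delta>) / 2 * (n * p i)" "(1 + \<delta>) / 2 * (n * p i) - 1 \<le> real (N i)"
      unfolding N_def by linarith+
  qed
  have "\<exists>S\<subseteq>B i. card S = N i" if i: "i < m" for i
  proof -
    have "(1 + \<delta>) / 2 * (n * p i) \<le> 1 * (n * p i)"
      using \<delta> p_pos[OF i] by (intro mult_right_mono) auto
    then have "real (N i) \<le> real (card (B i))" using N[OF i] b_card[OF i] by simp
    then have "N i \<le> card (B i)" by simp
    then show ?thesis by (rule obtain_subset_with_card_n) blast
  qed
  note ex = this
  define S where "S i = (SOME S. S \<subseteq> B i \<and> card S = N i)" for i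
  have S: "S i \<subseteq> B i \<and> card (S i) = N i" if "i < m" for i
    unfolding S_def by (rule someI_ex[OF ex[OF that]])
  define \<sigma> where "\<sigma> v = (if v \<in> V then if v \<in> S (b v) then 1 else (-1 :: real) else undefined)" for v
  show thesis
  proof
    show "\<sigma> \<in> \<Omega>" by (auto simp: \<sigma>_def configs_def PiE_def Pi_def extensional_def split: if_splits)
    fix i assume i: "i < m"
    have "(\<Sum>v\<in>B i. \<sigma> v) = (\<Sum>v\<in>B i. (if v \<in> S i then 2 else 0) - 1)"
      by (intro sum.cong) (auto simp: \<sigma>_def)
    also have "\<dots> = (\<Sum>v\<in>B i. if v \<in> S i then 2 else 0) - real (card (B i))"
      by (simp add: sum_subtractf)
    also have "(\<Sum>v\<in>B i. if v \<in> S i then 2 else 0) = (\<Sum>v\<in>{v \<in> B i. v \<in> S i}. (2::real))"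
      by (rule sum.inter_filter[symmetric]) simp
    also have "{v \<in> B i. v \<in> S i} = S i" using S[OF i] by auto
    finally have "(\<Sum>v\<in>B i. \<sigma> v) = 2 * real (N i) - n * p i"
      using S[OF i] b_card[OF i] by simp
    then have "\<bar>(\<Sum>v\<in>B i. \<sigma> v) - \<delta> * (n * p i)\<bar> \<le> 2"
      using N[OF i] by (simp add: abs_le_iff algebra_simps)
    then have "\<bar>(\<Sum>v\<in>B i. \<sigma> v) - \<delta> * (n * p i)\<bar> / n \<le> 2 / n"
      by (intro divide_right_mono) auto
    moreover have "mag i \<sigma> - \<delta> * p i = ((\<Sum>v\<in>B i. \<sigma> v) - \<delta> * (n * p i)) / n"
      using n_pos by (simp add: mag_def field_simps)
    ultimately show "\<bar>mag i \<sigma> - \<delta> * p i\<bar> \<le> 2 / n" by simp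
  qed
qed

definition abar :: real where "abar = (\<Sum>i<m. a i * p i)"
text \<open>Rounding costs 2/n in \<open>M\<close> and, after splitting the square, 8/(n
  \<open>p i\<close>) in each term of \<open>Q\<close>.\<close>

definition start_err :: real where "start_err = 2 + 8 * Q_weight * (\<Sum>i<m. 1 / p i)"
definition start_level :: real where "start_level = abar\<^sup>2 / (8 * (Q_weight + 1))"

lemma m_pos: "m > 0" using p_sum by (cases "m = 0") auto

lemma abar_pos: "abar > 0"
  unfolding abar_def using m_pos ba_pos p_pos by (intro sum_pos) (auto simp: lessThan_empty_iff)

lemma start_level_pos: "start_level > 0" using abar_pos Q_weight_nonneg by (simp add: start_level_def add_nonneg_pos)

lemma starting_U:
  obtains \<sigma> where "\<sigma> \<in> \<Omega>" "U \<sigma> \<ge> start_level - start_err / n"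
proof -
  have "abar \<le> (\<Sum>i<m. 1 * p i)" unfolding abar_def
    using ba_le_1 p_pos by (intro sum_mono mult_right_mono) (auto simp: less_imp_le)
  then have abar1: "abar \<le> 1" using p_sum by simp
  \<comment> \<open>Up to rounding, \<open>M\<close> is \<open>\<delta> * abar\<close> and the loss
    from \<open>Q\<close> is at most \<open>2 * Q_weight * \<delta>\<^sup>2\<close>. This choice
    makes the loss at most half of the gain and leaves \<open>start_level\<close>; the added 1 keeps
    \<open>\<delta>\<close> at most 1 even if \<open>Q_weight\<close> vanishes.\<close>
  define \<delta> where "\<delta> = abar / (4 * (Q_weight + 1))"
  have \<delta>0: "\<delta> \<ge> 0" using abar_pos Q_weight_nonneg by (simp add: \<delta>_def)
  have \<delta>1: "\<delta> \<le> 1" using abar1 Q_weight_nonneg by (simp add: \<delta>_def field_simps)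
  obtain \<sigma> where \<sigma>: "\<sigma> \<in> \<Omega>" and mag: "\<And>i. i < m \<Longrightarrow> \<bar>mag i \<sigma> - \<delta> * p i\<bar> \<le> 2 / n"
    using starting_config[OF \<delta>0 \<delta>1] by blast
  have "\<delta> * abar - 2 / n = (\<Sum>i<m. a i * (\<delta> * p i - 2 / n))"
    using a_sum by (simp add: abar_def right_diff_distrib sum_subtractf sum_distrib_left ac_simps
      flip: sum_distrib_right sum_divide_distrib)
  also have "\<dots> \<le> M \<sigma>" unfolding M_def
    using mag ba_pos by (intro sum_mono mult_left_mono) (auto simp: abs_le_iff less_imp_le algebra_simps)
  finally have M: "M \<sigma> \<ge> \<delta> * abar - 2 / n" .
  have "Q \<sigma> \<le> (\<Sum>i<m. 2 * \<delta>\<^sup>2 * p i + 8 / n * (1 / p i))" unfolding Q_def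
  proof (intro sum_mono)
    fix i assume "i \<in> {..<m}"
    then have i: "i < m" by simp
    have "(mag i \<sigma>)\<^sup>2 = (\<delta> * p i + (mag i \<sigma> - \<delta> * p i))\<^sup>2" by simp
    also have "\<dots> \<le> 2 * (\<delta> * p i)\<^sup>2 + 2 * (mag i \<sigma> - \<delta> * p i)\<^sup>2"
      using square_add_le[of 1 "\<delta> * p i" "mag i \<sigma> - \<delta> * p i"] by simp
    also have "(mag i \<sigma> - \<delta> * p i)\<^sup>2 \<le> (2 / n)\<^sup>2"
      using mag[OF i] by (rule square_le_if_abs_le)
    also have "(2 / real n)\<^sup>2 \<le> 4 / n" using n_pos by (simp add: power2_eq_square field_simps)
    finally have "(mag i \<sigma>)\<^sup>2 \<le> 2 * (\<delta> * p i)\<^sup>2 + 8 / n" by simp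
    then have "(mag i \<sigma>)\<^sup>2 / p i \<le> (2 * (\<delta> * p i)\<^sup>2 + 8 / n) / p i"
      using p_pos[OF i] by (intro divide_right_mono) auto
    also have "\<dots> = 2 * \<delta>\<^sup>2 * p i + 8 / n * (1 / p i)"
      using p_pos[OF i] by (simp add: power2_eq_square add_divide_distrib)
    finally show "(mag i \<sigma>)\<^sup>2 / p i \<le> 2 * \<delta>\<^sup>2 * p i + 8 / n * (1 / p i)" .
  qed
  also have "\<dots> = 2 * \<delta>\<^sup>2 + 8 / n * (\<Sum>i<m. 1 / p i)"
    by (simp only: sum.distrib sum_distrib_left[symmetric] p_sum mult_1_right)
  finally have "Q_weight * Q \<sigma> \<le> Q_weight * (2 * \<delta>\<^sup>2 + 8 / n * (\<Sum>i<m. 1 / p i))"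
    using Q_weight_nonneg by (intro mult_left_mono)
  also have "\<dots> = 2 * Q_weight * \<delta>\<^sup>2 + 8 * Q_weight * (\<Sum>i<m. 1 / p i) / n" by (simp add: algebra_simps)
  also have "2 * Q_weight * \<delta>\<^sup>2 \<le> \<delta> * abar / 2"
  proof -
    have "Q_weight * (4 * \<delta>) \<le> abar" using abar_pos Q_weight_nonneg by (simp add: \<delta>_def field_simps)
    then have "\<delta> * (Q_weight * (4 * \<delta>)) \<le> \<delta> * abar" using \<delta>0 by (rule mult_left_mono)
    then show ?thesis by (simp add: power2_eq_square algebra_simps)
  qed
  finally have "U \<sigma> \<ge> \<delta> * abar / 2 - start_err / n"
    using M by (simp add: U_def start_err_def add_divide_distrib)
  moreover have "\<delta> * abar / 2 = start_level" by (simp add: \<delta>_def start_level_def power2_eq_square)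
  ultimately show thesis using \<sigma> that by simp
qed

section \<open>Distance to equilibrium\<close>

lemma fld_local_field: "fld \<sigma> v = \<beta> * local_field k b n \<sigma> v"
  by (simp add: fld_def local_field_def J_def sum_distrib_left mult.assoc)

text \<open>For each site \<open>v\<close> only the two configurations
  \<open>\<sigma>(v := 1)\<close> and \<open>\<sigma>(v := -1)\<close> pass the test in
  \<open>glauber\<close>; equality outside \<open>V\<close> comes from the extensionality of
  \<open>configs\<close>.\<close>

lemma sum_glauber:
  assumes \<sigma>: "\<sigma> \<in> \<Omega>"
  shows "(\<Sum>\<tau>\<in>\<Omega>. glauber k b \<beta> n \<sigma> \<tau> * g \<tau>) = P g \<sigma>"
proof -
  let ?r = "\<lambda>v \<tau>. (1 + \<tau> v * th \<sigma> v) / 2"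
  have inner: "(\<Sum>\<tau>\<in>\<Omega>. (if \<forall>w\<in>V - {v}. \<tau> w = \<sigma> w then ?r v \<tau> else 0) * g \<tau>) = resample g v \<sigma>"
    if v: "v \<in> V" for v
  proof -
    have set: "{\<tau> \<in> \<Omega>. \<forall>w\<in>V - {v}. \<tau> w = \<sigma> w} = {\<sigma>(v := 1), \<sigma>(v := -1)}" (is "?A = ?B")
    proof
      show "?B \<subseteq> ?A" using \<sigma> v by auto
      show "?A \<subseteq> ?B"
      proof
        fix \<tau> assume "\<tau> \<in> ?A"
        then have \<tau>: "\<tau> \<in> \<Omega>" and eq: "\<And>w. w \<in> V \<Longrightarrow> w \<noteq> v \<Longrightarrow> \<tau> w = \<sigma> w" by auto
        have "\<tau> w = \<sigma> w" if "w \<noteq> v" for w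
        proof (cases "w \<in> V")
          case False
          then show ?thesis using \<sigma> \<tau> unfolding configs_def by (metis PiE_arb)
        qed (use eq that in auto)
        then have "\<tau> = \<sigma>(v := \<tau> v)" by auto
        then show "\<tau> \<in> ?B" using config_cases[OF \<tau> v] by (metis insertCI)
      qed
    qed
    have ne: "\<sigma>(v := 1) \<noteq> \<sigma>(v := -1)" by (metis fun_upd_same one_neq_neg_one)
    have "(\<Sum>\<tau>\<in>\<Omega>. (if \<forall>w\<in>V - {v}. \<tau> w = \<sigma> w then ?r v \<tau> else 0) * g \<tau>)
        = (\<Sum>\<tau>\<in>\<Omega>. if \<forall>w\<in>V - {v}. \<tau> w = \<sigma> w then ?r v \<tau> * g \<tau> else 0)"
      by (intro sum.cong) auto
    also have "\<dots> = (\<Sum>\<tau>\<in>{\<tau> \<in> \<Omega>. \<forall>w\<in>V - {v}. \<tau> w = \<sigma> w}. ?r v \<tau> * g \<tau>)"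
      by (rule sum.inter_filter[symmetric]) simp
    also have "\<dots> = resample g v \<sigma>"
      unfolding set using ne by (simp add: resample_def)
    finally show ?thesis .
  qed
  have "(\<Sum>\<tau>\<in>\<Omega>. glauber k b \<beta> n \<sigma> \<tau> * g \<tau>)
      = (\<Sum>\<tau>\<in>\<Omega>. \<Sum>v\<in>V. 1 / n * ((if \<forall>w\<in>V - {v}. \<tau> w = \<sigma> w then ?r v \<tau> else 0) * g \<tau>))"
    unfolding glauber_def fld_local_field[symmetric] th_def sum_distrib_left sum_distrib_right
    by (intro sum.cong refl) (simp only: mult.assoc)
  also have "\<dots> = (\<Sum>v\<in>V. \<Sum>\<tau>\<in>\<Omega>. 1 / n * ((if \<forall>w\<in>V - {v}. \<tau> w = \<sigma> w then ?r v \<tau> else 0) * g \<tau>))"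
    by (rule sum.swap)
  also have "\<dots> = (\<Sum>v\<in>V. 1 / n * resample g v \<sigma>)"
    unfolding sum_distrib_left[symmetric] using inner by (intro sum.cong refl arg_cong2[of _ _ _ _ "(*)"])
  finally show ?thesis by (simp add: P_def sum_divide_distrib)
qed

lemma sum_glauber_pow:
  assumes \<sigma>: "\<sigma> \<in> \<Omega>"
  shows "(\<Sum>\<tau>\<in>\<Omega>. glauber_pow k b \<beta> n t \<sigma> \<tau> * g \<tau>) = (P ^^ t) g \<sigma>"
proof (induction t arbitrary: g)
  case 0
  have "(\<Sum>\<tau>\<in>\<Omega>. glauber_pow k b \<beta> n 0 \<sigma> \<tau> * g \<tau>) = (\<Sum>\<tau>\<in>\<Omega>. if \<sigma> = \<tau> then g \<tau> else 0)"
    by (intro sum.cong) auto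
  then show ?case using \<sigma> by simp
next
  case (Suc t)
  have "(\<Sum>\<tau>\<in>\<Omega>. glauber_pow k b \<beta> n (Suc t) \<sigma> \<tau> * g \<tau>)
      = (\<Sum>\<tau>\<in>\<Omega>. \<Sum>\<xi>\<in>\<Omega>. glauber_pow k b \<beta> n t \<sigma> \<xi> * (glauber k b \<beta> n \<xi> \<tau> * g \<tau>))"
    by (simp add: sum_distrib_right mult.assoc)
  also have "\<dots> = (\<Sum>\<xi>\<in>\<Omega>. \<Sum>\<tau>\<in>\<Omega>. glauber_pow k b \<beta> n t \<sigma> \<xi> * (glauber k b \<beta> n \<xi> \<tau> * g \<tau>))"
    by (rule sum.swap)
  also have "\<dots> = (\<Sum>\<xi>\<in>\<Omega>. glauber_pow k b \<beta> n t \<sigma> \<xi> * P g \<xi>)"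
    unfolding sum_distrib_left[symmetric] using sum_glauber
    by (intro sum.cong refl arg_cong2[of _ _ _ _ "(*)"])
  also have "\<dots> = (P ^^ Suc t) g \<sigma>" unfolding Suc.IH Pt_Suc ..
  finally show ?case .
qed

section \<open>The Gibbs measure\<close>

text \<open>The sum over v < w depends on the labelling of the sites; the symmetric form makes
  invariance under \<open>aut\<close> and the effect of a flip easy to read off.\<close>

lemma hamil_eq: "\<beta> * hamil k b n \<sigma> = (\<Sum>v\<in>V. \<sigma> v * fld \<sigma> v) / 2"
proof -
  let ?f = "\<lambda>v w. J v w * \<sigma> v * \<sigma> w"
  let ?L = "{(v, w). v \<in> V \<and> w \<in> V \<and> v < w}" and ?R = "{(v, w). v \<in> V \<and> w \<in> V \<and> w < v}"
  have fin: "finite ?L" "finite ?R"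
    by (rule finite_subset[of _ "V \<times> V"]; auto)+
  have L: "\<beta> * hamil k b n \<sigma> = (\<Sum>(v, w)\<in>?L. ?f v w)"
    unfolding hamil_def sum_distrib_left by (intro sum.cong) (auto simp: J_def)
  have R: "(\<Sum>(v, w)\<in>?R. ?f v w) = (\<Sum>(v, w)\<in>?L. ?f v w)"
    by (rule sum.reindex_bij_witness[of _ prod.swap prod.swap]) (auto simp: J_sym)
  have "(\<Sum>v\<in>V. \<sigma> v * fld \<sigma> v) = (\<Sum>v\<in>V. \<Sum>w\<in>V - {v}. ?f v w)"
    by (simp add: fld_def sum_distrib_left ac_simps)
  also have "\<dots> = (\<Sum>(v, w)\<in>(SIGMA v:V. V - {v}). ?f v w)"
    by (rule sum.Sigma) auto
  also have "(SIGMA v:V. V - {v}) = ?L \<union> ?R" by auto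
  also have "(\<Sum>(v, w)\<in>?L \<union> ?R. ?f v w) = (\<Sum>(v, w)\<in>?L. ?f v w) + (\<Sum>(v, w)\<in>?R. ?f v w)"
    using fin by (intro sum.union_disjoint) auto
  finally show ?thesis using L R by simp
qed

abbreviation "w \<equiv> gibbs k b \<beta> n"

lemma partition_pos: "(\<Sum>\<rho>\<in>\<Omega>. exp (\<beta> * hamil k b n \<rho>)) > 0"
proof -
  have "(\<lambda>v. if v \<in> V then 1 else undefined) \<in> \<Omega>" by (auto simp: configs_def)
  then show ?thesis by (intro sum_pos) auto
qed

lemma w_nonneg: "w \<sigma> \<ge> 0"
  using partition_pos by (simp add: gibbs_def)

lemma w_sum: "(\<Sum>\<sigma>\<in>\<Omega>. w \<sigma>) = 1"
  using partition_pos by (simp add: gibbs_def flip: sum_divide_distrib)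

lemma w_aut:
  assumes \<pi>: "aut \<pi>" shows "w (\<tau> \<circ> \<pi>) = w \<tau>"
proof -
  have p: "\<pi> permutes V" using \<pi> by (simp add: aut_def)
  have "(\<Sum>v\<in>V. (\<tau> \<circ> \<pi>) v * fld (\<tau> \<circ> \<pi>) v) = (\<Sum>v\<in>V. \<tau> (\<pi> v) * fld \<tau> (\<pi> v))"
    using fld_aut[OF \<pi>] by (intro sum.cong) auto
  also have "\<dots> = (\<Sum>v\<in>V. \<tau> v * fld \<tau> v)"
    by (rule sum.permute[OF p, unfolded o_def, symmetric])
  finally show ?thesis by (simp add: gibbs_def hamil_eq)
qed

lemma hamil_flip:
  assumes v: "v \<in> V"
  shows "\<beta> * hamil k b n (flip v \<sigma>) = \<beta> * hamil k b n \<sigma> - 2 * (\<sigma> v * fld \<sigma> v)"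
proof -
  have "(\<Sum>u\<in>V - {v}. flip v \<sigma> u * fld (flip v \<sigma>) u)
      = (\<Sum>u\<in>V - {v}. \<sigma> u * fld \<sigma> u - 2 * \<sigma> v * (J v u * \<sigma> u))"
  proof (intro sum.cong refl)
    fix u assume u: "u \<in> V - {v}"
    then have "flip v \<sigma> u = \<sigma> u" by (simp add: flip_def)
    then show "flip v \<sigma> u * fld (flip v \<sigma>) u = \<sigma> u * fld \<sigma> u - 2 * \<sigma> v * (J v u * \<sigma> u)"
      using u v J_sym[of u v] by (simp add: fld_flip_other algebra_simps)
  qed
  also have "\<dots> = (\<Sum>u\<in>V - {v}. \<sigma> u * fld \<sigma> u) - 2 * \<sigma> v * fld \<sigma> v"
    by (simp add: sum_subtractf fld_def sum_distrib_left)
  finally show ?thesis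
    unfolding hamil_eq sum.remove[OF finite_atLeastAtMost v] by (simp add: flip_same)
qed

lemma w_detailed_balance:
  assumes \<sigma>: "\<sigma> \<in> \<Omega>" and v: "v \<in> V"
  shows "w (flip v \<sigma>) * flip_prob v (flip v \<sigma>) = w \<sigma> * flip_prob v \<sigma>"
proof -
  let ?y = "\<sigma> v * fld \<sigma> v"
  have th: "\<sigma> v * th \<sigma> v = tanh ?y" using config_cases[OF \<sigma> v] by (auto simp: th_def)
  have e: "exp (- 2 * ?y) * (1 + \<sigma> v * th \<sigma> v) = 1 - \<sigma> v * th \<sigma> v"
    unfolding th by (rule exp_times_one_plus_tanh)
  have "exp (\<beta> * hamil k b n (flip v \<sigma>)) = exp (\<beta> * hamil k b n \<sigma>) * exp (- 2 * ?y)"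
    unfolding hamil_flip[OF v] by (simp flip: exp_add)
  then have "w (flip v \<sigma>) * (1 + \<sigma> v * th \<sigma> v) = w \<sigma> * (exp (- 2 * ?y) * (1 + \<sigma> v * th \<sigma> v))"
    by (simp add: gibbs_def)
  then have "w (flip v \<sigma>) * (1 + \<sigma> v * th \<sigma> v) = w \<sigma> * (1 - \<sigma> v * th \<sigma> v)"
    unfolding e .
  then have "w (flip v \<sigma>) * (1 + \<sigma> v * th \<sigma> v) / (2 * n) = w \<sigma> * (1 - \<sigma> v * th \<sigma> v) / (2 * n)"
    by (rule arg_cong)
  then show ?thesis by (simp add: flip_prob_def flip_same)
qed

section \<open>Total variation through indicator functions\<close>

lemma tv_sums:
  assumes \<sigma>: "\<sigma> \<in> \<Omega>" and A: "A \<subseteq> \<Omega>"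
  shows "(\<Sum>\<tau>\<in>A. glauber_pow k b \<beta> n t \<sigma> \<tau>) = (P ^^ t) (indicator A) \<sigma>"
    "(\<Sum>\<tau>\<in>A. w \<tau>) = (\<Sum>\<tau>\<in>\<Omega>. w \<tau> * indicator A \<tau>)"
proof -
  have *: "(\<Sum>\<tau>\<in>A. h \<tau>) = (\<Sum>\<tau>\<in>\<Omega>. h \<tau> * indicator A \<tau>)" for h :: "_ \<Rightarrow> real"
    by (rule sum.mono_neutral_cong_left) (use A in \<open>auto simp: indicator_def\<close>)
  show "(\<Sum>\<tau>\<in>A. w \<tau>) = (\<Sum>\<tau>\<in>\<Omega>. w \<tau> * indicator A \<tau>)" by (rule *)
  show "(\<Sum>\<tau>\<in>A. glauber_pow k b \<beta> n t \<sigma> \<tau>) = (P ^^ t) (indicator A) \<sigma>"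
    unfolding * sum_glauber_pow[OF \<sigma>] ..
qed

lemma tv_dist_eq:
  assumes "\<sigma> \<in> \<Omega>"
  shows "tv_dist n (glauber_pow k b \<beta> n t \<sigma>) w =
    Max ((\<lambda>A. \<bar>(P ^^ t) (indicator A) \<sigma> - (\<Sum>\<tau>\<in>\<Omega>. w \<tau> * indicator A \<tau>)\<bar>) ` Pow \<Omega>)"
  unfolding tv_dist_def
  by (rule arg_cong[where f = Max], rule image_cong) (simp_all only: Pow_iff tv_sums[OF assms])

lemma configs_nonempty: "\<Omega> \<noteq> {}"
  using partition_pos by force

lemma mix_dist_le:
  assumes "\<And>\<sigma> A. \<sigma> \<in> \<Omega> \<Longrightarrow> A \<subseteq> \<Omega> \<Longrightarrow>
    \<bar>(P ^^ t) (indicator A) \<sigma> - (\<Sum>\<tau>\<in>\<Omega>. w \<tau> * indicator A \<tau>)\<bar> \<le> d"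
  shows "mix_dist k b \<beta> n t \<le> d"
proof -
  have "tv_dist n (glauber_pow k b \<beta> n t \<sigma>) w \<le> d" if "\<sigma> \<in> \<Omega>" for \<sigma>
    unfolding tv_dist_eq[OF that] using assms[OF that]
    by (subst Max_le_iff) auto
  then show ?thesis unfolding mix_dist_def using configs_nonempty by (subst Max_le_iff) auto
qed

lemma mix_dist_ge:
  assumes \<sigma>: "\<sigma> \<in> \<Omega>" and A: "A \<subseteq> \<Omega>"
  shows "(P ^^ t) (indicator A) \<sigma> - (\<Sum>\<tau>\<in>\<Omega>. w \<tau> * indicator A \<tau>) \<le> mix_dist k b \<beta> n t"
proof -
  have "(P ^^ t) (indicator A) \<sigma> - (\<Sum>\<tau>\<in>\<Omega>. w \<tau> * indicator A \<tau>) \<le>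
      \<bar>(P ^^ t) (indicator A) \<sigma> - (\<Sum>\<tau>\<in>\<Omega>. w \<tau> * indicator A \<tau>)\<bar>" by simp
  also have "\<dots> \<le> tv_dist n (glauber_pow k b \<beta> n t \<sigma>) w"
    unfolding tv_dist_eq[OF \<sigma>] using A by (intro Max_ge) auto
  also have "\<dots> \<le> mix_dist k b \<beta> n t"
    unfolding mix_dist_def using \<sigma> by (intro Max_ge) auto
  finally show ?thesis .
qed

lemma w_indicator_bounds:
  "0 \<le> (\<Sum>\<tau>\<in>\<Omega>. w \<tau> * indicator A \<tau>)" "(\<Sum>\<tau>\<in>\<Omega>. w \<tau> * indicator A \<tau>) \<le> 1"
proof -
  show "0 \<le> (\<Sum>\<tau>\<in>\<Omega>. w \<tau> * indicator A \<tau>)" using w_nonneg by (intro sum_nonneg) auto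
  have "(\<Sum>\<tau>\<in>\<Omega>. w \<tau> * indicator A \<tau>) \<le> (\<Sum>\<tau>\<in>\<Omega>. w \<tau> * 1)"
    using w_nonneg by (intro sum_mono mult_left_mono) (auto simp: indicator_def)
  then show "(\<Sum>\<tau>\<in>\<Omega>. w \<tau> * indicator A \<tau>) \<le> 1" using w_sum by simp
qed

lemma mix_dist_bounds: "0 \<le> mix_dist k b \<beta> n t" "mix_dist k b \<beta> n t \<le> 1"
proof -
  obtain \<sigma> where "\<sigma> \<in> \<Omega>" using configs_nonempty by auto
  moreover have "indicator {} = (\<lambda>_ :: nat \<Rightarrow> real. 0 :: real)"
    by (simp add: fun_eq_iff)
  ultimately show "0 \<le> mix_dist k b \<beta> n t"
    using mix_dist_ge[of \<sigma> "{}" t] by (simp add: Pt_const)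
  show "mix_dist k b \<beta> n t \<le> 1"
  proof (rule mix_dist_le)
    fix \<sigma> A assume "\<sigma> \<in> \<Omega>"
    then have "0 \<le> (P ^^ t) (indicator A) \<sigma>" "(P ^^ t) (indicator A) \<sigma> \<le> 1"
      by (auto intro!: Pt_ge_const Pt_le_const simp: indicator_def)
    then show "\<bar>(P ^^ t) (indicator A) \<sigma> - (\<Sum>\<tau>\<in>\<Omega>. w \<tau> * indicator A \<tau>)\<bar> \<le> 1"
      using w_indicator_bounds[of A] by linarith
  qed
qed

lemma grad_bound_nonneg: "grad_bound \<ge> 0"
  using grad_bound_pos by simp

lemma mix_dist_upper:
  assumes t: "t \<ge> n" and amin: "amin > 0" "\<And>i. i < m \<Longrightarrow> amin \<le> a i"
  shows "mix_dist k b \<beta> n t \<le> \<rho> ^ (t - n) * (2 * m * sqrt (2 * grad_bound * n)) / amin"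
proof (rule mix_dist_le)
  fix \<sigma> A assume \<sigma>: "\<sigma> \<in> \<Omega>"
  \<comment> \<open>At most \<open>2 * m\<close> classes, whatever the starting point; this makes
    the bound uniform over it.\<close>
  let ?cls = "\<lambda>v. (b v, \<sigma> v)"
  have sub: "?cls ` V \<subseteq> {..<m} \<times> {-1, 1}"
  proof (rule image_subsetI)
    fix v assume v: "v \<in> V"
    show "?cls v \<in> {..<m} \<times> {-1, 1}" using b_less[OF v] config_cases[OF \<sigma> v] by auto
  qed
  have "card (?cls ` V) \<le> card ({..<m} \<times> {-1, 1 :: real})"
    by (rule card_mono[OF _ sub]) simp
  then have "card (?cls ` V) \<le> 2 * m" by (simp add: card_cartesian_product)
  then have c2m: "real (card (?cls ` V)) \<le> 2 * m" by linarith
  have "\<bar>(P ^^ (t - n + n)) (indicator A) \<sigma> - (\<Sum>\<tau>\<in>\<Omega>. w \<tau> * indicator A \<tau>)\<bar>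
      \<le> \<rho> ^ (t - n) * (card (?cls ` V) * sqrt (2 * grad_bound * n)) / amin"
  proof (rule upper_bound[OF \<sigma>])
    show "\<bar>indicator A \<tau>\<bar> \<le> (1::real)" for \<tau> by (simp add: indicator_def)
    show "J v u = J v' u'" if "?cls v = ?cls v'" "?cls u = ?cls u'" for v u v' u'
      using that by (simp add: J_def Kint_def)
    show "amin \<le> a (b v)" if "v \<in> V" for v using amin(2) b_less[OF that] .
  qed (use w_nonneg w_sum w_aut w_detailed_balance amin in auto)
  also have "\<dots> \<le> \<rho> ^ (t - n) * (2 * m * sqrt (2 * grad_bound * n)) / amin"
    using c2m \<rho>_nonneg grad_bound_pos amin by (intro divide_right_mono mult_left_mono mult_right_mono) auto
  finally show "\<bar>(P ^^ t) (indicator A) \<sigma> - (\<Sum>\<tau>\<in>\<Omega>. w \<tau> * indicator A \<tau>)\<bar>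
      \<le> \<rho> ^ (t - n) * (2 * m * sqrt (2 * grad_bound * n)) / amin" using t by simp
qed

text \<open>Stationarity equates the means of \<open>Q\<close> and \<open>P Q\<close>, so the drift
  inequality \<open>P_Q_le\<close> can be solved for that mean.\<close>

lemma gibbs_Q_le: "(\<Sum>\<sigma>\<in>\<Omega>. w \<sigma> * Q \<sigma>) \<le> Q_err / (2 * c * n)"
proof -
  let ?q = "\<Sum>\<sigma>\<in>\<Omega>. w \<sigma> * Q \<sigma>"
  have "?q = (\<Sum>\<sigma>\<in>\<Omega>. w \<sigma> * P Q \<sigma>)"
    by (rule stationary_P[symmetric]) (rule w_detailed_balance)
  also have "\<dots> \<le> (\<Sum>\<sigma>\<in>\<Omega>. w \<sigma> * ((1 - 2 * c / n) * Q \<sigma> + Q_err / n\<^sup>2))"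
    using P_Q_le w_nonneg by (intro sum_mono mult_left_mono) auto
  also have "\<dots> = (\<Sum>\<sigma>\<in>\<Omega>. (1 - 2 * c / n) * (w \<sigma> * Q \<sigma>) + Q_err / n\<^sup>2 * w \<sigma>)"
    by (intro sum.cong) (auto simp: algebra_simps)
  also have "\<dots> = (1 - 2 * c / n) * ?q + Q_err / n\<^sup>2"
    by (simp only: sum.distrib sum_distrib_left[symmetric] w_sum mult_1_right)
  finally have "2 * c / n * ?q \<le> Q_err / n\<^sup>2" by (simp add: algebra_simps)
  then show ?thesis using n_pos c_pos by (simp add: field_simps power2_eq_square)
qed

text \<open>The event \<open>M \<ge> E / 2\<close> separates the two laws. Under the chain the mean
  is at least \<open>E\<close>, and Chebyshev gives the 16; under the Gibbs measure Markov's
  inequality for \<open>M\<^sup>2 \<le> Q\<close> gives the \<open>2 * Q_err\<close>.\<close>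

lemma mix_dist_lower:
  assumes E: "E > 0" "E \<le> \<rho> ^ t * (start_level - start_err / n) - U_err / (c * n)"
  shows "mix_dist k b \<beta> n t \<ge> 1 - (16 + 2 * Q_err) / (c * n * E\<^sup>2)"
proof -
  obtain \<sigma> where \<sigma>: "\<sigma> \<in> \<Omega>" and U: "U \<sigma> \<ge> start_level - start_err / n" by (rule starting_U)
  define e where "e = (P ^^ t) M \<sigma>"
  have "\<rho> ^ t * (start_level - start_err / n) \<le> \<rho> ^ t * U \<sigma>" using U \<rho>_nonneg by (intro mult_left_mono) auto
  then have e: "E \<le> e" using E Pt_M_ge[OF \<sigma>, of t] by (simp add: e_def)
  define A where "A = {\<tau> \<in> \<Omega>. M \<tau> \<ge> E / 2}"
  have E2: "E\<^sup>2 > 0" using E by simp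
  have "1 - 16 / (c * n * E\<^sup>2) \<le> (P ^^ t) (indicator A) \<sigma>"
  proof -
    \<comment> \<open>Chebyshev as a pointwise inequality; the square is expanded, with subtraction
      as a negative multiple, so that \<open>Pt_add\<close> and \<open>Pt_cmult\<close>
      apply.\<close>
    have ind: "1 + (- (4 / E\<^sup>2)) * ((M \<tau>)\<^sup>2 + (- 2 * e) * M \<tau> + e\<^sup>2) \<le> indicator A \<tau>" if \<tau>: "\<tau> \<in> \<Omega>" for \<tau>
    proof -
      have sq: "(M \<tau>)\<^sup>2 + (- 2 * e) * M \<tau> + e\<^sup>2 = (e - M \<tau>)\<^sup>2"
        by (simp add: power2_eq_square algebra_simps)
      show ?thesis
      proof (cases "\<tau> \<in> A")
        case True
        then show ?thesis unfolding sq using E2 by simp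
      next
        case False
        then have "E / 2 \<le> e - M \<tau>" using \<tau> e by (simp add: A_def)
        then have "(E / 2)\<^sup>2 \<le> (e - M \<tau>)\<^sup>2" using E by (intro power_mono) auto
        then have "4 / E\<^sup>2 * (E / 2)\<^sup>2 \<le> 4 / E\<^sup>2 * (e - M \<tau>)\<^sup>2" using E2 by (intro mult_left_mono) auto
        moreover have "4 / E\<^sup>2 * (E / 2)\<^sup>2 = 1" using E2 by (simp add: power_divide)
        ultimately have "1 \<le> 4 / E\<^sup>2 * (e - M \<tau>)\<^sup>2" by simp
        moreover have "indicator A \<tau> = (0::real)" using False by simp
        ultimately show ?thesis unfolding sq by (simp only: mult_minus_left)
      qed
    qed
    have "(P ^^ t) (\<lambda>\<tau>. 1 + (- (4 / E\<^sup>2)) * ((M \<tau>)\<^sup>2 + (- 2 * e) * M \<tau> + e\<^sup>2)) \<sigma> \<le> (P ^^ t) (indicator A) \<sigma>"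
      using ind \<sigma> by (rule Pt_mono)
    moreover have "(P ^^ t) (\<lambda>\<tau>. 1 + (- (4 / E\<^sup>2)) * ((M \<tau>)\<^sup>2 + (- 2 * e) * M \<tau> + e\<^sup>2)) \<sigma>
        = 1 - 4 / E\<^sup>2 * ((P ^^ t) (\<lambda>\<tau>. (M \<tau>)\<^sup>2) \<sigma> - e\<^sup>2)"
      unfolding Pt_add Pt_const Pt_cmult e_def by (simp add: power2_eq_square algebra_simps)
    moreover have "4 / E\<^sup>2 * ((P ^^ t) (\<lambda>\<tau>. (M \<tau>)\<^sup>2) \<sigma> - e\<^sup>2) \<le> 4 / E\<^sup>2 * (4 / (c * n))"
      unfolding e_def using E2 by (intro mult_left_mono Pt_M_variance_le \<sigma>) auto
    moreover have "4 / E\<^sup>2 * (4 / (c * n)) = 16 / (c * n * E\<^sup>2)" by simp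
    ultimately show ?thesis by linarith
  qed
  moreover have "(\<Sum>\<tau>\<in>\<Omega>. w \<tau> * indicator A \<tau>) \<le> 2 * Q_err / (c * n * E\<^sup>2)"
  proof -
    have "(\<Sum>\<tau>\<in>\<Omega>. w \<tau> * indicator A \<tau>) \<le> (\<Sum>\<tau>\<in>\<Omega>. 4 / E\<^sup>2 * (w \<tau> * Q \<tau>))"
    proof (intro sum_mono)
      fix \<tau> assume \<tau>: "\<tau> \<in> \<Omega>"
      have "indicator A \<tau> \<le> 4 / E\<^sup>2 * Q \<tau>"
      proof (cases "\<tau> \<in> A")
        case True
        then have "(E / 2)\<^sup>2 \<le> (M \<tau>)\<^sup>2" using E by (intro power_mono) (auto simp: A_def)
        also have "\<dots> \<le> Q \<tau>" by (rule M_square_le)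
        finally show ?thesis using True E2 by (simp add: power_divide field_simps)
      qed (use Q_nonneg in simp)
      then have "w \<tau> * indicator A \<tau> \<le> w \<tau> * (4 / E\<^sup>2 * Q \<tau>)"
        using w_nonneg by (intro mult_left_mono)
      then show "w \<tau> * indicator A \<tau> \<le> 4 / E\<^sup>2 * (w \<tau> * Q \<tau>)" by (simp add: ac_simps)
    qed
    also have "\<dots> = 4 / E\<^sup>2 * (\<Sum>\<tau>\<in>\<Omega>. w \<tau> * Q \<tau>)" by (simp add: sum_distrib_left)
    also have "\<dots> \<le> 4 / E\<^sup>2 * (Q_err / (2 * c * n))"
      using gibbs_Q_le E2 by (intro mult_left_mono) auto
    also have "\<dots> = 2 * Q_err / (c * n * E\<^sup>2)" by (simp add: ac_simps)
    finally show ?thesis .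
  qed
  moreover have "(P ^^ t) (indicator A) \<sigma> - (\<Sum>\<tau>\<in>\<Omega>. w \<tau> * indicator A \<tau>) \<le> mix_dist k b \<beta> n t"
    using \<sigma> by (intro mix_dist_ge) (auto simp: A_def)
  ultimately show ?thesis by (simp add: add_divide_distrib)
qed

end

section \<open>Cutoff\<close>

lemma sqrt_eq_exp: "n > 0 \<Longrightarrow> sqrt (real n) = exp (ln n / 2)"
  by (simp add: ln_sqrt[symmetric])

text \<open>The 2 in the exponent pays for \<open>c\<close>, spent on the n smoothing steps, and for
  \<open>c / n\<close>, lost to the floor.\<close>

lemma late_time_bound:
  fixes c \<gamma> :: real and n :: nat
  assumes n: "n > 0" and c: "0 < c" "c \<le> 1" and \<gamma>: "\<gamma> \<ge> 1"
  defines "t \<equiv> nat \<lfloor>n * ln n / (2 * c) + \<gamma> * real n\<rfloor>"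
  shows "t \<ge> n" "(1 - c / n) ^ (t - n) * sqrt n \<le> exp (2 - c * \<gamma>)"
proof -
  define y where "y = n * ln n / (2 * c) + \<gamma> * n"
  have n1: "real n \<ge> 1" using n by simp
  have "0 \<le> n * ln n / (2 * c)" using n1 c by simp
  moreover have "1 * real n \<le> \<gamma> * n" using \<gamma> by (intro mult_right_mono) auto
  ultimately have y: "y \<ge> n" by (simp add: y_def)
  then have "t \<ge> n" unfolding t_def y_def[symmetric] by (simp add: le_nat_floor)
  then show "t \<ge> n" .
  have "real t \<ge> y - 1" unfolding t_def y_def[symmetric] using y n1 by linarith
  then have s: "real (t - n) \<ge> y - 1 - n" using \<open>t \<ge> n\<close> by (simp add: of_nat_diff)
  have "c / n \<le> 1 / 1" using n1 c by (intro frac_le) auto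
  then have "(1 - c / n) ^ (t - n) \<le> exp (- (c / n)) ^ (t - n)"
    using exp_ge_add_one_self[of "- (c / n)"] by (intro power_mono) auto
  also have "\<dots> = exp (- (c / n * (t - n)))" by (simp add: mult.commute flip: exp_of_nat_mult)
  also have "\<dots> \<le> exp (2 - c * \<gamma> - ln n / 2)"
  proof -
    have "c / n * (y - 1 - n) \<le> c / n * (t - n)" using s c by (intro mult_left_mono) auto
    moreover have "c / n * (y - 1 - n) = ln n / 2 + c * \<gamma> - c / n - c"
      using n1 c by (simp add: y_def field_simps)
    ultimately show ?thesis using \<open>c / n \<le> 1 / 1\<close> c by simp
  qed
  finally have "(1 - c / n) ^ (t - n) * sqrt n \<le> exp (2 - c * \<gamma> - ln n / 2) * sqrt n"
    by (intro mult_right_mono) auto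
  also have "\<dots> = exp (2 - c * \<gamma>)" unfolding sqrt_eq_exp[OF n] by (simp flip: exp_add)
  finally show "(1 - c / n) ^ (t - n) * sqrt n \<le> exp (2 - c * \<gamma>)" .
qed

text \<open>1 - c/n \<ge> exp (- c/(n - c)), and replacing c/n by c/(n - c) over this time costs at
  most 1 in the exponent. The condition on \<open>ln n\<close> keeps the time nonnegative, so that
  \<open>nat\<close> does not truncate it.\<close>

lemma early_time_bound:
  fixes c \<gamma> :: real and n :: nat
  assumes n: "n \<ge> 2" and c: "0 < c" "c \<le> 1" and \<gamma>: "\<gamma> \<ge> 0" "2 * c * \<gamma> \<le> ln n"
  defines "t \<equiv> nat \<lfloor>n * ln n / (2 * c) - \<gamma> * real n\<rfloor>"
  shows "(1 - c / n) ^ t * sqrt n \<ge> exp (c * \<gamma> - 1)"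
proof -
  define y where "y = n * ln n / (2 * c) - \<gamma> * n"
  have n2: "real n \<ge> 2" using n by simp
  have nc: "n - c > 0" using n2 c by simp
  have "n * (2 * c * \<gamma>) \<le> n * ln n" using \<gamma> by (intro mult_left_mono) auto
  then have "y \<ge> 0" using c by (simp add: y_def field_simps)
  then have t: "real t \<le> y" unfolding t_def y_def[symmetric] by simp
  have "1 + c / (n - c) \<le> exp (c / (n - c))" by (rule exp_ge_add_one_self)
  then have "exp (- (c / (n - c))) \<le> 1 / (1 + c / (n - c))"
    using nc c unfolding exp_minus inverse_eq_divide by (intro divide_left_mono mult_pos_pos add_pos_pos) auto
  also have "\<dots> = 1 - c / n" using nc n2 by (simp add: field_simps)
  finally have "exp (- (c / (n - c))) ^ t \<le> (1 - c / n) ^ t" by (intro power_mono) auto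
  then have p: "exp (- (c / (n - c) * t)) \<le> (1 - c / n) ^ t"
    by (simp flip: exp_of_nat_mult) (simp add: mult.commute)
  have "c / (n - c) * t \<le> c / (n - c) * y" using t nc c by (intro mult_left_mono) auto
  also have "\<dots> = (ln n / 2 - c * \<gamma>) + c / (n - c) * (ln n / 2 - c * \<gamma>)"
    using nc c by (simp add: y_def field_simps)
  also have "c / (n - c) * (ln n / 2 - c * \<gamma>) \<le> c / (n - c) * (n - c)"
  proof (intro mult_left_mono)
    have "ln n \<le> n - 1" using ln_le_minus_one[of n] n2 by simp
    then show "ln n / 2 - c * \<gamma> \<le> n - c" using c \<gamma> n2 mult_nonneg_nonneg[of c \<gamma>] by linarith
  qed (use nc c in auto)
  also have "c / (n - c) * (n - c) \<le> 1" using nc c by simp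
  finally have "exp (c * \<gamma> - 1 - ln n / 2) \<le> exp (- (c / (n - c) * t))" by simp
  also note p
  finally have "exp (c * \<gamma> - 1 - ln n / 2) * sqrt n \<le> (1 - c / n) ^ t * sqrt n"
    by (intro mult_right_mono) auto
  moreover have "exp (c * \<gamma> - 1 - ln n / 2) * sqrt n = exp (c * \<gamma> - 1)"
    using n by (simp add: sqrt_eq_exp flip: exp_add)
  ultimately show ?thesis by simp
qed

lemma tendsto_exp_decay:
  fixes c C :: real
  assumes "c > 0"
  shows "((\<lambda>\<gamma>. C * exp (- (c * \<gamma>))) \<longlongrightarrow> 0) at_top"
proof -
  have "filterlim (\<lambda>\<gamma>. c * \<gamma>) at_top at_top"
    by (rule filterlim_tendsto_pos_mult_at_top[OF tendsto_const assms filterlim_ident])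
  then have "filterlim (\<lambda>\<gamma>. - (c * \<gamma>)) at_bot at_top"
    by (simp add: filterlim_uminus_at_top)
  from filterlim_compose[OF exp_at_bot this] show ?thesis by (rule tendsto_mult_right_zero)
qed

section \<open>Uniform bounds and passage to the limit\<close>

lemma mix_dist_cutoff_bounds:
  fixes m :: nat and p :: "nat \<Rightarrow> real" and k :: "nat \<Rightarrow> nat \<Rightarrow> real" and \<beta> :: real
    and blk :: "nat \<Rightarrow> nat \<Rightarrow> nat"
  assumes "m \<ge> 1"
    and "\<forall>i<m. p i > 0" and "(\<Sum>i<m. p i) = 1"
    and "\<forall>i<m. \<forall>j<m. k i j = k j i"
    and "\<forall>i<m. \<forall>j<m. i \<noteq> j \<longrightarrow> k i j > 0"
    and "\<forall>i<m. k i i \<ge> 0"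
    and "\<beta> \<ge> 0" and "\<beta> < beta_cr m p k"
    and "\<forall>n. admissible m p n \<longrightarrow>
           (\<forall>v\<in>{1..n}. blk n v < m) \<and>
           (\<forall>i<m. real (card {v\<in>{1..n}. blk n v = i}) = real n * p i)"
  obtains c Cu Cl where "c > 0"
    and "\<forall>n t. admissible m p n \<longrightarrow> 0 \<le> mix_dist k (blk n) \<beta> n t \<and> mix_dist k (blk n) \<beta> n t \<le> 1"
    and "\<forall>n. \<forall>\<gamma>\<ge>1. admissible m p n \<longrightarrow>
      mix_dist k (blk n) \<beta> n (nat \<lfloor>cutoff_time m p k \<beta> n + \<gamma> * real n\<rfloor>) \<le> Cu * exp (- (c * \<gamma>))"
    and "\<forall>\<gamma>\<ge>0. \<exists>N. \<forall>n\<ge>N. admissible m p n \<longrightarrow> 1 - Cl * exp (- (2 * c * \<gamma>))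
      \<le> mix_dist k (blk n) \<beta> n (nat \<lfloor>cutoff_time m p k \<beta> n - \<gamma> * real n\<rfloor>)"
proof -
  obtain a l where a: "\<forall>i<m. a i > 0" "(\<Sum>i<m. a i) = 1"
    "\<forall>j<m. (\<Sum>i<m. a i * p i * k i j) = l * a j" and l: "l > 0" "\<beta> * l < 1"
    and al: "\<forall>n>0. alpha m p k \<beta> n = 1 / (2 * (1 - \<beta> * l))"
    by (rule perron_facts[OF assms(1,2,4-8)])
  define S where "S = {n. admissible m p n}"
  define c where "c = 1 - \<beta> * l"
  \<comment> \<open>A crude bound on all couplings; only its independence of \<open>n\<close>
    matters.\<close>
  define \<kappa> where "\<kappa> = \<beta> * (\<Sum>i<m. \<Sum>j<m. k i j)"
  have knn: "k i j \<ge> 0" if "i < m" "j < m" for i j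
    using assms(5,6) that by (cases "i = j") (auto simp: less_imp_le)
  have k\<kappa>: "\<beta> * k i j \<le> \<kappa>" if "i < m" "j < m" for i j
  proof -
    have "k i j \<le> (\<Sum>j<m. k i j)" using that knn by (intro member_le_sum) auto
    also have "\<dots> \<le> (\<Sum>i<m. \<Sum>j<m. k i j)"
      using that knn by (intro member_le_sum[of i _ "\<lambda>i. \<Sum>j<m. k i j"] sum_nonneg) auto
    finally show ?thesis unfolding \<kappa>_def using assms(7) by (intro mult_left_mono)
  qed
  have loc: "block_ising m p k \<beta> n (blk n) a l \<kappa>" if "n \<in> S" for n
    using that assms(2-9) a l knn k\<kappa> by unfold_locales (auto simp: S_def admissible_def)
  have S0: "n > 0" if "n \<in> S" for n using that by (simp add: S_def admissible_def)
  have c: "0 < c" "c \<le> 1" using l assms(7) by (auto simp: c_def)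
  have ct: "cutoff_time m p k \<beta> n = n * ln n / (2 * c)" if "n \<in> S" for n
    using al S0[OF that] by (simp add: cutoff_time_def c_def)
  have \<rho>: "ising_contraction.\<rho> n (\<beta> * l) = 1 - c / n" if "n \<in> S" for n
    using block_ising.\<rho>_eq[OF loc[OF that]] block_ising.c_def[OF loc[OF that]] by (simp add: c_def)
  have mix01: "0 \<le> mix_dist k (blk n) \<beta> n t" "mix_dist k (blk n) \<beta> n t \<le> 1" if "n \<in> S" for n t
    using block_ising.mix_dist_bounds[OF loc[OF that]] by auto

  define amin where "amin = Min (a ` {..<m})"
  have "{..<m} \<noteq> {}" using assms(1) by (simp add: lessThan_empty_iff)
  then have amin0: "amin > 0" unfolding amin_def using a(1) by (subst Min_gr_iff) auto
  have amin: "amin \<le> a i" if "i < m" for i unfolding amin_def using that by (intro Min_le) auto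
  define Cu where "Cu = 2 * m * sqrt (2 * ising.grad_bound \<kappa>) / amin * exp 2"
  have upper: "mix_dist k (blk n) \<beta> n (nat \<lfloor>cutoff_time m p k \<beta> n + \<gamma> * real n\<rfloor>) \<le> Cu * exp (- (c * \<gamma>))"
    if n: "n \<in> S" and \<gamma>: "\<gamma> \<ge> 1" for n \<gamma>
  proof -
    let ?t = "nat \<lfloor>cutoff_time m p k \<beta> n + \<gamma> * real n\<rfloor>"
    note late = late_time_bound[OF S0[OF n] c \<gamma>, folded ct[OF n]]
    have "mix_dist k (blk n) \<beta> n ?t \<le> (1 - c / n) ^ (?t - n) * (2 * m * sqrt (2 * ising.grad_bound \<kappa> * n)) / amin"
      using block_ising.mix_dist_upper[OF loc[OF n] late(1) amin0 amin] \<rho>[OF n] by simp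
    also have "\<dots> = 2 * m * sqrt (2 * ising.grad_bound \<kappa>) / amin * ((1 - c / n) ^ (?t - n) * sqrt n)"
      by (simp add: real_sqrt_mult)
    also have "\<dots> \<le> 2 * m * sqrt (2 * ising.grad_bound \<kappa>) / amin * exp (2 - c * \<gamma>)"
    proof (intro mult_left_mono late(2))
      show "0 \<le> 2 * m * sqrt (2 * ising.grad_bound \<kappa>) / amin"
        using block_ising.grad_bound_nonneg[OF loc[OF n]] amin0 by simp
    qed
    also have "\<dots> = Cu * exp (- (c * \<gamma>))" by (simp add: Cu_def exp_diff exp_minus divide_inverse)
    finally show ?thesis .
  qed

  define Q_err where "Q_err = block_ising.Q_err m \<kappa>"
  define U_err where "U_err = block_ising.U_err m \<beta> l \<kappa>"
  define start_err where "start_err = block_ising.start_err m p \<beta> l \<kappa>"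
  define start_level where "start_level = block_ising.start_level m p \<beta> a l \<kappa>"
  define Cl where "Cl = (16 + 2 * Q_err) * 16 * exp 2 / (c * start_level\<^sup>2)"
  have lower: "\<exists>N. \<forall>n\<ge>N. n \<in> S \<longrightarrow> 1 - Cl * exp (- (2 * c * \<gamma>))
      \<le> mix_dist k (blk n) \<beta> n (nat \<lfloor>cutoff_time m p k \<beta> n - \<gamma> * real n\<rfloor>)" if \<gamma>: "\<gamma> \<ge> 0" for \<gamma>
  proof -
    \<comment> \<open>A sum in place of a maximum: the summands ensure in turn n \<ge> 2, a
      nonnegative time, a rounding loss of at most half of \<open>start_level\<close>, and
      \<open>U_err / (c * n) \<le> E\<close>.\<close>
    define N where "N = nat \<lceil>2 + exp (2 * c * \<gamma>) + \<bar>2 * start_err / start_level\<bar> + (4 * exp 1 * U_err / (c * start_level))\<^sup>2\<rceil>"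
    show ?thesis
    proof (intro exI[of _ N] allI impI)
      fix n assume nN: "n \<ge> N" and n: "n \<in> S"
      have start_level: "start_level > 0" unfolding start_level_def by (rule block_ising.start_level_pos[OF loc[OF n]])
      have "2 + exp (2 * c * \<gamma>) + \<bar>2 * start_err / start_level\<bar> + (4 * exp 1 * U_err / (c * start_level))\<^sup>2 \<le> n"
        using nN unfolding N_def by linarith
      then have n2: "real n \<ge> 2" and ne: "exp (2 * c * \<gamma>) \<le> n" and n5: "2 * start_err / start_level \<le> n"
        and n4: "(4 * exp 1 * U_err / (c * start_level))\<^sup>2 \<le> n"
        using exp_ge_zero[of "2 * c * \<gamma>"] zero_le_power2[of "4 * exp 1 * U_err / (c * start_level)"] by linarith+
      let ?t = "nat \<lfloor>cutoff_time m p k \<beta> n - \<gamma> * real n\<rfloor>"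
      have "2 * c * \<gamma> \<le> ln n" using ne n2 by (simp add: ln_ge_iff)
      from early_time_bound[OF _ c \<gamma> this, folded ct[OF n]] n2
      have early: "exp (c * \<gamma> - 1) \<le> (1 - c / n) ^ ?t * sqrt n" by simp
      \<comment> \<open>Half of \<open>start_level\<close> survives rounding, which leaves
        \<open>2 * E\<close>; one \<open>E\<close> absorbs the drift error and the other is the
        separation level.\<close>
      define E where "E = exp (c * \<gamma> - 1) / sqrt n * (start_level / 4)"
      have sn: "sqrt n > 0" using n2 by simp
      have E0: "E > 0" using start_level sn by (simp add: E_def)
      have "U_err / (c * n) \<le> E"
      proof -
        have "4 * exp 1 * U_err / (c * start_level) \<le> sqrt n" using n4 by (rule real_le_rsqrt)
        then have "U_err / c \<le> exp (- 1) * (start_level / 4) * sqrt n"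
          using c start_level by (simp add: exp_minus field_simps)
        then have "U_err / c / n \<le> exp (- 1) * (start_level / 4) * sqrt n / n"
          using n2 by (intro divide_right_mono) auto
        also have "\<dots> = exp (- 1) / sqrt n * (start_level / 4)"
          using n2 real_sqrt_mult_self[of n] by (simp add: field_simps)
        also have "\<dots> \<le> E" unfolding E_def
          using start_level c \<gamma> sn by (intro mult_right_mono divide_right_mono) auto
        finally show ?thesis by simp
      qed
      moreover have "2 * E \<le> (1 - c / n) ^ ?t * (start_level - start_err / n)"
      proof -
        have "exp (c * \<gamma> - 1) / sqrt n \<le> (1 - c / n) ^ ?t" using early sn by (simp add: field_simps)
        moreover have "start_level / 2 \<le> start_level - start_err / n" using n5 n2 start_level by (simp add: field_simps)
        ultimately have "exp (c * \<gamma> - 1) / sqrt n * (start_level / 2) \<le> (1 - c / n) ^ ?t * (start_level - start_err / n)"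
          using start_level sn by (intro mult_mono) (auto intro: order_trans[rotated])
        then show ?thesis by (simp add: E_def mult.commute)
      qed
      ultimately have "E \<le> ising_contraction.\<rho> n (\<beta> * l) ^ ?t * (start_level - start_err / n) - U_err / (c * n)"
        using \<rho>[OF n] by simp
      from block_ising.mix_dist_lower[OF loc[OF n] E0, of ?t, folded Q_err_def U_err_def start_err_def start_level_def,
          unfolded block_ising.c_def[OF loc[OF n]], folded c_def, OF this]
      have "1 - (16 + 2 * Q_err) / (c * n * E\<^sup>2) \<le> mix_dist k (blk n) \<beta> n ?t" .
      moreover have "(16 + 2 * Q_err) / (c * n * E\<^sup>2) = Cl * exp (- (2 * c * \<gamma>))"
      proof -
        have "n * E\<^sup>2 = exp (c * \<gamma> - 1) ^ 2 * (start_level\<^sup>2 / 16)"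
          using n2 by (simp add: E_def power_mult_distrib power_divide)
        also have "exp (c * \<gamma> - 1) ^ 2 = exp (2 * c * \<gamma>) / exp 2"
          by (simp flip: exp_of_nat_mult exp_diff add: algebra_simps)
        finally have den: "c * n * E\<^sup>2 = c * (exp (2 * c * \<gamma>) / exp 2 * (start_level\<^sup>2 / 16))" by (simp only: mult.assoc)
        show ?thesis unfolding den using c start_level by (simp add: Cl_def exp_minus field_simps)
      qed
      ultimately show "1 - Cl * exp (- (2 * c * \<gamma>)) \<le> mix_dist k (blk n) \<beta> n ?t" by simp
    qed
  qed
  show thesis
    using that[of c Cu Cl] c(1) mix01 upper lower by (simp add: S_def)
qed

theorem theorem3p1:
  fixes m :: nat and p :: "nat \<Rightarrow> real" and k :: "nat \<Rightarrow> nat \<Rightarrow> real" and \<beta> :: real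
    and blk :: "nat \<Rightarrow> nat \<Rightarrow> nat"
  assumes "m \<ge> 1"
    and "\<forall>i<m. p i > 0" and "(\<Sum>i<m. p i) = 1"
    and "\<forall>i<m. \<forall>j<m. k i j = k j i"
    and "\<forall>i<m. \<forall>j<m. i \<noteq> j \<longrightarrow> k i j > 0"
    and "\<forall>i<m. k i i \<ge> 0"
    and "\<beta> \<ge> 0" and "\<beta> < beta_cr m p k"
    and "\<forall>n. admissible m p n \<longrightarrow>
           (\<forall>v\<in>{1..n}. blk n v < m) \<and>
           (\<forall>i<m. real (card {v\<in>{1..n}. blk n v = i}) = real n * p i)"
    and "infinite {n. admissible m p n}"
  shows "(((\<lambda>\<gamma>::real. Limsup (inf sequentially (principal {n. admissible m p n}))
            (\<lambda>n. ereal (mix_dist k (blk n) \<beta> n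
               (nat \<lfloor>cutoff_time m p k \<beta> n + \<gamma> * real n\<rfloor>)))) \<longlongrightarrow> 0) at_top) \<and>
         (((\<lambda>\<gamma>::real. Liminf (inf sequentially (principal {n. admissible m p n}))
            (\<lambda>n. ereal (mix_dist k (blk n) \<beta> n
               (nat \<lfloor>cutoff_time m p k \<beta> n - \<gamma> * real n\<rfloor>)))) \<longlongrightarrow> 1) at_top)"
proof -
  obtain c Cu Cl where c: "c > 0"
    and mix01: "\<forall>n t. admissible m p n \<longrightarrow> 0 \<le> mix_dist k (blk n) \<beta> n t \<and> mix_dist k (blk n) \<beta> n t \<le> 1"
    and upper: "\<forall>n. \<forall>\<gamma>\<ge>1. admissible m p n \<longrightarrow>
      mix_dist k (blk n) \<beta> n (nat \<lfloor>cutoff_time m p k \<beta> n + \<gamma> * real n\<rfloor>) \<le> Cu * exp (- (c * \<gamma>))"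
    and lower: "\<forall>\<gamma>\<ge>0. \<exists>N. \<forall>n\<ge>N. admissible m p n \<longrightarrow> 1 - Cl * exp (- (2 * c * \<gamma>))
      \<le> mix_dist k (blk n) \<beta> n (nat \<lfloor>cutoff_time m p k \<beta> n - \<gamma> * real n\<rfloor>)"
    by (rule mix_dist_cutoff_bounds[OF assms(1-9)])
  define S where "S = {n. admissible m p n}"
  define F where "F = inf sequentially (principal S)"
  \<comment> \<open>Infinitely many admissible sizes make the filter proper, which
    \<open>le_Limsup\<close> and \<open>Liminf_le\<close> require.\<close>
  have Fne: "F \<noteq> bot"
    using assms(10) unfolding trivial_limit_def F_def eventually_inf_principal S_def[symmetric]
    by (auto simp: eventually_sequentially infinite_nat_iff_unbounded_le)
  have evF: "eventually Pr F" if "\<And>n. n \<ge> N \<Longrightarrow> admissible m p n \<Longrightarrow> Pr n" for N Pr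
    unfolding F_def S_def eventually_inf_principal eventually_sequentially using that by auto
  have "((\<lambda>\<gamma>. Limsup F (\<lambda>n. ereal (mix_dist k (blk n) \<beta> n
      (nat \<lfloor>cutoff_time m p k \<beta> n + \<gamma> * real n\<rfloor>)))) \<longlongrightarrow> ereal 0) at_top"
  proof (rule tendsto_sandwich)
    show "eventually (\<lambda>\<gamma>. ereal 0 \<le> Limsup F (\<lambda>n. ereal (mix_dist k (blk n) \<beta> n
      (nat \<lfloor>cutoff_time m p k \<beta> n + \<gamma> * real n\<rfloor>)))) at_top"
      using mix01 by (intro always_eventually allI le_Limsup Fne evF[of 0]) auto
    show "eventually (\<lambda>\<gamma>. Limsup F (\<lambda>n. ereal (mix_dist k (blk n) \<beta> n
      (nat \<lfloor>cutoff_time m p k \<beta> n + \<gamma> * real n\<rfloor>))) \<le> ereal (Cu * exp (- (c * \<gamma>)))) at_top"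
      using eventually_ge_at_top[of 1]
    proof eventually_elim
      case (elim \<gamma>)
      then show ?case using upper by (intro Limsup_bounded evF[of 0]) auto
    qed
    show "((\<lambda>\<gamma>. ereal (Cu * exp (- (c * \<gamma>)))) \<longlongrightarrow> ereal 0) at_top"
      using c by (intro tendsto_ereal tendsto_exp_decay)
  qed (rule tendsto_const)
  moreover have "((\<lambda>\<gamma>. Liminf F (\<lambda>n. ereal (mix_dist k (blk n) \<beta> n
      (nat \<lfloor>cutoff_time m p k \<beta> n - \<gamma> * real n\<rfloor>)))) \<longlongrightarrow> ereal 1) at_top"
  proof (rule tendsto_sandwich)
    show "eventually (\<lambda>\<gamma>. ereal (1 - Cl * exp (- (2 * c * \<gamma>))) \<le>
      Liminf F (\<lambda>n. ereal (mix_dist k (blk n) \<beta> n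
      (nat \<lfloor>cutoff_time m p k \<beta> n - \<gamma> * real n\<rfloor>)))) at_top"
      using eventually_ge_at_top[of 0]
    proof eventually_elim
      case (elim \<gamma>)
      obtain N where "\<forall>n\<ge>N. admissible m p n \<longrightarrow> 1 - Cl * exp (- (2 * c * \<gamma>))
          \<le> mix_dist k (blk n) \<beta> n (nat \<lfloor>cutoff_time m p k \<beta> n - \<gamma> * real n\<rfloor>)"
        using lower elim by blast
      then show ?case by (intro Liminf_bounded evF[of N]) simp
    qed
    show "eventually (\<lambda>\<gamma>. Liminf F (\<lambda>n. ereal (mix_dist k (blk n) \<beta> n
      (nat \<lfloor>cutoff_time m p k \<beta> n - \<gamma> * real n\<rfloor>))) \<le> ereal 1) at_top"
      using mix01 by (intro always_eventually allI Liminf_le Fne evF[of 0]) auto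
    have "((\<lambda>\<gamma>. 1 - Cl * exp (- (2 * c * \<gamma>))) \<longlongrightarrow> 1 - 0) at_top"
      using c by (intro tendsto_diff tendsto_const tendsto_exp_decay) auto
    then show "((\<lambda>\<gamma>. ereal (1 - Cl * exp (- (2 * c * \<gamma>)))) \<longlongrightarrow> ereal 1) at_top"
      by (intro tendsto_ereal) simp
  qed (rule tendsto_const)
  ultimately show ?thesis
    unfolding F_def S_def zero_ereal_def one_ereal_def ..
qed

end
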